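(* Let $s>\frac52$ and let $w_0=(\rho_0,u_0,v_0)\in H^{s-1}(\mathbb{R})\times H^s(\mathbb{R})\times H^s(\mathbb{R})$. Let $T=T(w_0)>0$ be the lifespan of the solution $w=(\rho,u,v)$, with initial data $w_0$, of $$\begin{cases}\rho_t+(\rho uv)_x=0,\\ m_t+uvm_x+3vu_xm+\rho^2u=0,\\ n_t+uvn_x+3v_xun-\rho^2v=0,\\ m=u-u_{xx},\quad n=v-v_{xx}.\end{cases}$$ If there exists $\beta\in(0,\infty)$ such that the initial data satisfy $$\left\|(\rho_0,\rho_{0,x},u_0,u_{0,x},u_{0,xx},v_0,v_{0,x},v_{0,xx})\,(\ln(e+\beta+|x|))^\beta\right\|_{L^\infty}\le C_0,$$ then the solution satisfies $$\left\|(\rho,\rho_x,u,u_x,u_{xx},v,v_x,v_{xx})\,(\ln(e+\beta+|x|))^\beta\right\|_{L^\infty}\le C_1$$ uniformly in $t\in[0,T_0]$ for some $T_0<T$. The constant $C_1$ depends on $M$, $C_\beta$, $C_0$.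
   Context: The solution is $w\in C([0,T);H^{s-1}\times H^s\times H^s)$ on $\mathbb{R}$. The $L^\infty$ norm of a tuple is the sum of the $L^\infty$ norms of its components. $M=\sup_{t\in[0,T_0]}\left(\|\rho(t,\cdot)\|_{H^{s-1}}+\|u(t,\cdot)\|_{H^s}+\|v(t,\cdot)\|_{H^s}\right)$. $C_\beta$ is a constant depending only on $\beta$ such that $\psi_N(x)\int_{\mathbb{R}}\frac{e^{-|x-y|}}{\psi_N(y)}dy\le C_\beta$ for all $x\in\mathbb{R}$ and $N\in\mathbb{R}^+$, where $\psi_N(x)=(\ln(e+\beta+|x|))^\beta$ for $0\le|x|<N$ and $\psi_N(x)=(\ln(e+\beta+N))^\beta$ for $|x|\ge N$. *)

theory Defs
  imports "HOL-Probability.Probability"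
begin

section \<open>Sobolev spaces on the real line\<close>

definition square_integrable :: "(real \<Rightarrow> 'a::real_normed_vector) \<Rightarrow> bool" where
  "square_integrable f \<longleftrightarrow> f \<in> borel_measurable lborel \<and> (\<integral>\<^sup>+x. ennreal ((norm (f x))\<^sup>2) \<partial>lborel) < \<infinity>"

text \<open>The \<open>L\<^sup>2\<close> (Plancherel) Fourier transform in the unitary normalisation: \<open>g\<close> is the \<open>L\<^sup>2\<close> limit,
  as \<open>R\<close> tends to infinity, of the transforms of \<open>f\<close> cut off to \<open>[-R, R]\<close>. It is determined up to null
  sets, hence a relation. The distance is a nonnegative integral, so that it cannot vanish for lack
  of integrability.\<close>

definition has_fourier_transform :: "(real \<Rightarrow> real) \<Rightarrow> (real \<Rightarrow> complex) \<Rightarrow> bool" where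
  "has_fourier_transform f g \<longleftrightarrow> square_integrable f \<and> square_integrable g \<and>
     ((\<lambda>R. \<integral>\<^sup>+\<xi>. ennreal ((cmod (g \<xi> -
          (LINT x:{-R..R}|lborel. cis (- (x * \<xi>)) * complex_of_real (f x)) / complex_of_real (sqrt (2 * pi))))\<^sup>2)
        \<partial>lborel) \<longlongrightarrow> 0) at_top"

definition fourier_energy :: "real \<Rightarrow> (real \<Rightarrow> complex) \<Rightarrow> ennreal" where
  "fourier_energy s g = (\<integral>\<^sup>+\<xi>. ennreal ((1 + \<xi>\<^sup>2) powr s * (cmod (g \<xi>))\<^sup>2) \<partial>lborel)"

text \<open>Only exponents \<open>s \<ge> 0\<close> are meant: for negative \<open>s\<close> the usual space also contains distributions
  outside \<open>L\<^sup>2\<close>.\<close>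

definition sobolev :: "real \<Rightarrow> (real \<Rightarrow> real) set" where
  "sobolev s = {f. \<exists>g. has_fourier_transform f g \<and> fourier_energy s g < \<infinity>}"

definition sobolev_norm :: "real \<Rightarrow> (real \<Rightarrow> real) \<Rightarrow> real" where
  "sobolev_norm s f = sqrt (enn2real (fourier_energy s (SOME g. has_fourier_transform f g)))"

text \<open>For \<open>s > 1/2\<close> every class in \<open>H\<^sup>s\<close> has exactly one continuous representative, with which it is
  identified. For \<open>s > k + 1/2\<close> this representative is of class \<open>C\<^sup>k\<close>, so its derivatives up to
  order \<open>k\<close> can be taken pointwise with \<^const>\<open>deriv\<close>.\<close>

definition sobolev_cont :: "real \<Rightarrow> (real \<Rightarrow> real) set" where
  "sobolev_cont s = {f \<in> sobolev s. continuous_on UNIV f}"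

definition time_interval :: "ereal \<Rightarrow> real set" where
  "time_interval T = {t. 0 \<le> t \<and> ereal t < T}"

text \<open>The space \<open>C([0,T); H\<^sup>s)\<close>.\<close>

definition sobolev_curve :: "real \<Rightarrow> ereal \<Rightarrow> (real \<Rightarrow> real \<Rightarrow> real) \<Rightarrow> bool" where
  "sobolev_curve s T f \<longleftrightarrow> (\<forall>t\<in>time_interval T. f t \<in> sobolev_cont s) \<and>
     (\<forall>t\<in>time_interval T.
        ((\<lambda>\<tau>. sobolev_norm s (\<lambda>x. f \<tau> x - f t x)) \<longlongrightarrow> 0) (at t within time_interval T))"


section \<open>The system\<close>

definition test_function :: "(real \<Rightarrow> real) \<Rightarrow> bool" where
  "test_function \<phi> \<longleftrightarrow> (\<forall>k x. (deriv ^^ k) \<phi> differentiable (at x)) \<and> (\<exists>R. \<forall>x. \<bar>x\<bar> > R \<longrightarrow> \<phi> x = 0)"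

definition momentum :: "(real \<Rightarrow> real) \<Rightarrow> real \<Rightarrow> real" where
  "momentum f x = f x - deriv (deriv f) x"

text \<open>At the regularity \<open>s > 5/2\<close> the momenta are continuous but \<open>m\<^sub>x\<close> and \<open>m\<^sub>t\<close> are in general not
  functions, so the equations hold in the sense of distributions in \<open>x\<close> at every time \<open>t\<close>. The term
  \<open>uvm\<^sub>x\<close> paired with \<open>\<phi>\<close> is \<open>-\<integral> m (uv\<phi>)\<^sub>x dx\<close>, where \<open>uv\<phi>\<close> is \<open>C\<^sup>2\<close> with compact support.\<close>

definition weak_rhs_\<rho> :: "(real \<Rightarrow> real) \<Rightarrow> (real \<Rightarrow> real) \<Rightarrow> (real \<Rightarrow> real) \<Rightarrow> (real \<Rightarrow> real) \<Rightarrow> real" where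
  "weak_rhs_\<rho> \<rho> u v \<phi> = (LINT x|lborel. \<rho> x * u x * v x * deriv \<phi> x)"

definition weak_rhs_m :: "(real \<Rightarrow> real) \<Rightarrow> (real \<Rightarrow> real) \<Rightarrow> (real \<Rightarrow> real) \<Rightarrow> (real \<Rightarrow> real) \<Rightarrow> real" where
  "weak_rhs_m \<rho> u v \<phi> = (LINT x|lborel.
      momentum u x * deriv (\<lambda>y. u y * v y * \<phi> y) x
      - 3 * v x * deriv u x * momentum u x * \<phi> x
      - (\<rho> x)\<^sup>2 * u x * \<phi> x)"

definition weak_rhs_n :: "(real \<Rightarrow> real) \<Rightarrow> (real \<Rightarrow> real) \<Rightarrow> (real \<Rightarrow> real) \<Rightarrow> (real \<Rightarrow> real) \<Rightarrow> real" where
  "weak_rhs_n \<rho> u v \<phi> = (LINT x|lborel.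
      momentum v x * deriv (\<lambda>y. u y * v y * \<phi> y) x
      - 3 * deriv v x * u x * momentum v x * \<phi> x
      + (\<rho> x)\<^sup>2 * v x * \<phi> x)"

definition solution ::
  "real \<Rightarrow> ereal \<Rightarrow> (real \<Rightarrow> real \<Rightarrow> real) \<Rightarrow> (real \<Rightarrow> real \<Rightarrow> real) \<Rightarrow> (real \<Rightarrow> real \<Rightarrow> real) \<Rightarrow> bool" where
  "solution s T \<rho> u v \<longleftrightarrow>
     sobolev_curve (s - 1) T \<rho> \<and> sobolev_curve s T u \<and> sobolev_curve s T v \<and>
     (\<forall>\<phi> t. test_function \<phi> \<longrightarrow> t \<in> time_interval T \<longrightarrow>
        ((\<lambda>\<tau>. LINT x|lborel. \<rho> \<tau> x * \<phi> x) has_real_derivative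
            weak_rhs_\<rho> (\<rho> t) (u t) (v t) \<phi>) (at t within time_interval T) \<and>
        ((\<lambda>\<tau>. LINT x|lborel. momentum (u \<tau>) x * \<phi> x) has_real_derivative
            weak_rhs_m (\<rho> t) (u t) (v t) \<phi>) (at t within time_interval T) \<and>
        ((\<lambda>\<tau>. LINT x|lborel. momentum (v \<tau>) x * \<phi> x) has_real_derivative
            weak_rhs_n (\<rho> t) (u t) (v t) \<phi>) (at t within time_interval T))"

text \<open>The lifespan is the maximal time of existence; it may be infinite.\<close>

definition lifespan :: "real \<Rightarrow> (real \<Rightarrow> real) \<Rightarrow> (real \<Rightarrow> real) \<Rightarrow> (real \<Rightarrow> real) \<Rightarrow> ereal" where
  "lifespan s \<rho>\<^sub>0 u\<^sub>0 v\<^sub>0 =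
     Sup {T. 0 < T \<and> (\<exists>\<rho> u v. solution s T \<rho> u v \<and> \<rho> 0 = \<rho>\<^sub>0 \<and> u 0 = u\<^sub>0 \<and> v 0 = v\<^sub>0)}"


section \<open>Weights and norms\<close>

definition log_weight :: "real \<Rightarrow> real \<Rightarrow> real" where
  "log_weight \<beta> x = ln (exp 1 + \<beta> + \<bar>x\<bar>) powr \<beta>"

definition \<psi> :: "real \<Rightarrow> real \<Rightarrow> real \<Rightarrow> real" where
  "\<psi> \<beta> N x = (if \<bar>x\<bar> < N then log_weight \<beta> x else log_weight \<beta> N)"

definition is_C\<^sub>\<beta> :: "real \<Rightarrow> real \<Rightarrow> bool" where
  "is_C\<^sub>\<beta> \<beta> C \<longleftrightarrow> (\<forall>N>0. \<forall>x. \<psi> \<beta> N x * (LINT y|lborel. exp (- \<bar>x - y\<bar>) / \<psi> \<beta> N y) \<le> C)"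

definition linf_norm :: "(real \<Rightarrow> real) \<Rightarrow> ennreal" where
  "linf_norm f = esssup lborel (\<lambda>x. ennreal \<bar>f x\<bar>)"

definition weighted_linf_norm ::
  "real \<Rightarrow> (real \<Rightarrow> real) \<Rightarrow> (real \<Rightarrow> real) \<Rightarrow> (real \<Rightarrow> real) \<Rightarrow> ennreal" where
  "weighted_linf_norm \<beta> \<rho> u v =
     (\<Sum>f\<leftarrow>[\<rho>, deriv \<rho>, u, deriv u, deriv (deriv u), v, deriv v, deriv (deriv v)].
        linf_norm (\<lambda>x. f x * log_weight \<beta> x))"

definition sup_sobolev_norm ::
  "real \<Rightarrow> real \<Rightarrow> (real \<Rightarrow> real \<Rightarrow> real) \<Rightarrow> (real \<Rightarrow> real \<Rightarrow> real) \<Rightarrow> (real \<Rightarrow> real \<Rightarrow> real) \<Rightarrow> real" where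
  "sup_sobolev_norm s T\<^sub>0 \<rho> u v =
     (SUP t\<in>{0..T\<^sub>0}. sobolev_norm (s - 1) (\<rho> t) + sobolev_norm s (u t) + sobolev_norm s (v t))"

end

theory Submission
  imports Defs "HOL-Real_Asymp.Real_Asymp"
begin

text \<open>On a time interval that is short in terms of the (locally bounded) \<open>C\<^sup>2\<close> norms of \<open>u\<close> and \<open>v\<close>, the
  quantities \<open>\<rho>\<close>, \<open>\<rho>\<^sub>x\<close>, \<open>m\<close> and \<open>n\<close> solve transport equations with velocity \<open>uv\<close>. Following a
  characteristic backwards from \<open>(t, y)\<close> to \<open>(0, x)\<close> bounds each of them at \<open>(t, y)\<close> by the initial data at \<open>x\<close>,
  and \<open>\<bar>x - y\<bar> \<le> 1\<close>, so that the weight changes by a bounded factor only. The bounds for \<open>u\<close>, \<open>u\<^sub>x\<close>, \<open>u\<^sub>x\<^sub>x\<close>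
  are recovered from \<open>m\<close>, because the inverse of \<open>1 - \<partial>\<^sub>x\<^sup>2\<close> has the kernel \<open>exp (-\<bar>x\<bar>) / 2\<close>, which decays faster than
  the weight varies. Because \<open>T\<^sub>0\<close> may depend on the solution, all constants are absolute and \<open>C\<^sub>1 = 180 C\<^sub>0\<close>.\<close>

section \<open>Fourier transforms and Sobolev norms\<close>

text \<open>Each quantity is therefore averaged against a narrow bump that travels with the
  characteristic. The velocity uv is C^1 with bounded derivative, and this keeps the commutator of
  averaging and transport small for a merely continuous quantity.

  The estimates decouple: \<rho> has the source -(uv)_x \<rho> alone, and each other source is
  linear in its own quantity plus a term with a factor \<rho>. So \<rho> is bounded on its own, and
  one condition T * B^2 \<le> 1/8 absorbs all growth, where B bounds the coefficients. Everything
  stays linear in the initial data.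

  The transform is defined as an L^2 limit, so pointwise statements rest on an inversion formula
  that holds at every point for the continuous representative.\<close>

definition trunc_ft :: "(real \<Rightarrow> real) \<Rightarrow> real \<Rightarrow> real \<Rightarrow> complex" where
  "trunc_ft f R \<xi> = (LINT x:{-R..R}|lborel. cis (- (x * \<xi>)) * complex_of_real (f x)) / complex_of_real (sqrt (2 * pi))"

lemma has_fourier_transform_alt:
  "has_fourier_transform f g \<longleftrightarrow> square_integrable f \<and> square_integrable g \<and>
     ((\<lambda>R. \<integral>\<^sup>+\<xi>. ennreal ((cmod (g \<xi> - trunc_ft f R \<xi>))\<^sup>2) \<partial>lborel) \<longlongrightarrow> 0) at_top"
  by (simp add: has_fourier_transform_def trunc_ft_def)

lemma has_fourier_transform_measurable:
  assumes "has_fourier_transform f g"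
  shows "f \<in> borel_measurable borel" "g \<in> borel_measurable borel"
  using assms by (auto simp: has_fourier_transform_def square_integrable_def)

lemma borel_measurable_cis [measurable]: "cis \<in> borel_measurable borel"
  by (intro borel_measurable_continuous_onI continuous_intros)

lemma trunc_ft_measurable:
  assumes [measurable]: "f \<in> borel_measurable borel"
  shows "trunc_ft f R \<in> borel_measurable borel"
  unfolding trunc_ft_def [abs_def] set_lebesgue_integral_def by measurable

lemma square_integrable_mult_integrable:
  fixes f :: "real \<Rightarrow> 'a::{real_normed_div_algebra,second_countable_topology,banach}"
  assumes "square_integrable f" "square_integrable g"
  shows "integrable lborel (\<lambda>x. f x * g x)"
proof (rule integrableI_bounded)
  have [measurable]: "f \<in> borel_measurable borel" "g \<in> borel_measurable borel"
    using assms by (auto simp: square_integrable_def)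
  show "(\<lambda>x. f x * g x) \<in> borel_measurable lborel"
    by simp
  have "(\<integral>\<^sup>+x. ennreal (norm (f x * g x)) \<partial>lborel)
      \<le> (\<integral>\<^sup>+x. ennreal ((norm (f x))\<^sup>2) + ennreal ((norm (g x))\<^sup>2) \<partial>lborel)"
  proof (rule nn_integral_mono)
    fix x
    have "norm (f x) * norm (g x) \<le> 2 * norm (f x) * norm (g x)" by simp
    also have "\<dots> \<le> (norm (f x))\<^sup>2 + (norm (g x))\<^sup>2" by (rule sum_squares_bound)
    finally have "norm (f x) * norm (g x) \<le> (norm (f x))\<^sup>2 + (norm (g x))\<^sup>2" .
    thus "ennreal (norm (f x * g x)) \<le> ennreal ((norm (f x))\<^sup>2) + ennreal ((norm (g x))\<^sup>2)"
      by (simp add: norm_mult flip: ennreal_plus)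
  qed
  also have "\<dots> = (\<integral>\<^sup>+x. ennreal ((norm (f x))\<^sup>2) \<partial>lborel) + (\<integral>\<^sup>+x. ennreal ((norm (g x))\<^sup>2) \<partial>lborel)"
    by (rule nn_integral_add) auto
  also have "\<dots> < \<infinity>"
    using assms by (simp add: square_integrable_def)
  finally show "(\<integral>\<^sup>+x. ennreal (norm (f x * g x)) \<partial>lborel) < \<infinity>" .
qed

lemma square_integrable_indicator_Icc:
  "square_integrable (indicator {a..b::real} :: real \<Rightarrow> real)"
proof -
  have "(\<integral>\<^sup>+x. ennreal ((norm (indicator {a..b} x :: real))\<^sup>2) \<partial>lborel) = (\<integral>\<^sup>+x. indicator {a..b} x \<partial>lborel)"
    by (rule nn_integral_cong) (auto split: split_indicator)
  also have "\<dots> < \<infinity>" by (cases "a \<le> b") auto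
  finally show ?thesis by (simp add: square_integrable_def)
qed

lemma square_integrable_set_integrable:
  fixes f :: "real \<Rightarrow> real"
  assumes "square_integrable f"
  shows "set_integrable lborel {a..b} f"
  unfolding set_integrable_def real_scaleR_def
  by (rule square_integrable_mult_integrable[OF square_integrable_indicator_Icc assms])

lemma trunc_ft_integrable:
  assumes "square_integrable f"
  shows "set_integrable lborel {-R..R} (\<lambda>x. cis (- (x * \<xi>)) * complex_of_real (f x))"
proof -
  have [measurable]: "f \<in> borel_measurable borel" using assms by (simp add: square_integrable_def)
  show ?thesis
    unfolding set_integrable_def
  proof (rule Bochner_Integration.integrable_bound[OF square_integrable_set_integrable[OF assms, of "-R" R, unfolded set_integrable_def]])
    show "AE x in lborel. norm (indicator {-R..R} x *\<^sub>R (cis (- (x * \<xi>)) * complex_of_real (f x)))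
        \<le> norm (indicator {-R..R} x *\<^sub>R f x)"
      by (auto simp: norm_mult)
  qed measurable
qed

lemma trunc_ft_diff:
  assumes "square_integrable f" "square_integrable g"
  shows "trunc_ft (\<lambda>x. f x - g x) R \<xi> = trunc_ft f R \<xi> - trunc_ft g R \<xi>"
proof -
  have "(LINT x:{-R..R}|lborel. cis (- (x * \<xi>)) * complex_of_real (f x - g x))
      = (LINT x:{-R..R}|lborel. cis (- (x * \<xi>)) * complex_of_real (f x) - cis (- (x * \<xi>)) * complex_of_real (g x))"
    by (simp add: algebra_simps)
  also have "\<dots> = (LINT x:{-R..R}|lborel. cis (- (x * \<xi>)) * complex_of_real (f x))
     - (LINT x:{-R..R}|lborel. cis (- (x * \<xi>)) * complex_of_real (g x))"
    by (rule set_integral_diff(2)) (rule trunc_ft_integrable assms)+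
  finally show ?thesis
    by (simp add: trunc_ft_def diff_divide_distrib)
qed

text \<open>Stands in for Minkowski's inequality: distances and energies are \<open>ennreal\<close>
  integrals of squares, and the factor 2 costs nothing because only finiteness and convergence to 0
  are drawn from it.\<close>

lemma norm_diff_power2_le: "ennreal ((norm (a - b))\<^sup>2) \<le> 2 * ennreal ((norm a)\<^sup>2) + 2 * ennreal ((norm b)\<^sup>2)"
proof -
  have "(norm (a - b))\<^sup>2 \<le> (norm a + norm b)\<^sup>2"
    by (intro power_mono norm_triangle_ineq4) auto
  also have "\<dots> \<le> 2 * (norm a)\<^sup>2 + 2 * (norm b)\<^sup>2"
    using zero_le_power2[of "norm a - norm b"] by (simp add: power2_eq_square algebra_simps)
  finally have "ennreal ((norm (a - b))\<^sup>2) \<le> ennreal (2 * (norm a)\<^sup>2 + 2 * (norm b)\<^sup>2)"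
    by (rule ennreal_leI)
  thus ?thesis by (simp add: ennreal_plus ennreal_mult)
qed

lemma nn_integral_norm_diff_power2_le:
  fixes f g :: "real \<Rightarrow> 'a::{real_normed_vector,second_countable_topology}"
  assumes [measurable]: "f \<in> borel_measurable borel" "g \<in> borel_measurable borel" "w \<in> borel_measurable borel"
  shows "(\<integral>\<^sup>+x. w x * ennreal ((norm (f x - g x))\<^sup>2) \<partial>lborel)
     \<le> 2 * (\<integral>\<^sup>+x. w x * ennreal ((norm (f x))\<^sup>2) \<partial>lborel) + 2 * (\<integral>\<^sup>+x. w x * ennreal ((norm (g x))\<^sup>2) \<partial>lborel)"
proof -
  have "(\<integral>\<^sup>+x. w x * ennreal ((norm (f x - g x))\<^sup>2) \<partial>lborel)
     \<le> (\<integral>\<^sup>+x. 2 * (w x * ennreal ((norm (f x))\<^sup>2)) + 2 * (w x * ennreal ((norm (g x))\<^sup>2)) \<partial>lborel)"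
  proof (rule nn_integral_mono)
    fix x
    have "w x * ennreal ((norm (f x - g x))\<^sup>2) \<le> w x * (2 * ennreal ((norm (f x))\<^sup>2) + 2 * ennreal ((norm (g x))\<^sup>2))"
      by (intro mult_left_mono norm_diff_power2_le) auto
    thus "w x * ennreal ((norm (f x - g x))\<^sup>2) \<le> 2 * (w x * ennreal ((norm (f x))\<^sup>2)) + 2 * (w x * ennreal ((norm (g x))\<^sup>2))"
      by (simp add: distrib_left mult.left_commute)
  qed
  also have "\<dots> = 2 * (\<integral>\<^sup>+x. w x * ennreal ((norm (f x))\<^sup>2) \<partial>lborel) + 2 * (\<integral>\<^sup>+x. w x * ennreal ((norm (g x))\<^sup>2) \<partial>lborel)"
    by (subst nn_integral_add) (auto simp: nn_integral_cmult)
  finally show ?thesis .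
qed

lemma square_integrable_diff:
  fixes f g :: "real \<Rightarrow> 'a::{real_normed_vector,second_countable_topology}"
  assumes "square_integrable f" "square_integrable g"
  shows "square_integrable (\<lambda>x. f x - g x)"
proof -
  have [measurable]: "f \<in> borel_measurable borel" "g \<in> borel_measurable borel"
    using assms by (auto simp: square_integrable_def)
  have "(\<integral>\<^sup>+x. ennreal ((norm (f x - g x))\<^sup>2) \<partial>lborel) < \<infinity>"
    using nn_integral_norm_diff_power2_le[of f g "\<lambda>_. 1"] assms
    by (auto simp: square_integrable_def ennreal_mult_less_top ennreal_add_less_top intro: le_less_trans)
  thus ?thesis by (simp add: square_integrable_def)
qed

lemma has_fourier_transform_diff:
  assumes "has_fourier_transform f g" "has_fourier_transform f' g'"
  shows "has_fourier_transform (\<lambda>x. f x - f' x) (\<lambda>x. g x - g' x)"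
proof -
  have sq: "square_integrable f" "square_integrable f'" "square_integrable g" "square_integrable g'"
    using assms by (auto simp: has_fourier_transform_def)
  note [measurable] = has_fourier_transform_measurable[OF assms(1)] has_fourier_transform_measurable[OF assms(2)]
  note [measurable] = trunc_ft_measurable[of f] trunc_ft_measurable[of f']
  let ?A = "\<lambda>R. \<integral>\<^sup>+\<xi>. ennreal ((cmod (g \<xi> - trunc_ft f R \<xi>))\<^sup>2) \<partial>lborel"
  let ?B = "\<lambda>R. \<integral>\<^sup>+\<xi>. ennreal ((cmod (g' \<xi> - trunc_ft f' R \<xi>))\<^sup>2) \<partial>lborel"
  let ?C = "\<lambda>R. \<integral>\<^sup>+\<xi>. ennreal ((cmod ((g \<xi> - g' \<xi>) - trunc_ft (\<lambda>x. f x - f' x) R \<xi>))\<^sup>2) \<partial>lborel"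
  have le: "?C R \<le> 2 * ?A R + 2 * ?B R" for R
    using nn_integral_norm_diff_power2_le[of "\<lambda>\<xi>. g \<xi> - trunc_ft f R \<xi>" "\<lambda>\<xi>. g' \<xi> - trunc_ft f' R \<xi>" "\<lambda>_. 1"]
    by (simp add: trunc_ft_diff sq algebra_simps)
  have "((\<lambda>R. 2 * ?A R + 2 * ?B R) \<longlongrightarrow> 2 * 0 + 2 * 0) at_top"
    using assms by (intro tendsto_add tendsto_mult_ennreal) (auto simp: has_fourier_transform_alt)
  hence "((\<lambda>R. 2 * ?A R + 2 * ?B R) \<longlongrightarrow> 0) at_top" by simp
  hence "(?C \<longlongrightarrow> 0) at_top"
    by (rule tendsto_sandwich[OF _ _ tendsto_const, rotated 2]) (auto simp: le)
  thus ?thesis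
    using sq by (simp add: has_fourier_transform_alt square_integrable_diff)
qed

text \<open>The difference of two transforms of f is a transform of the zero function, whose
  truncated transforms all vanish. Its distance to them is constant in R and tends to 0, hence is
  0.\<close>

lemma has_fourier_transform_unique:
  assumes "has_fourier_transform f g" "has_fourier_transform f g'"
  shows "AE \<xi> in lborel. g \<xi> = g' \<xi>"
proof -
  note [measurable] = has_fourier_transform_measurable[OF assms(1)] has_fourier_transform_measurable[OF assms(2)]
  have "has_fourier_transform (\<lambda>x. 0) (\<lambda>x. g x - g' x)"
    using has_fourier_transform_diff[OF assms] by simp
  hence "((\<lambda>R::real. \<integral>\<^sup>+\<xi>. ennreal ((cmod (g \<xi> - g' \<xi>))\<^sup>2) \<partial>lborel) \<longlongrightarrow> 0) at_top"
    by (simp add: has_fourier_transform_alt trunc_ft_def)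
  hence "(\<integral>\<^sup>+\<xi>. ennreal ((cmod (g \<xi> - g' \<xi>))\<^sup>2) \<partial>lborel) = 0"
    by (simp add: tendsto_const_iff)
  thus ?thesis
    by (subst (asm) nn_integral_0_iff_AE) auto
qed

lemma fourier_energy_eq:
  "fourier_energy s g = (\<integral>\<^sup>+\<xi>. ennreal ((1 + \<xi>\<^sup>2) powr s) * ennreal ((cmod (g \<xi>))\<^sup>2) \<partial>lborel)"
  unfolding fourier_energy_def by (simp add: ennreal_mult)

text \<open>Makes the embedding applicable to the increments \<open>f \<tau> - f t\<close> of a
  curve, which is how continuity in time becomes uniform pointwise convergence.\<close>

lemma sobolev_cont_diff:
  assumes "f \<in> sobolev_cont s" "h \<in> sobolev_cont s"
  shows "(\<lambda>x. f x - h x) \<in> sobolev_cont s"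
proof -
  from assms obtain g k where g: "has_fourier_transform f g" "fourier_energy s g < \<infinity>"
    and k: "has_fourier_transform h k" "fourier_energy s k < \<infinity>"
    and c: "continuous_on UNIV f" "continuous_on UNIV h"
    by (auto simp: sobolev_cont_def sobolev_def)
  note [measurable] = has_fourier_transform_measurable[OF g(1)] has_fourier_transform_measurable[OF k(1)]
  have "fourier_energy s (\<lambda>x. g x - k x) \<le> 2 * fourier_energy s g + 2 * fourier_energy s k"
    unfolding fourier_energy_eq by (rule nn_integral_norm_diff_power2_le) auto
  also have "\<dots> < \<infinity>"
    using g k by (auto simp: ennreal_mult_less_top)
  finally show ?thesis
    using has_fourier_transform_diff[OF g(1) k(1)] c
    by (auto simp: sobolev_cont_def sobolev_def intro!: continuous_intros)
qed

text \<open>The Fourier transform chosen by \<^const>\<open>Eps\<close> in the Sobolev norm differs from any other only on a null set.\<close>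

lemma sobolev_chosen_transform:
  assumes "f \<in> sobolev s"
  obtains g where "has_fourier_transform f g" "fourier_energy s g < \<infinity>"
    "sobolev_norm s f = sqrt (enn2real (fourier_energy s g))"
proof -
  from assms obtain k where k: "has_fourier_transform f k" "fourier_energy s k < \<infinity>"
    by (auto simp: sobolev_def)
  define g where "g = (SOME g. has_fourier_transform f g)"
  have g: "has_fourier_transform f g"
    unfolding g_def using someI[of "has_fourier_transform f", OF k(1)] .
  note [measurable] = has_fourier_transform_measurable[OF g(1)] has_fourier_transform_measurable[OF k(1)]
  have "fourier_energy s g = fourier_energy s k"
    unfolding fourier_energy_def using has_fourier_transform_unique[OF g k(1)]
    by (intro nn_integral_cong_AE) auto
  with k(2) g show ?thesis
    by (intro that[of g]) (auto simp: sobolev_norm_def g_def)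
qed

section \<open>Fourier inversion by Gaussian regularisation\<close>

text \<open>This is the characteristic function of the standard normal law at d / \<epsilon>, after
  the substitution z = \<epsilon> * \<xi>.\<close>

lemma fourier_gaussian_aux:
  fixes d \<epsilon> :: real
  assumes "\<epsilon> > 0"
  shows "(LINT \<xi>|lborel. cis (d * \<xi>) * complex_of_real (exp (- (\<epsilon>\<^sup>2 * \<xi>\<^sup>2) / 2)))
     = complex_of_real (2 * pi * normal_density 0 \<epsilon> d)"
proof -
  have "complex_of_real (exp (- ((d / \<epsilon>)\<^sup>2) / 2)) = char std_normal_distribution (d / \<epsilon>)"
    by (simp add: char_std_normal_distribution)
  also have "\<dots> = (LINT z|lborel. std_normal_density z *\<^sub>R iexp (d / \<epsilon> * z))"
    unfolding char_def by (subst integral_density) auto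
  also have "\<dots> = \<bar>\<epsilon>\<bar> *\<^sub>R (LINT \<xi>|lborel. std_normal_density (0 + \<epsilon> * \<xi>) *\<^sub>R iexp (d / \<epsilon> * (0 + \<epsilon> * \<xi>)))"
    using assms by (intro lborel_integral_real_affine) auto
  also have "\<dots> = complex_of_real (\<epsilon> / sqrt (2 * pi)) * (LINT \<xi>|lborel. cis (d * \<xi>) * complex_of_real (exp (- (\<epsilon>\<^sup>2 * \<xi>\<^sup>2) / 2)))"
    using assms
    by (simp add: std_normal_density_def cis_conv_exp scaleR_conv_of_real power_mult_distrib mult_ac
      flip: integral_mult_right_zero)
  finally have "(LINT \<xi>|lborel. cis (d * \<xi>) * complex_of_real (exp (- (\<epsilon>\<^sup>2 * \<xi>\<^sup>2) / 2)))
      = complex_of_real (exp (- ((d / \<epsilon>)\<^sup>2) / 2)) * complex_of_real (sqrt (2 * pi) / \<epsilon>)"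
    using assms by (simp add: field_simps)
  also have "\<dots> = complex_of_real (exp (- ((d / \<epsilon>)\<^sup>2) / 2) * (sqrt (2 * pi) / \<epsilon>))"
    by simp
  also have "exp (- ((d / \<epsilon>)\<^sup>2) / 2) * (sqrt (2 * pi) / \<epsilon>) = 2 * pi * normal_density 0 \<epsilon> d"
  proof -
    have "sqrt (2 * pi * \<epsilon>\<^sup>2) = sqrt (2 * pi) * \<epsilon>"
      using assms by (simp add: real_sqrt_mult)
    moreover have "2 * pi = sqrt (2 * pi) * sqrt (2 * pi)" by simp
    hence "sqrt (2 * pi) / \<epsilon> = 2 * pi / (sqrt (2 * pi) * \<epsilon>)"
      by (metis mult_divide_mult_cancel_left_if pi_gt_zero real_sqrt_gt_0_iff less_irrefl mult_pos_pos zero_less_numeral)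
    ultimately show ?thesis
      by (simp add: normal_density_def power_divide)
  qed
  finally show ?thesis .
qed

lemma gaussian_integrable:
  assumes "c > (0::real)"
  shows "integrable lborel (\<lambda>x. exp (- c * x\<^sup>2))"
proof -
  define \<sigma> where "\<sigma> = sqrt (1 / (2 * c))"
  have \<sigma>: "\<sigma> > 0" "\<sigma>\<^sup>2 = 1 / (2 * c)" using assms by (auto simp: \<sigma>_def)
  have "integrable lborel (\<lambda>x. sqrt (2 * pi * \<sigma>\<^sup>2) * normal_density 0 \<sigma> x)"
    using \<sigma> by (intro integrable_mult_right integrable_normal_density)
  also have "(\<lambda>x. sqrt (2 * pi * \<sigma>\<^sup>2) * normal_density 0 \<sigma> x) = (\<lambda>x. exp (- c * x\<^sup>2))"
    using \<sigma> assms by (auto simp: normal_density_def field_simps)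
  finally show ?thesis .
qed

lemma square_integrable_gaussian:
  assumes "c > (0::real)"
  shows "square_integrable (\<lambda>y. exp (- c * (x - y)\<^sup>2))"
proof -
  have "integrable lborel (\<lambda>x. exp (- (2 * c) * x\<^sup>2))"
    using gaussian_integrable[of "2 * c"] assms by simp
  hence "integrable lborel (\<lambda>y. exp (- (2 * c) * (x + (-1) * y)\<^sup>2))"
    by (rule lborel_integrable_real_affine) simp
  moreover have "exp (- (2 * c) * (x + (-1) * y)\<^sup>2) = (exp (- c * (x - y)\<^sup>2))\<^sup>2" for y
    by (simp add: power2_eq_square flip: exp_add)
  ultimately have "integrable lborel (\<lambda>y. (exp (- c * (x - y)\<^sup>2))\<^sup>2)"
    by simp
  hence "(\<integral>\<^sup>+y. ennreal (norm ((exp (- c * (x - y)\<^sup>2))\<^sup>2)) \<partial>lborel) < \<infinity>"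
    by (subst (asm) integrable_iff_bounded) simp
  thus ?thesis
    by (simp add: square_integrable_def)
qed

lemma square_integrable_modulated_gaussian:
  assumes "\<epsilon> > (0::real)"
  shows "square_integrable (\<lambda>\<xi>. cis (x * \<xi>) * complex_of_real (exp (- (\<epsilon>\<^sup>2 * \<xi>\<^sup>2) / 2)))"
  using square_integrable_gaussian[of "\<epsilon>\<^sup>2 / 2" 0] assms
  by (simp add: square_integrable_def norm_mult)

text \<open>Truncation makes Fubini applicable: on [-R, R] a square integrable f is integrable, so
  the double integral against the Gaussian converges absolutely. The inner integral over \<xi> is
  then a normal density.\<close>

lemma trunc_ft_gaussian:
  fixes f :: "real \<Rightarrow> real" and \<epsilon> x R :: real
  assumes f: "square_integrable f" and \<epsilon>: "\<epsilon> > 0"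
  shows "(LINT \<xi>|lborel. trunc_ft f R \<xi> * (cis (x * \<xi>) * complex_of_real (exp (- (\<epsilon>\<^sup>2 * \<xi>\<^sup>2) / 2))))
     = complex_of_real (sqrt (2 * pi) * (LINT y|lborel. indicator {-R..R} y * f y * normal_density 0 \<epsilon> (x - y)))"
proof -
  have [measurable]: "f \<in> borel_measurable borel" using f by (simp add: square_integrable_def)
  define G where "G \<xi> = exp (- (\<epsilon>\<^sup>2 * \<xi>\<^sup>2) / 2)" for \<xi> :: real
  have [measurable]: "G \<in> borel_measurable borel" unfolding G_def [abs_def] by measurable
  have Gint: "integrable lborel G"
    using gaussian_integrable[of "\<epsilon>\<^sup>2 / 2"] \<epsilon> by (simp add: G_def [abs_def])
  define F where "F y = indicator {-R..R} y * f y" for y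
  have [measurable]: "F \<in> borel_measurable borel" unfolding F_def [abs_def] by measurable
  have Fint: "integrable lborel F"
    using square_integrable_set_integrable[OF f, of "-R" R] by (simp add: set_integrable_def F_def [abs_def])
  define H where "H \<xi> y = complex_of_real (F y * G \<xi>) * cis ((x - y) * \<xi>)" for \<xi> y
  have [measurable]: "(\<lambda>(\<xi>, y). H \<xi> y) \<in> borel_measurable (lborel \<Otimes>\<^sub>M lborel)"
    unfolding H_def [abs_def] by measurable
  have Hint: "integrable (lborel \<Otimes>\<^sub>M lborel) (\<lambda>(\<xi>, y). H \<xi> y)"
  proof (rule Bochner_Integration.integrable_bound)
    have "integrable (lborel \<Otimes>\<^sub>M lborel) (\<lambda>(\<xi>, y). G \<xi> * F y)"
    proof (rule lborel_pair.Fubini_integrable)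
      show "(\<lambda>(\<xi>, y). G \<xi> * F y) \<in> borel_measurable (lborel \<Otimes>\<^sub>M lborel)" by measurable
      have "integrable lborel (\<lambda>\<xi>. \<bar>G \<xi>\<bar> * (LINT y|lborel. \<bar>F y\<bar>))"
        using Gint by auto
      thus "integrable lborel (\<lambda>\<xi>. LINT y|lborel. norm (case (\<xi>, y) of (\<xi>, y) \<Rightarrow> G \<xi> * F y))"
        by (simp add: abs_mult)
      show "AE \<xi> in lborel. integrable lborel (\<lambda>y. case (\<xi>, y) of (\<xi>, y) \<Rightarrow> G \<xi> * F y)"
        using Fint by auto
    qed
    thus "integrable (lborel \<Otimes>\<^sub>M lborel) (\<lambda>(\<xi>, y). G \<xi> * F y)" .
  qed (auto simp: H_def norm_mult abs_mult)
  have "(LINT \<xi>|lborel. trunc_ft f R \<xi> * (cis (x * \<xi>) * complex_of_real (G \<xi>)))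
      = (LINT \<xi>|lborel. (LINT y|lborel. H \<xi> y) / complex_of_real (sqrt (2 * pi)))"
  proof (rule Bochner_Integration.integral_cong[OF refl])
    fix \<xi>
    have "(LINT y|lborel. H \<xi> y) = (LINT y|lborel. (indicator {-R..R} y *\<^sub>R (cis (- (y * \<xi>)) * complex_of_real (f y)))
        * (cis (x * \<xi>) * complex_of_real (G \<xi>)))"
    proof (rule Bochner_Integration.integral_cong[OF refl])
      fix y
      have "cis ((x - y) * \<xi>) = cis (- (y * \<xi>)) * cis (x * \<xi>)"
        by (simp add: cis_mult algebra_simps)
      thus "H \<xi> y = (indicator {-R..R} y *\<^sub>R (cis (- (y * \<xi>)) * complex_of_real (f y))) * (cis (x * \<xi>) * complex_of_real (G \<xi>))"
        by (simp add: H_def F_def scaleR_conv_of_real)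
    qed
    also have "\<dots> = (LINT y:{-R..R}|lborel. cis (- (y * \<xi>)) * complex_of_real (f y)) * (cis (x * \<xi>) * complex_of_real (G \<xi>))"
      unfolding set_lebesgue_integral_def by (rule integral_mult_left_zero)
    finally show "trunc_ft f R \<xi> * (cis (x * \<xi>) * complex_of_real (G \<xi>)) = (LINT y|lborel. H \<xi> y) / complex_of_real (sqrt (2 * pi))"
      by (simp add: trunc_ft_def)
  qed
  also have "\<dots> = (LINT \<xi>|lborel. LINT y|lborel. H \<xi> y) / complex_of_real (sqrt (2 * pi))"
    by (rule integral_divide_zero)
  also have "(LINT \<xi>|lborel. LINT y|lborel. H \<xi> y) = (LINT y|lborel. LINT \<xi>|lborel. H \<xi> y)"
    by (rule lborel_pair.Fubini_integral[symmetric]) (rule Hint)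
  also have "\<dots> = (LINT y|lborel. complex_of_real (F y * (2 * pi * normal_density 0 \<epsilon> (x - y))))"
  proof (rule Bochner_Integration.integral_cong[OF refl])
    fix y
    have "(LINT \<xi>|lborel. H \<xi> y) = (LINT \<xi>|lborel. complex_of_real (F y) * (cis ((x - y) * \<xi>) * complex_of_real (exp (- (\<epsilon>\<^sup>2 * \<xi>\<^sup>2) / 2))))"
      by (simp add: H_def G_def mult_ac)
    also have "\<dots> = complex_of_real (F y * (2 * pi * normal_density 0 \<epsilon> (x - y)))"
      by (simp only: integral_mult_right_zero fourier_gaussian_aux[OF \<epsilon>] of_real_mult)
    finally show "(LINT \<xi>|lborel. H \<xi> y) = complex_of_real (F y * (2 * pi * normal_density 0 \<epsilon> (x - y)))" .
  qed
  also have "\<dots> = complex_of_real (LINT y|lborel. 2 * pi * (F y * normal_density 0 \<epsilon> (x - y)))"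
    by (subst integral_complex_of_real) (simp add: mult_ac)
  also have "\<dots> = complex_of_real (2 * pi * (LINT y|lborel. F y * normal_density 0 \<epsilon> (x - y)))"
    by (simp only: integral_mult_right_zero)
  also have "\<dots> / complex_of_real (sqrt (2 * pi)) = complex_of_real (sqrt (2 * pi) * (LINT y|lborel. F y * normal_density 0 \<epsilon> (x - y)))"
  proof -
    have "2 * pi * c / sqrt (2 * pi) = sqrt (2 * pi) * c" for c
      by (simp add: field_simps)
    thus ?thesis by (simp only: of_real_divide [symmetric])
  qed
  finally show ?thesis by (simp add: G_def F_def)
qed

text \<open>Cauchy-Schwarz. If the product is not integrable, the Bochner integral is 0 and the
  bound is trivial.\<close>

lemma L2_integral_bound:
  fixes p h :: "real \<Rightarrow> complex"
  assumes "p \<in> borel_measurable borel" "h \<in> borel_measurable borel"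
  shows "(ennreal (cmod (LINT \<xi>|lborel. p \<xi> * h \<xi>)))\<^sup>2
    \<le> (\<integral>\<^sup>+\<xi>. ennreal ((cmod (p \<xi>))\<^sup>2) \<partial>lborel) * (\<integral>\<^sup>+\<xi>. ennreal ((cmod (h \<xi>))\<^sup>2) \<partial>lborel)"
proof -
  note [measurable] = assms
  have "ennreal (cmod (LINT \<xi>|lborel. p \<xi> * h \<xi>)) \<le> (\<integral>\<^sup>+\<xi>. ennreal (cmod (p \<xi>)) * ennreal (cmod (h \<xi>)) \<partial>lborel)"
  proof (cases "integrable lborel (\<lambda>\<xi>. p \<xi> * h \<xi>)")
    case True
    from integral_norm_bound_ennreal[OF True] show ?thesis
      by (simp add: norm_mult ennreal_mult)
  next
    case False
    thus ?thesis by (simp add: not_integrable_integral_eq)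
  qed
  hence "(ennreal (cmod (LINT \<xi>|lborel. p \<xi> * h \<xi>)))\<^sup>2 \<le> (\<integral>\<^sup>+\<xi>. ennreal (cmod (p \<xi>)) * ennreal (cmod (h \<xi>)) \<partial>lborel)\<^sup>2"
    by (rule power_mono) simp
  also have "\<dots> \<le> (\<integral>\<^sup>+\<xi>. (ennreal (cmod (p \<xi>)))\<^sup>2 \<partial>lborel) * (\<integral>\<^sup>+\<xi>. (ennreal (cmod (h \<xi>)))\<^sup>2 \<partial>lborel)"
    by (rule Cauchy_Schwarz_nn_integral) auto
  finally show ?thesis by (simp add: ennreal_power)
qed

text \<open>Parseval's identity against a modulated Gaussian, obtained by letting R tend to infinity
  in the truncated identity. The left side converges because L^2 convergence may be tested against a
  square integrable function, the right side by dominated convergence.\<close>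

lemma fourier_transform_gaussian:
  fixes f :: "real \<Rightarrow> real" and \<epsilon> x :: real
  assumes ft: "has_fourier_transform f g" and \<epsilon>: "\<epsilon> > 0"
  shows "(LINT \<xi>|lborel. g \<xi> * (cis (x * \<xi>) * complex_of_real (exp (- (\<epsilon>\<^sup>2 * \<xi>\<^sup>2) / 2))))
     = complex_of_real (sqrt (2 * pi) * (LINT y|lborel. f y * normal_density 0 \<epsilon> (x - y)))"
proof -
  have f: "square_integrable f" and g: "square_integrable g" using ft by (auto simp: has_fourier_transform_def)
  have [measurable]: "f \<in> borel_measurable borel" "g \<in> borel_measurable borel"
    using f g by (simp_all add: square_integrable_def)
  note [measurable] = trunc_ft_measurable[of f]
  define h where "h \<xi> = cis (x * \<xi>) * complex_of_real (exp (- (\<epsilon>\<^sup>2 * \<xi>\<^sup>2) / 2))" for \<xi>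
  have h: "square_integrable h"
    using square_integrable_modulated_gaussian[OF \<epsilon>] by (simp add: h_def [abs_def])
  have [measurable]: "h \<in> borel_measurable borel" using h by (simp add: square_integrable_def)
  define K where "K = (\<integral>\<^sup>+\<xi>. ennreal ((cmod (h \<xi>))\<^sup>2) \<partial>lborel)"
  have K: "K < \<infinity>" using h by (simp add: K_def square_integrable_def)
  define e where "e R = (\<integral>\<^sup>+\<xi>. ennreal ((cmod (g \<xi> - trunc_ft f R \<xi>))\<^sup>2) \<partial>lborel)" for R
  have e0: "(e \<longlongrightarrow> 0) at_top"
    using ft by (simp add: has_fourier_transform_alt e_def [abs_def])
  define S where "S R = (LINT \<xi>|lborel. trunc_ft f R \<xi> * h \<xi>)" for R
  define S' where "S' = (LINT \<xi>|lborel. g \<xi> * h \<xi>)"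
  \<comment> \<open>A finite distance to the square integrable g is what makes
    \<open>trunc_ft f R\<close> square integrable, so that the integrals defining
    \<open>S' - S R\<close> may be subtracted. This holds for large R, which is enough for the
    limit.\<close>
  have "\<forall>\<^sub>F R in at_top. e R < \<infinity>"
    using e0 by (rule order_tendstoD) simp
  moreover have "(ennreal (cmod (S' - S R)))\<^sup>2 \<le> e R * K" if "e R < \<infinity>" for R
  proof -
    have "square_integrable (\<lambda>\<xi>. g \<xi> - trunc_ft f R \<xi>)"
      using that by (simp add: square_integrable_def e_def)
    from square_integrable_diff[OF g this] have "square_integrable (trunc_ft f R)" by simp
    hence "S' - S R = (LINT \<xi>|lborel. (g \<xi> - trunc_ft f R \<xi>) * h \<xi>)"
      using square_integrable_mult_integrable[OF g h] square_integrable_mult_integrable[OF _ h, of "trunc_ft f R"]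
      by (simp add: S_def S'_def left_diff_distrib)
    thus ?thesis
      using L2_integral_bound[of "\<lambda>\<xi>. g \<xi> - trunc_ft f R \<xi>" h] by (simp add: e_def K_def)
  qed
  ultimately have ev: "\<forall>\<^sub>F R in at_top. ennreal ((cmod (S' - S R))\<^sup>2) \<le> e R * K"
    by (auto elim!: eventually_mono simp: ennreal_power)
  have "((\<lambda>R. e R * K) \<longlongrightarrow> 0 * K) at_top"
    using K by (intro tendsto_mult_ennreal e0 tendsto_const) auto
  hence "((\<lambda>R. ennreal ((cmod (S' - S R))\<^sup>2)) \<longlongrightarrow> 0) at_top"
    by (intro tendsto_sandwich[OF _ ev tendsto_const]) auto
  hence "((\<lambda>R. (cmod (S' - S R))\<^sup>2) \<longlongrightarrow> 0) at_top"
    by (subst (asm) ennreal_0[symmetric], subst (asm) tendsto_ennreal_iff) auto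
  hence "((\<lambda>R. sqrt ((cmod (S' - S R))\<^sup>2)) \<longlongrightarrow> sqrt 0) at_top"
    by (rule tendsto_real_sqrt)
  hence "((\<lambda>R. S' - S R) \<longlongrightarrow> 0) at_top"
    by (simp add: tendsto_norm_zero_iff)
  hence "((\<lambda>R. S' - (S' - S R)) \<longlongrightarrow> S' - 0) at_top"
    by (intro tendsto_diff tendsto_const)
  hence lim1: "(S \<longlongrightarrow> S') at_top" by simp
  have N2: "square_integrable (\<lambda>y. normal_density 0 \<epsilon> (x - y))"
  proof -
    have "(\<lambda>y. normal_density 0 \<epsilon> (x - y)) = (\<lambda>y. (1 / sqrt (2 * pi * \<epsilon>\<^sup>2)) * exp (- (1 / (2 * \<epsilon>\<^sup>2)) * (x - y)\<^sup>2))"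
      by (auto simp: normal_density_def)
    moreover have "square_integrable (\<lambda>y. c * exp (- (1 / (2 * \<epsilon>\<^sup>2)) * (x - y)\<^sup>2))" for c
      using square_integrable_gaussian[of "1 / (2 * \<epsilon>\<^sup>2)" x] \<epsilon>
      by (auto simp: square_integrable_def power_mult_distrib ennreal_mult nn_integral_cmult ennreal_mult_less_top)
    ultimately show ?thesis by (simp only:)
  qed
  have int: "integrable lborel (\<lambda>y. f y * normal_density 0 \<epsilon> (x - y))"
    by (rule square_integrable_mult_integrable[OF f N2])
  have "((\<lambda>R. LINT y|lborel. indicator {-R..R} y * f y * normal_density 0 \<epsilon> (x - y)) \<longlongrightarrow>
      (LINT y|lborel. f y * normal_density 0 \<epsilon> (x - y))) at_top"
  proof (rule integral_dominated_convergence_at_top)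
    show "integrable lborel (\<lambda>y. norm (f y * normal_density 0 \<epsilon> (x - y)))"
      using int by (rule integrable_norm)
    show "\<forall>\<^sub>F R in at_top. AE y in lborel. norm (indicator {-R..R} y * f y * normal_density 0 \<epsilon> (x - y)) \<le> norm (f y * normal_density 0 \<epsilon> (x - y))"
      by (auto split: split_indicator)
    show "AE y in lborel. ((\<lambda>R. indicator {-R..R} y * f y * normal_density 0 \<epsilon> (x - y)) \<longlongrightarrow> f y * normal_density 0 \<epsilon> (x - y)) at_top"
    proof (rule AE_I2)
      fix y
      have "\<forall>\<^sub>F R in at_top. f y * normal_density 0 \<epsilon> (x - y) = indicator {-R..R} y * f y * normal_density 0 \<epsilon> (x - y)"
        using eventually_ge_at_top[of "\<bar>y\<bar>"] by eventually_elim (auto simp: indicator_def)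
      thus "((\<lambda>R. indicator {-R..R} y * f y * normal_density 0 \<epsilon> (x - y)) \<longlongrightarrow> f y * normal_density 0 \<epsilon> (x - y)) at_top"
        by (rule Lim_transform_eventually[OF tendsto_const])
    qed
  qed auto
  hence "((\<lambda>R. complex_of_real (sqrt (2 * pi) * (LINT y|lborel. indicator {-R..R} y * f y * normal_density 0 \<epsilon> (x - y)))) \<longlongrightarrow>
      complex_of_real (sqrt (2 * pi) * (LINT y|lborel. f y * normal_density 0 \<epsilon> (x - y)))) at_top"
    by (intro tendsto_of_real tendsto_mult tendsto_const)
  hence "(S \<longlongrightarrow> complex_of_real (sqrt (2 * pi) * (LINT y|lborel. f y * normal_density 0 \<epsilon> (x - y)))) at_top"
    unfolding S_def h_def by (subst trunc_ft_gaussian[OF f \<epsilon>])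
  with lim1 show ?thesis
    using tendsto_unique[OF trivial_limit_at_top_linorder] unfolding S'_def h_def by blast
qed

text \<open>A continuous square integrable f may be unbounded, so the integral is split at distance
  1 from x. On the compact part f is bounded and rescaling by \<epsilon> allows dominated
  convergence; on the rest the kernel is at most 4 * \<epsilon> times a fixed Gaussian
  \<open>W\<close>, against which f is integrable.\<close>

lemma gaussian_convolution_tendsto:
  fixes f :: "real \<Rightarrow> real" and x :: real
  assumes f: "square_integrable f" and cont: "continuous_on UNIV f"
  shows "(\<lambda>n. LINT y|lborel. f y * normal_density 0 (1 / real (Suc n)) (x - y)) \<longlonglongrightarrow> f x"
proof -
  have [measurable]: "f \<in> borel_measurable borel" using f by (simp add: square_integrable_def)
  define \<epsilon> where "\<epsilon> n = 1 / real (Suc n)" for n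
  have \<epsilon>: "\<epsilon> n > 0" "\<epsilon> n \<le> 1" for n by (auto simp: \<epsilon>_def)
  have \<epsilon>0: "\<epsilon> \<longlonglongrightarrow> 0" unfolding \<epsilon>_def by (rule LIMSEQ_Suc[OF lim_1_over_n])
  define S where "S = {x - 1..x + 1}"
  have [measurable]: "S \<in> sets borel" by (simp add: S_def)
  obtain B where B: "\<And>y. y \<in> S \<Longrightarrow> \<bar>f y\<bar> \<le> B"
  proof -
    have "compact (f ` S)" unfolding S_def
      by (intro compact_continuous_image continuous_on_subset[OF cont]) auto
    hence "bounded (f ` S)" by (rule compact_imp_bounded)
    thus ?thesis using that by (auto simp: bounded_iff)
  qed
  have B0: "B \<ge> 0" using B[of x] by (auto simp: S_def intro: order_trans[OF abs_ge_zero])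
  have Nscale: "\<epsilon> n * normal_density 0 (\<epsilon> n) (\<epsilon> n * z) = std_normal_density z" for n z
    using \<epsilon>(1)[of n] by (simp add: normal_density_def power_mult_distrib real_sqrt_mult)
  have bnd: "norm (indicator S (x - \<epsilon> n * z) * f (x - \<epsilon> n * z) * std_normal_density z) \<le> B * std_normal_density z" for n z
    using B B0 by (auto simp: indicator_def abs_mult intro!: mult_right_mono)
  have near: "(\<lambda>n. LINT y|lborel. indicator S y * f y * normal_density 0 (\<epsilon> n) (x - y)) \<longlonglongrightarrow> f x"
  proof -
    have "(\<lambda>n. LINT z|lborel. indicator S (x - \<epsilon> n * z) * f (x - \<epsilon> n * z) * std_normal_density z) \<longlonglongrightarrow>
        (LINT z|lborel. f x * std_normal_density z)"
    proof (rule integral_dominated_convergence)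
      show "integrable lborel (\<lambda>z. B * std_normal_density z)" by auto
      show "AE z in lborel. norm (indicator S (x - \<epsilon> n * z) * f (x - \<epsilon> n * z) * std_normal_density z) \<le> B * std_normal_density z" for n
        using bnd by auto
      show "AE z in lborel. (\<lambda>n. indicator S (x - \<epsilon> n * z) * f (x - \<epsilon> n * z) * std_normal_density z) \<longlonglongrightarrow> f x * std_normal_density z"
      proof (rule AE_I2)
        fix z
        have lim: "(\<lambda>n. x - \<epsilon> n * z) \<longlonglongrightarrow> x - 0 * z"
          by (intro tendsto_intros \<epsilon>0)
        have "isCont f (x - 0 * z)" using cont by (simp add: continuous_on_eq_continuous_at)
        from isCont_tendsto_compose[OF this lim] have "(\<lambda>n. f (x - \<epsilon> n * z)) \<longlonglongrightarrow> f x" by simp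
        hence 1: "(\<lambda>n. f (x - \<epsilon> n * z) * std_normal_density z) \<longlonglongrightarrow> f x * std_normal_density z"
          by (intro tendsto_intros)
        have "open {x - 1<..<x + 1}" "x - 0 * z \<in> {x - 1<..<x + 1}" by auto
        from topological_tendstoD[OF lim this]
        have "\<forall>\<^sub>F n in sequentially. f (x - \<epsilon> n * z) * std_normal_density z =
            indicator S (x - \<epsilon> n * z) * f (x - \<epsilon> n * z) * std_normal_density z"
          by eventually_elim (auto simp: S_def indicator_def)
        from Lim_transform_eventually[OF 1 this]
        show "(\<lambda>n. indicator S (x - \<epsilon> n * z) * f (x - \<epsilon> n * z) * std_normal_density z) \<longlonglongrightarrow> f x * std_normal_density z" .
      qed
    qed auto
    moreover have "(LINT y|lborel. indicator S y * f y * normal_density 0 (\<epsilon> n) (x - y)) =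
        (LINT z|lborel. indicator S (x - \<epsilon> n * z) * f (x - \<epsilon> n * z) * std_normal_density z)" for n
    proof -
      have "(LINT y|lborel. indicator S y * f y * normal_density 0 (\<epsilon> n) (x - y)) =
        \<bar>- \<epsilon> n\<bar> *\<^sub>R (LINT z|lborel. indicator S (x + (- \<epsilon> n) * z) * f (x + (- \<epsilon> n) * z) * normal_density 0 (\<epsilon> n) (x - (x + (- \<epsilon> n) * z)))"
        using \<epsilon>(1)[of n] by (intro lborel_integral_real_affine) auto
      also have "\<dots> = (LINT z|lborel. \<epsilon> n * (indicator S (x - \<epsilon> n * z) * f (x - \<epsilon> n * z) * normal_density 0 (\<epsilon> n) (\<epsilon> n * z)))"
        using \<epsilon>(1)[of n] by simp
      also have "\<dots> = (LINT z|lborel. indicator S (x - \<epsilon> n * z) * f (x - \<epsilon> n * z) * std_normal_density z)"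
        by (simp add: Nscale[symmetric, of _ n] mult_ac)
      finally show ?thesis .
    qed
    moreover have "(LINT z|lborel. f x * std_normal_density z) = f x" by simp
    ultimately show ?thesis by simp
  qed
  define W where "W y = exp (- (1/4) * (x - y)\<^sup>2)" for y
  have [measurable]: "W \<in> borel_measurable borel" unfolding W_def [abs_def] by measurable
  have fW: "integrable lborel (\<lambda>y. f y * W y)"
    unfolding W_def by (intro square_integrable_mult_integrable f square_integrable_gaussian) auto
  \<comment> \<open>Outside \<open>S\<close> both a = 1/\<epsilon>^2 and d = (x - y)^2 are at least
    1, so a * d / 2 \<ge> a / 4 + d / 4 separates the two variables. The factor exp (- a / 4) \<le>
    4 / a = 4 * \<epsilon>^2 beats the normalisation 1 / \<epsilon> and leaves 4 *
    \<epsilon>.\<close>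
  have tail: "indicator (-S) y * normal_density 0 (\<epsilon> n) (x - y) \<le> 4 * \<epsilon> n * W y" for n y
  proof (cases "y \<in> S")
    case True thus ?thesis using \<epsilon>(1)[of n] by (simp add: W_def)
  next
    case False
    define d where "d = (x - y)\<^sup>2"
    have "\<bar>x - y\<bar> \<ge> 1" using False by (auto simp: S_def)
    from one_le_power[OF this, of 2] have d: "d \<ge> 1" by (simp add: d_def)
    define a where "a = 1 / (\<epsilon> n)\<^sup>2"
    have a: "a \<ge> 1" using \<epsilon>[of n] by (simp add: a_def power_le_one_iff)
    have "a * d / 2 \<ge> a / 4 + d / 4"
      using mult_right_mono[OF a, of d] mult_left_mono[OF d, of a] a d by linarith
    hence "exp (- (a * d / 2)) \<le> exp (- (d / 4)) * exp (- (a / 4))"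
      by (simp flip: exp_add)
    also have "exp (- (a / 4)) \<le> 4 / a"
    proof -
      have "a / 4 \<le> exp (a / 4)" using exp_ge_add_one_self[of "a/4"] by linarith
      thus ?thesis using a by (simp add: exp_minus field_simps)
    qed
    finally have e: "exp (- (a * d / 2)) \<le> exp (- (d / 4)) * (4 / a)" by simp
    have "normal_density 0 (\<epsilon> n) (x - y) = 1 / (sqrt (2 * pi) * \<epsilon> n) * exp (- (a * d / 2))"
      using \<epsilon>(1)[of n] by (simp add: normal_density_def real_sqrt_mult a_def d_def)
    also have "\<dots> \<le> 1 / (1 * \<epsilon> n) * (exp (- (d / 4)) * (4 / a))"
    proof (intro mult_mono e divide_left_mono mult_right_mono)
      show "1 \<le> sqrt (2 * pi)" using pi_gt3 by simp
    qed (use \<epsilon>(1)[of n] in auto)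
    also have "\<dots> = 4 * \<epsilon> n * W y"
      using \<epsilon>(1)[of n] by (simp add: W_def d_def a_def power2_eq_square)
    finally show ?thesis using False by simp
  qed
  have tb: "norm (indicator (-S) y * f y * normal_density 0 (\<epsilon> n) (x - y)) \<le> norm (4 * \<epsilon> n * (f y * W y))" for n y
  proof -
    have "norm (indicator (-S) y * f y * normal_density 0 (\<epsilon> n) (x - y)) = \<bar>f y\<bar> * (indicator (-S) y * normal_density 0 (\<epsilon> n) (x - y))"
      by (simp add: abs_mult normal_density_nonneg)
    also have "\<dots> \<le> \<bar>f y\<bar> * (4 * \<epsilon> n * W y)" by (intro mult_left_mono tail) auto
    also have "\<dots> = norm (4 * \<epsilon> n * (f y * W y))"
      using \<epsilon>(1)[of n] by (simp add: abs_mult W_def)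
    finally show ?thesis .
  qed
  have farint: "integrable lborel (\<lambda>y. indicator (-S) y * f y * normal_density 0 (\<epsilon> n) (x - y))" for n
    by (rule Bochner_Integration.integrable_bound[OF integrable_mult_right[OF fW, of "4 * \<epsilon> n"]]) (use tb in auto)
  have far: "(\<lambda>n. LINT y|lborel. indicator (-S) y * f y * normal_density 0 (\<epsilon> n) (x - y)) \<longlonglongrightarrow> 0"
  proof (rule tendsto_rabs_zero_cancel, rule tendsto_sandwich[OF _ _ tendsto_const])
    show "(\<lambda>n. 4 * \<epsilon> n * (LINT y|lborel. \<bar>f y * W y\<bar>)) \<longlonglongrightarrow> 0"
      by (rule tendsto_eq_intros \<epsilon>0 | simp)+
    have "\<bar>LINT y|lborel. indicator (-S) y * f y * normal_density 0 (\<epsilon> n) (x - y)\<bar> \<le> 4 * \<epsilon> n * (LINT y|lborel. \<bar>f y * W y\<bar>)" for n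
    proof -
      have "\<bar>LINT y|lborel. indicator (-S) y * f y * normal_density 0 (\<epsilon> n) (x - y)\<bar>
          \<le> (LINT y|lborel. norm (indicator (-S) y * f y * normal_density 0 (\<epsilon> n) (x - y)))"
        using integral_norm_bound[of lborel "\<lambda>y. indicator (-S) y * f y * normal_density 0 (\<epsilon> n) (x - y)"] by simp
      also have "\<dots> \<le> (LINT y|lborel. norm (4 * \<epsilon> n * (f y * W y)))"
        using tb fW by (intro integral_mono integrable_norm farint) auto
      also have "\<dots> = (LINT y|lborel. 4 * \<epsilon> n * \<bar>f y * W y\<bar>)"
        using \<epsilon>(1)[of n] by (simp add: abs_mult)
      also have "\<dots> = 4 * \<epsilon> n * (LINT y|lborel. \<bar>f y * W y\<bar>)"
        by (rule integral_mult_right_zero)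
      finally show ?thesis .
    qed
    thus "\<forall>\<^sub>F n in sequentially. \<bar>LINT y|lborel. indicator (-S) y * f y * normal_density 0 (\<epsilon> n) (x - y)\<bar> \<le> 4 * \<epsilon> n * (LINT y|lborel. \<bar>f y * W y\<bar>)"
      by auto
  qed auto
  have nearint: "integrable lborel (\<lambda>y. indicator S y * f y * normal_density 0 (\<epsilon> n) (x - y))" for n
  proof (rule Bochner_Integration.integrable_bound)
    have "integrable lborel (\<lambda>y. normal_density 0 (\<epsilon> n) (x + (-1) * y))"
      using \<epsilon> by (intro lborel_integrable_real_affine integrable_normal_density) auto
    thus "integrable lborel (\<lambda>y. B * normal_density 0 (\<epsilon> n) (x - y))" by simp
    show "AE y in lborel. norm (indicator S y * f y * normal_density 0 (\<epsilon> n) (x - y)) \<le> norm (B * normal_density 0 (\<epsilon> n) (x - y))"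
      using B B0 by (auto simp: indicator_def abs_mult intro!: mult_right_mono)
  qed auto
  have "(LINT y|lborel. f y * normal_density 0 (\<epsilon> n) (x - y)) =
     (LINT y|lborel. indicator S y * f y * normal_density 0 (\<epsilon> n) (x - y))
     + (LINT y|lborel. indicator (-S) y * f y * normal_density 0 (\<epsilon> n) (x - y))" for n
    by (subst Bochner_Integration.integral_add[OF nearint farint, symmetric])
       (auto intro!: Bochner_Integration.integral_cong simp: indicator_def)
  with tendsto_add[OF near far] show ?thesis by (simp add: \<epsilon>_def)
qed

text \<open>Both sides of the Gaussian identity converge as \<epsilon> tends to 0: one by dominated
  convergence, since g is integrable, the other because Gaussians approximate the identity at a
  point of continuity. Hence the formula holds at every x, not just almost everywhere.\<close>

lemma fourier_inversion:
  fixes f :: "real \<Rightarrow> real"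
  assumes ft: "has_fourier_transform f g" and cont: "continuous_on UNIV f" and gi: "integrable lborel g"
  shows "complex_of_real (f x) = (LINT \<xi>|lborel. g \<xi> * cis (x * \<xi>)) / complex_of_real (sqrt (2 * pi))"
proof -
  have f: "square_integrable f" using ft by (auto simp: has_fourier_transform_def)
  have [measurable]: "g \<in> borel_measurable borel" using has_fourier_transform_measurable[OF ft] by simp
  define \<epsilon> where "\<epsilon> n = 1 / real (Suc n)" for n
  have \<epsilon>: "\<epsilon> n > 0" for n by (auto simp: \<epsilon>_def)
  have \<epsilon>0: "\<epsilon> \<longlonglongrightarrow> 0" unfolding \<epsilon>_def by (rule LIMSEQ_Suc[OF lim_1_over_n])
  have "(\<lambda>n. LINT \<xi>|lborel. g \<xi> * (cis (x * \<xi>) * complex_of_real (exp (- ((\<epsilon> n)\<^sup>2 * \<xi>\<^sup>2) / 2)))) \<longlonglongrightarrow>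
     (LINT \<xi>|lborel. g \<xi> * cis (x * \<xi>))"
  proof (rule integral_dominated_convergence)
    show "integrable lborel (\<lambda>\<xi>. cmod (g \<xi>))" using gi by auto
    show "AE \<xi> in lborel. (\<lambda>n. g \<xi> * (cis (x * \<xi>) * complex_of_real (exp (- ((\<epsilon> n)\<^sup>2 * \<xi>\<^sup>2) / 2)))) \<longlonglongrightarrow> g \<xi> * cis (x * \<xi>)"
    proof (rule AE_I2)
      fix \<xi>
      have "(\<lambda>n. g \<xi> * (cis (x * \<xi>) * complex_of_real (exp (- ((\<epsilon> n)\<^sup>2 * \<xi>\<^sup>2) / 2)))) \<longlonglongrightarrow>
         g \<xi> * (cis (x * \<xi>) * complex_of_real (exp (- (0\<^sup>2 * \<xi>\<^sup>2) / 2)))"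
        by (intro tendsto_intros \<epsilon>0) auto
      thus "(\<lambda>n. g \<xi> * (cis (x * \<xi>) * complex_of_real (exp (- ((\<epsilon> n)\<^sup>2 * \<xi>\<^sup>2) / 2)))) \<longlonglongrightarrow> g \<xi> * cis (x * \<xi>)"
        by simp
    qed
    show "AE \<xi> in lborel. norm (g \<xi> * (cis (x * \<xi>) * complex_of_real (exp (- ((\<epsilon> n)\<^sup>2 * \<xi>\<^sup>2) / 2)))) \<le> cmod (g \<xi>)" for n
      by (auto simp: norm_mult intro!: mult_left_le)
  qed auto
  hence "(\<lambda>n. complex_of_real (sqrt (2 * pi) * (LINT y|lborel. f y * normal_density 0 (\<epsilon> n) (x - y)))) \<longlonglongrightarrow>
     (LINT \<xi>|lborel. g \<xi> * cis (x * \<xi>))"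
    by (simp only: fourier_transform_gaussian[OF ft \<epsilon>])
  moreover have "(\<lambda>n. complex_of_real (sqrt (2 * pi) * (LINT y|lborel. f y * normal_density 0 (\<epsilon> n) (x - y)))) \<longlonglongrightarrow>
     complex_of_real (sqrt (2 * pi) * f x)"
    unfolding \<epsilon>_def by (intro tendsto_intros gaussian_convolution_tendsto f cont)
  ultimately have "(LINT \<xi>|lborel. g \<xi> * cis (x * \<xi>)) = complex_of_real (sqrt (2 * pi) * f x)"
    by (rule LIMSEQ_unique)
  thus ?thesis by simp
qed

section \<open>The Sobolev embedding\<close>

lemma has_vector_derivative_iff_tendsto:
  "(f has_vector_derivative D) (at x) \<longleftrightarrow> ((\<lambda>y. (1 / (y - x)) *\<^sub>R (f y - f x)) \<longlongrightarrow> D) (at x)"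
proof -
  have eq: "norm (f y - f x - (y - x) *\<^sub>R D) / norm (y - x) = norm ((1 / (y - x)) *\<^sub>R (f y - f x) - D)" if "y \<noteq> x" for y
  proof -
    have "(1 / (y - x)) *\<^sub>R (f y - f x) - D = (1 / (y - x)) *\<^sub>R (f y - f x - (y - x) *\<^sub>R D)"
      using that by (simp add: scaleR_diff_right)
    thus ?thesis by (simp add: divide_inverse_commute)
  qed
  have "(f has_vector_derivative D) (at x) \<longleftrightarrow> ((\<lambda>y. norm (f y - f x - (y - x) *\<^sub>R D) / norm (y - x)) \<longlongrightarrow> 0) (at x)"
    by (simp add: has_vector_derivative_def has_derivative_iff_norm bounded_linear_scaleR_left)
  also have "\<dots> \<longleftrightarrow> ((\<lambda>y. norm ((1 / (y - x)) *\<^sub>R (f y - f x) - D)) \<longlongrightarrow> 0) (at x)"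
  proof (intro filterlim_cong refl)
    show "\<forall>\<^sub>F y in at x. norm (f y - f x - (y - x) *\<^sub>R D) / norm (y - x) = norm ((1 / (y - x)) *\<^sub>R (f y - f x) - D)"
      using eventually_neq_at_within[of x x UNIV] by eventually_elim (rule eq)
  qed
  also have "\<dots> \<longleftrightarrow> ((\<lambda>y. (1 / (y - x)) *\<^sub>R (f y - f x)) \<longlongrightarrow> D) (at x)"
    by (simp only: tendsto_norm_zero_iff LIM_zero_iff)
  finally show ?thesis .
qed

text \<open>Since |cis t - 1| \<le> |t|, the difference quotients of the integrand are dominated by
  |\<xi> * g \<xi>|. The limit is tested on sequences, where dominated convergence applies.\<close>

lemma fourier_integral_has_derivative:
  assumes g: "integrable lborel g" and xg: "integrable lborel (\<lambda>\<xi>. complex_of_real \<xi> * g \<xi>)"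
  shows "((\<lambda>x. LINT \<xi>|lborel. g \<xi> * cis (x * \<xi>)) has_vector_derivative
    (LINT \<xi>|lborel. (\<i> * complex_of_real \<xi> * g \<xi>) * cis (x * \<xi>))) (at x)"
proof -
  have [measurable]: "g \<in> borel_measurable borel" using g by simp
  have ecis: "cmod (cis t - 1) \<le> \<bar>t\<bar>" for t
    using iexp_approx1[of t 0] by (simp add: cis_conv_exp)
  have int: "integrable lborel (\<lambda>\<xi>. g \<xi> * cis (y * \<xi>))" for y
    by (rule Bochner_Integration.integrable_bound[OF g]) (auto simp: norm_mult)
  have dcis: "((\<lambda>y. cis (y * \<xi>)) has_vector_derivative (\<i> * complex_of_real \<xi> * cis (y * \<xi>))) (at y within UNIV)" for y \<xi>
    by (auto intro!: derivative_eq_intros simp: has_vector_derivative_complex_iff)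
  have "(\<lambda>y. (1 / (y - x)) *\<^sub>R ((LINT \<xi>|lborel. g \<xi> * cis (y * \<xi>)) - (LINT \<xi>|lborel. g \<xi> * cis (x * \<xi>))))
     \<midarrow>x\<rightarrow> (LINT \<xi>|lborel. (\<i> * complex_of_real \<xi> * g \<xi>) * cis (x * \<xi>))"
    unfolding tendsto_at_iff_sequentially comp_def
  proof safe
    fix X :: "nat \<Rightarrow> real" assume X: "\<forall>n. X n \<in> UNIV - {x}" and lim: "X \<longlonglongrightarrow> x"
    have "(\<lambda>n. LINT \<xi>|lborel. (1 / (X n - x)) *\<^sub>R (g \<xi> * (cis (X n * \<xi>) - cis (x * \<xi>)))) \<longlonglongrightarrow>
        (LINT \<xi>|lborel. (\<i> * complex_of_real \<xi> * g \<xi>) * cis (x * \<xi>))"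
    proof (rule integral_dominated_convergence)
      show "integrable lborel (\<lambda>\<xi>. norm (complex_of_real \<xi> * g \<xi>))" using xg by (rule integrable_norm)
      show "AE \<xi> in lborel. norm ((1 / (X n - x)) *\<^sub>R (g \<xi> * (cis (X n * \<xi>) - cis (x * \<xi>)))) \<le> norm (complex_of_real \<xi> * g \<xi>)" for n
      proof (rule AE_I2)
        fix \<xi>
        have ne: "X n - x \<noteq> 0" using X by auto
        have "cis (X n * \<xi>) = cis (x * \<xi>) * cis ((X n - x) * \<xi>)"
          by (simp add: cis_mult algebra_simps)
        hence "cis (X n * \<xi>) - cis (x * \<xi>) = cis (x * \<xi>) * (cis ((X n - x) * \<xi>) - 1)"
          by (simp add: algebra_simps)
        hence "cmod (cis (X n * \<xi>) - cis (x * \<xi>)) \<le> \<bar>X n - x\<bar> * \<bar>\<xi>\<bar>"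
          using ecis[of "(X n - x) * \<xi>"] by (simp add: norm_mult abs_mult)
        hence "1 / \<bar>X n - x\<bar> * (cmod (g \<xi>) * cmod (cis (X n * \<xi>) - cis (x * \<xi>)))
           \<le> 1 / \<bar>X n - x\<bar> * (cmod (g \<xi>) * (\<bar>X n - x\<bar> * \<bar>\<xi>\<bar>))"
          by (intro mult_left_mono) auto
        thus "norm ((1 / (X n - x)) *\<^sub>R (g \<xi> * (cis (X n * \<xi>) - cis (x * \<xi>)))) \<le> norm (complex_of_real \<xi> * g \<xi>)"
          using ne by (simp add: norm_mult mult_ac)
      qed
      show "AE \<xi> in lborel. (\<lambda>n. (1 / (X n - x)) *\<^sub>R (g \<xi> * (cis (X n * \<xi>) - cis (x * \<xi>)))) \<longlonglongrightarrow> (\<i> * complex_of_real \<xi> * g \<xi>) * cis (x * \<xi>)"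
      proof (rule AE_I2)
        fix \<xi>
        have "(\<lambda>y. (1 / (y - x)) *\<^sub>R (cis (y * \<xi>) - cis (x * \<xi>))) \<midarrow>x\<rightarrow> \<i> * complex_of_real \<xi> * cis (x * \<xi>)"
          using dcis[of \<xi> x] by (simp add: has_vector_derivative_iff_tendsto)
        with X lim have "(\<lambda>n. (1 / (X n - x)) *\<^sub>R (cis (X n * \<xi>) - cis (x * \<xi>))) \<longlonglongrightarrow> \<i> * complex_of_real \<xi> * cis (x * \<xi>)"
          unfolding tendsto_at_iff_sequentially comp_def by auto
        from tendsto_mult[OF tendsto_const this, of "g \<xi>"]
        show "(\<lambda>n. (1 / (X n - x)) *\<^sub>R (g \<xi> * (cis (X n * \<xi>) - cis (x * \<xi>)))) \<longlonglongrightarrow> (\<i> * complex_of_real \<xi> * g \<xi>) * cis (x * \<xi>)"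
          by (simp add: mult_ac scaleR_conv_of_real)
      qed
    qed (use xg in \<open>auto\<close>)
    thus "(\<lambda>n. (1 / (X n - x)) *\<^sub>R ((LINT \<xi>|lborel. g \<xi> * cis (X n * \<xi>)) - (LINT \<xi>|lborel. g \<xi> * cis (x * \<xi>))))
       \<longlonglongrightarrow> (LINT \<xi>|lborel. (\<i> * complex_of_real \<xi> * g \<xi>) * cis (x * \<xi>))"
      by (simp add: right_diff_distrib int Bochner_Integration.integral_diff[OF int int])
  qed
  thus ?thesis by (simp add: has_vector_derivative_iff_tendsto)
qed


lemma fourier_integral_continuous:
  assumes g: "integrable lborel g"
  shows "continuous_on UNIV (\<lambda>x. LINT \<xi>|lborel. g \<xi> * cis (x * \<xi>))"
proof -
  have [measurable]: "g \<in> borel_measurable borel" using g by simp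
  have "(\<lambda>n. LINT \<xi>|lborel. g \<xi> * cis (X n * \<xi>)) \<longlonglongrightarrow> (LINT \<xi>|lborel. g \<xi> * cis (x * \<xi>))" if X: "X \<longlonglongrightarrow> x" for X x
  proof (rule integral_dominated_convergence)
    show "integrable lborel (\<lambda>\<xi>. cmod (g \<xi>))" using g by auto
    show "AE \<xi> in lborel. (\<lambda>n. g \<xi> * cis (X n * \<xi>)) \<longlonglongrightarrow> g \<xi> * cis (x * \<xi>)"
      by (intro AE_I2 tendsto_intros X)
    show "AE \<xi> in lborel. norm (g \<xi> * cis (X n * \<xi>)) \<le> cmod (g \<xi>)" for n
      by (auto simp: norm_mult)
  qed auto
  thus ?thesis
    by (auto simp: continuous_on_sequentially comp_def)
qed

text \<open>From (1 + x)^2 \<le> 2 * (1 + x^2) the integrand is compared on each half line with a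
  power of 1 + |\<xi>|, which has an elementary antiderivative that vanishes at infinity exactly
  when 2 * p > 1.\<close>

lemma japanese_bracket_nn_integral_finite:
  assumes p: "p > 1 / 2"
  shows "(\<integral>\<^sup>+\<xi>. ennreal ((1 + \<xi>\<^sup>2) powr (- p)) \<partial>lborel) < \<infinity>"
proof -
  define h where "h \<xi> = ennreal (2 powr p * (1 + \<xi>) powr (- 2 * p)) * indicator {0..} \<xi>" for \<xi> :: real
  have hm [measurable]: "h \<in> borel_measurable borel" unfolding h_def [abs_def] by measurable
  have hfin: "(\<integral>\<^sup>+\<xi>. h \<xi> \<partial>lborel) < \<infinity>"
  proof -
    have "(\<integral>\<^sup>+\<xi>. ennreal (2 powr p * (1 + \<xi>) powr (- 2 * p)) * indicator {0..} \<xi> \<partial>lborel)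
        = 0 - (2 powr p * (1 + 0) powr (1 - 2 * p) / (1 - 2 * p))"
    proof (rule nn_integral_FTC_atLeast)
      show "((\<lambda>x. 2 powr p * (1 + x) powr (1 - 2 * p) / (1 - 2 * p)) \<longlongrightarrow> 0) at_top"
        using p by real_asymp
      fix x :: real assume "0 \<le> x"
      thus "((\<lambda>x. 2 powr p * (1 + x) powr (1 - 2 * p) / (1 - 2 * p)) has_real_derivative 2 powr p * (1 + x) powr (- 2 * p)) (at x)"
        using p by (auto intro!: derivative_eq_intros)
    qed auto
    thus ?thesis by (simp add: h_def)
  qed
  have "(\<integral>\<^sup>+\<xi>. h (0 + (-1) * \<xi>) \<partial>lborel) = (\<integral>\<^sup>+\<xi>. h \<xi> \<partial>lborel)"
    by (subst nn_integral_real_affine[of h "-1" 0]) auto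
  hence hfin': "(\<integral>\<^sup>+\<xi>. h (- \<xi>) \<partial>lborel) < \<infinity>" using hfin by simp
  have b: "(1 + x\<^sup>2) powr (- p) \<le> 2 powr p * (1 + x) powr (- 2 * p)" if "x \<ge> 0" for x :: real
  proof -
    have "(1 + x)\<^sup>2 / 2 \<le> 1 + x\<^sup>2"
      using zero_le_power2[of "1 - x"] by (simp add: power2_eq_square algebra_simps)
    hence "(1 + x\<^sup>2) powr (- p) \<le> ((1 + x)\<^sup>2 / 2) powr (- p)"
      using p that by (intro powr_mono2') auto
    also have "\<dots> = 2 powr p * (1 + x) powr (- 2 * p)"
      using that by (simp add: powr_divide powr_minus field_simps powr_powr powr_realpow[symmetric] powr_numeral[symmetric] del: powr_numeral)
    finally show ?thesis .
  qed
  have "(\<integral>\<^sup>+\<xi>. ennreal ((1 + \<xi>\<^sup>2) powr (- p)) \<partial>lborel) \<le> (\<integral>\<^sup>+\<xi>. h \<xi> + h (- \<xi>) \<partial>lborel)"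
  proof (rule nn_integral_mono)
    fix \<xi> :: real
    show "ennreal ((1 + \<xi>\<^sup>2) powr (- p)) \<le> h \<xi> + h (- \<xi>)"
    proof (cases "\<xi> \<ge> 0")
      case True
      hence "ennreal ((1 + \<xi>\<^sup>2) powr (- p)) \<le> h \<xi>"
        using b[of \<xi>] by (auto simp: h_def intro: ennreal_leI)
      thus ?thesis by (rule order_trans) simp
    next
      case False
      hence "ennreal ((1 + \<xi>\<^sup>2) powr (- p)) \<le> h (- \<xi>)"
        using b[of "-\<xi>"] by (auto simp: h_def intro: ennreal_leI)
      thus ?thesis by (rule order_trans) simp
    qed
  qed
  also have "\<dots> = (\<integral>\<^sup>+\<xi>. h \<xi> \<partial>lborel) + (\<integral>\<^sup>+\<xi>. h (- \<xi>) \<partial>lborel)"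
    by (rule nn_integral_add) auto
  also have "\<dots> < \<infinity>" using hfin hfin' by simp
  finally show ?thesis .
qed

text \<open>Cauchy-Schwarz after splitting off (1 + \<xi>^2) to the powers -s/2 and s/2. What
  remains besides the energy is at most (1 + \<xi>^2) to the power -(s - j), integrable because s -
  j > 1/2. The constant precedes g, so it is uniform over the space.\<close>

lemma fourier_energy_moment_bound:
  assumes "s > real j + 1 / 2"
  shows "\<exists>c. \<forall>g. g \<in> borel_measurable borel \<longrightarrow> fourier_energy s g < \<infinity> \<longrightarrow>
     integrable lborel (\<lambda>\<xi>. complex_of_real \<xi> ^ j * g \<xi>) \<and>
     (LINT \<xi>|lborel. cmod (complex_of_real \<xi> ^ j * g \<xi>)) \<le> c * sqrt (enn2real (fourier_energy s g))"
proof -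
  define K where "K = (\<integral>\<^sup>+\<xi>. ennreal ((1 + \<xi>\<^sup>2) powr (- (s - real j))) \<partial>lborel)"
  have K: "K < \<infinity>" unfolding K_def using assms by (intro japanese_bracket_nn_integral_finite) simp
  show ?thesis
  proof (intro exI[of _ "sqrt (enn2real K)"] allI impI)
    fix g :: "real \<Rightarrow> complex"
    assume [measurable]: "g \<in> borel_measurable borel" and E: "fourier_energy s g < \<infinity>"
    define a where "a \<xi> = ennreal (\<bar>\<xi>\<bar> ^ j * (1 + \<xi>\<^sup>2) powr (- s / 2))" for \<xi> :: real
    define b where "b \<xi> = ennreal ((1 + \<xi>\<^sup>2) powr (s / 2) * cmod (g \<xi>))" for \<xi> :: real
    have [measurable]: "a \<in> borel_measurable borel" "b \<in> borel_measurable borel"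
      unfolding a_def [abs_def] b_def [abs_def] by measurable
    have pos: "1 + \<xi>\<^sup>2 > 0" for \<xi> :: real by (simp add: add_pos_nonneg)
    have "a \<xi> * b \<xi> = ennreal (cmod (complex_of_real \<xi> ^ j * g \<xi>))" for \<xi>
    proof -
      have "\<bar>\<xi>\<bar> ^ j * (1 + \<xi>\<^sup>2) powr (- s / 2) * ((1 + \<xi>\<^sup>2) powr (s / 2) * cmod (g \<xi>))
        = \<bar>\<xi>\<bar> ^ j * ((1 + \<xi>\<^sup>2) powr (- s / 2) * (1 + \<xi>\<^sup>2) powr (s / 2)) * cmod (g \<xi>)"
        by (simp only: mult_ac)
      also have "(1 + \<xi>\<^sup>2) powr (- s / 2) * (1 + \<xi>\<^sup>2) powr (s / 2) = 1"
        using pos[of \<xi>] by (subst powr_add [symmetric]) auto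
      finally show ?thesis
        by (simp add: a_def b_def norm_mult norm_power flip: ennreal_mult)
    qed
    hence "(\<integral>\<^sup>+\<xi>. ennreal (cmod (complex_of_real \<xi> ^ j * g \<xi>)) \<partial>lborel)\<^sup>2 = (\<integral>\<^sup>+\<xi>. a \<xi> * b \<xi> \<partial>lborel)\<^sup>2"
      by simp
    also have "\<dots> \<le> (\<integral>\<^sup>+\<xi>. (a \<xi>)\<^sup>2 \<partial>lborel) * (\<integral>\<^sup>+\<xi>. (b \<xi>)\<^sup>2 \<partial>lborel)"
      by (rule Cauchy_Schwarz_nn_integral) auto
    also have "\<dots> \<le> K * fourier_energy s g"
    proof (rule mult_mono)
      have "(a \<xi>)\<^sup>2 \<le> ennreal ((1 + \<xi>\<^sup>2) powr (- (s - real j)))" for \<xi>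
      proof -
        have "(\<bar>\<xi>\<bar> ^ j * (1 + \<xi>\<^sup>2) powr (- s / 2))\<^sup>2 = (\<xi>\<^sup>2) ^ j * (1 + \<xi>\<^sup>2) powr (- s)"
        proof -
          have "(\<bar>\<xi>\<bar> ^ j)\<^sup>2 = (\<bar>\<xi>\<bar>\<^sup>2) ^ j" by (simp only: power_mult [symmetric] mult.commute)
          moreover have "((1 + \<xi>\<^sup>2) powr (- s / 2))\<^sup>2 = (1 + \<xi>\<^sup>2) powr (- s)"
            by (simp only: power2_eq_square powr_add [symmetric]) simp
          ultimately show ?thesis by (simp add: power_mult_distrib)
        qed
        also have "\<dots> \<le> (1 + \<xi>\<^sup>2) ^ j * (1 + \<xi>\<^sup>2) powr (- s)"
          by (intro mult_right_mono power_mono) auto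
        also have "\<dots> = (1 + \<xi>\<^sup>2) powr (- (s - real j))"
          using pos[of \<xi>] by (simp add: powr_realpow[symmetric] powr_add[symmetric])
        finally show ?thesis by (simp add: a_def ennreal_power ennreal_leI)
      qed
      thus "(\<integral>\<^sup>+\<xi>. (a \<xi>)\<^sup>2 \<partial>lborel) \<le> K" unfolding K_def by (intro nn_integral_mono)
      have "(b \<xi>)\<^sup>2 = ennreal ((1 + \<xi>\<^sup>2) powr s * (cmod (g \<xi>))\<^sup>2)" for \<xi>
      proof -
        have "((1 + \<xi>\<^sup>2) powr (s / 2))\<^sup>2 = (1 + \<xi>\<^sup>2) powr s"
          by (simp only: power2_eq_square powr_add [symmetric]) simp
        thus ?thesis by (simp add: b_def ennreal_power power_mult_distrib)
      qed
      thus "(\<integral>\<^sup>+\<xi>. (b \<xi>)\<^sup>2 \<partial>lborel) \<le> fourier_energy s g" by (simp add: fourier_energy_def)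
    qed auto
    also have "\<dots> = ennreal (enn2real K * enn2real (fourier_energy s g))"
      using K E by (simp add: ennreal_mult)
    finally have le: "(\<integral>\<^sup>+\<xi>. ennreal (cmod (complex_of_real \<xi> ^ j * g \<xi>)) \<partial>lborel)\<^sup>2
       \<le> ennreal (enn2real K * enn2real (fourier_energy s g))" .
    hence "(\<integral>\<^sup>+\<xi>. ennreal (cmod (complex_of_real \<xi> ^ j * g \<xi>)) \<partial>lborel)\<^sup>2 < \<infinity>"
      by (rule le_less_trans) simp
    hence "(\<integral>\<^sup>+\<xi>. ennreal (cmod (complex_of_real \<xi> ^ j * g \<xi>)) \<partial>lborel) < \<infinity>"
      by (auto simp: power2_eq_square ennreal_mult_less_top less_top[symmetric] ennreal_top_mult)
    hence int: "integrable lborel (\<lambda>\<xi>. complex_of_real \<xi> ^ j * g \<xi>)"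
      by (intro integrableI_bounded) auto
    have "ennreal ((LINT \<xi>|lborel. cmod (complex_of_real \<xi> ^ j * g \<xi>))\<^sup>2) \<le> ennreal (enn2real K * enn2real (fourier_energy s g))"
      using le by (subst (asm) nn_integral_eq_integral) (use int in \<open>auto simp: ennreal_power intro: integrable_norm\<close>)
    hence "(LINT \<xi>|lborel. cmod (complex_of_real \<xi> ^ j * g \<xi>))\<^sup>2 \<le> enn2real K * enn2real (fourier_energy s g)"
      by (subst (asm) ennreal_le_iff) auto
    hence "(LINT \<xi>|lborel. cmod (complex_of_real \<xi> ^ j * g \<xi>)) \<le> sqrt (enn2real K * enn2real (fourier_energy s g))"
      by (rule real_le_rsqrt)
    with int show "integrable lborel (\<lambda>\<xi>. complex_of_real \<xi> ^ j * g \<xi>) \<and>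
      (LINT \<xi>|lborel. cmod (complex_of_real \<xi> ^ j * g \<xi>)) \<le> sqrt (enn2real K) * sqrt (enn2real (fourier_energy s g))"
      by (simp add: real_sqrt_mult)
  qed
qed

text \<open>Inversion represents f as the Fourier integral of g. Differentiating j \<le> k times
  under the integral multiplies g by (i \<xi>)^j, still integrable by the moment bound, so each
  derivative is continuous and bounded by an L^1 norm. Summing the constants of all orders gives a
  single c.\<close>

lemma sobolev_embedding:
  assumes s: "s > real k + 1 / 2"
  obtains c where "\<And>f j. f \<in> sobolev_cont s \<Longrightarrow> j \<le> k \<Longrightarrow> continuous_on UNIV ((deriv ^^ j) f)"
    "\<And>f j x. f \<in> sobolev_cont s \<Longrightarrow> j \<le> k \<Longrightarrow> \<bar>(deriv ^^ j) f x\<bar> \<le> c * sobolev_norm s f"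
    "\<And>f j x. f \<in> sobolev_cont s \<Longrightarrow> j < k \<Longrightarrow> ((deriv ^^ j) f has_real_derivative (deriv ^^ Suc j) f x) (at x)"
proof -
  have "\<forall>j\<in>{..k}. \<exists>c. \<forall>g. g \<in> borel_measurable borel \<longrightarrow> fourier_energy s g < \<infinity> \<longrightarrow>
     integrable lborel (\<lambda>\<xi>. complex_of_real \<xi> ^ j * g \<xi>) \<and>
     (LINT \<xi>|lborel. cmod (complex_of_real \<xi> ^ j * g \<xi>)) \<le> c * sqrt (enn2real (fourier_energy s g))"
    using s by (intro ballI fourier_energy_moment_bound) auto
  then obtain c where c: "\<forall>j\<in>{..k}. \<forall>g. g \<in> borel_measurable borel \<longrightarrow> fourier_energy s g < \<infinity> \<longrightarrow>
     integrable lborel (\<lambda>\<xi>. complex_of_real \<xi> ^ j * g \<xi>) \<and>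
     (LINT \<xi>|lborel. cmod (complex_of_real \<xi> ^ j * g \<xi>)) \<le> c j * sqrt (enn2real (fourier_energy s g))"
    by (rule bchoice[THEN exE])
  define C where "C = (\<Sum>j\<le>k. \<bar>c j\<bar>)"
  have main: "continuous_on UNIV ((deriv ^^ j) f) \<and> (\<forall>x. \<bar>(deriv ^^ j) f x\<bar> \<le> C * sobolev_norm s f) \<and>
      (j < k \<longrightarrow> (\<forall>x. ((deriv ^^ j) f has_real_derivative (deriv ^^ Suc j) f x) (at x)))"
    if f: "f \<in> sobolev_cont s" and j: "j \<le> k" for f j
  proof -
    from f have fc: "continuous_on UNIV f" and fs: "f \<in> sobolev s" by (auto simp: sobolev_cont_def)
    from sobolev_chosen_transform[OF fs] obtain g where ft: "has_fourier_transform f g" and E: "fourier_energy s g < \<infinity>"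
      and nrm: "sobolev_norm s f = sqrt (enn2real (fourier_energy s g))" .
    have [measurable]: "g \<in> borel_measurable borel" using has_fourier_transform_measurable[OF ft] by simp
    have gi: "integrable lborel (\<lambda>\<xi>. complex_of_real \<xi> ^ i * g \<xi>)"
      and gb: "(LINT \<xi>|lborel. cmod (complex_of_real \<xi> ^ i * g \<xi>)) \<le> C * sobolev_norm s f" if "i \<le> k" for i
    proof -
      show "integrable lborel (\<lambda>\<xi>. complex_of_real \<xi> ^ i * g \<xi>)" using c E that by auto
      have "(LINT \<xi>|lborel. cmod (complex_of_real \<xi> ^ i * g \<xi>)) \<le> c i * sobolev_norm s f"
        using c E that by (auto simp: nrm)
      also have "c i \<le> \<bar>c i\<bar>" by simp
      also have "\<bar>c i\<bar> \<le> C" unfolding C_def using that by (intro member_le_sum) auto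
      finally show "(LINT \<xi>|lborel. cmod (complex_of_real \<xi> ^ i * g \<xi>)) \<le> C * sobolev_norm s f"
        by (simp add: mult_right_mono nrm)
    qed
    define G where "G i \<xi> = \<i> ^ i * (complex_of_real \<xi> ^ i * g \<xi>)" for i \<xi>
    have Gi: "integrable lborel (G i)" if "i \<le> k" for i
      unfolding G_def using gi[OF that] by auto
    define F where "F i x = (LINT \<xi>|lborel. G i \<xi> * cis (x * \<xi>))" for i x
    \<comment> \<open>The inversion formula is complex while f is real. Only order 0 has to be
      matched with f; the higher \<open>D i\<close> then agree with the iterated
      \<open>deriv\<close> because each is the derivative of the one before.\<close>
    define D where "D i x = Re (F i x) / sqrt (2 * pi)" for i x
    have D0: "f = D 0"
    proof
      fix x
      have "complex_of_real (f x) = F 0 x / complex_of_real (sqrt (2 * pi))"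
        unfolding F_def G_def using fourier_inversion[OF ft fc, of x] gi[of 0] by simp
      hence "Re (complex_of_real (f x)) = Re (F 0 x / complex_of_real (sqrt (2 * pi)))" by simp
      thus "f x = D 0 x" by (simp add: D_def Re_divide_of_real)
    qed
    have Dd: "(D i has_real_derivative D (Suc i) x) (at x)" if "i < k" for i x
    proof -
      have G': "(\<lambda>\<xi>. \<i> * complex_of_real \<xi> * G i \<xi>) = G (Suc i)"
        by (auto simp: G_def)
      have "integrable lborel (\<lambda>\<xi>. complex_of_real \<xi> * G i \<xi>)"
      proof -
        have "(\<lambda>\<xi>. complex_of_real \<xi> * G i \<xi>) = (\<lambda>\<xi>. (- \<i>) * G (Suc i) \<xi>)"
          by (simp add: G'[symmetric] fun_eq_iff mult.assoc [symmetric])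
        thus ?thesis using Gi[of "Suc i"] that by simp
      qed
      from fourier_integral_has_derivative[OF Gi this, of x] that
      have "(F i has_vector_derivative F (Suc i) x) (at x)"
        unfolding F_def [abs_def] G'[symmetric] by simp
      hence "((\<lambda>x. Re (F i x)) has_real_derivative Re (F (Suc i) x)) (at x)"
        by (simp add: has_vector_derivative_complex_iff)
      thus ?thesis unfolding D_def [abs_def] by (rule DERIV_cdivide)
    qed
    have Dn: "(deriv ^^ i) f = D i" if "i \<le> k" for i
      using that
    proof (induction i)
      case 0 thus ?case by (simp add: D0)
    next
      case (Suc i)
      hence "(deriv ^^ Suc i) f = deriv (D i)" by simp
      also have "\<dots> = D (Suc i)" using Dd[of i] Suc.prems by (auto intro!: DERIV_imp_deriv)
      finally show ?case .
    qed
    have "continuous_on UNIV (D j)"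
      unfolding D_def [abs_def] F_def by (intro continuous_intros fourier_integral_continuous Gi j) auto
    moreover have "\<bar>D j x\<bar> \<le> C * sobolev_norm s f" for x
    proof -
      have "1 \<le> sqrt (2 * pi)" using pi_gt3 by simp
      hence "\<bar>D j x\<bar> \<le> \<bar>Re (F j x)\<bar>" by (simp add: D_def divide_le_eq mult_left_le_one_le mult_le_cancel_left1)
      also have "\<dots> \<le> cmod (F j x)" by (rule abs_Re_le_cmod)
      also have "\<dots> \<le> (LINT \<xi>|lborel. cmod (G j \<xi> * cis (x * \<xi>)))" unfolding F_def by (rule integral_norm_bound)
      also have "\<dots> = (LINT \<xi>|lborel. cmod (complex_of_real \<xi> ^ j * g \<xi>))" by (simp add: G_def norm_mult norm_power)
      also have "\<dots> \<le> C * sobolev_norm s f" by (rule gb[OF j])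
      finally show ?thesis .
    qed
    moreover have "j < k \<Longrightarrow> ((deriv ^^ j) f has_real_derivative (deriv ^^ Suc j) f x) (at x)" for x
      using Dd[of j x] Dn[of j] Dn[of "Suc j"] by simp
    ultimately show ?thesis using Dn[OF j] by auto
  qed
  show ?thesis
    by (rule that[of C]) (use main in \<open>blast intro: less_imp_le\<close>)+
qed

section \<open>Test functions\<close>

definition smooth_fun :: "(real \<Rightarrow> real) \<Rightarrow> bool" where
  "smooth_fun f \<longleftrightarrow> (\<forall>k x. (deriv ^^ k) f differentiable (at x))"

text \<open>Smoothness is shown by exhibiting a set of differentiable functions closed under
  \<open>deriv\<close>, so that no closed formula for a k-th derivative is ever required.\<close>

lemma smooth_fun_coinduct:
  assumes "f \<in> A" "\<And>g. g \<in> A \<Longrightarrow> deriv g \<in> A" "\<And>g x. g \<in> A \<Longrightarrow> g differentiable (at x)"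
  shows "smooth_fun f"
proof -
  have "(deriv ^^ k) f \<in> A" for k by (induction k) (use assms in auto)
  thus ?thesis using assms(3) by (auto simp: smooth_fun_def)
qed

lemma smooth_fun_deriv: "smooth_fun f \<Longrightarrow> smooth_fun (deriv f)"
  unfolding smooth_fun_def using funpow_swap1[of deriv] by (metis funpow.simps(2) comp_apply)

lemma smooth_fun_DERIV:
  assumes "smooth_fun f"
  shows "((deriv ^^ k) f has_real_derivative (deriv ^^ Suc k) f x) (at x)"
  using assms by (simp add: smooth_fun_def DERIV_deriv_iff_real_differentiable)

text \<open>An invariant set for the product f * g: by the Leibniz rule the derivative of a member
  is again a member. Repeated summands take the place of binomial coefficients.\<close>

inductive_set product_span :: "(real \<Rightarrow> real) \<Rightarrow> (real \<Rightarrow> real) \<Rightarrow> (real \<Rightarrow> real) set" for f g where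
  prod: "(\<lambda>x. (deriv ^^ i) f x * (deriv ^^ j) g x) \<in> product_span f g"
| add: "p \<in> product_span f g \<Longrightarrow> q \<in> product_span f g \<Longrightarrow> (\<lambda>x. p x + q x) \<in> product_span f g"

lemma smooth_fun_mult:
  assumes f: "smooth_fun f" and g: "smooth_fun g"
  shows "smooth_fun (\<lambda>x. f x * g x)"
proof -
  have D: "\<exists>p'\<in>product_span f g. \<forall>x. (p has_real_derivative p' x) (at x)" if "p \<in> product_span f g" for p
    using that
  proof induction
    case (prod i j)
    show ?case
    proof (intro bexI allI)
      show "(\<lambda>x. (deriv ^^ Suc i) f x * (deriv ^^ j) g x + (deriv ^^ i) f x * (deriv ^^ Suc j) g x) \<in> product_span f g"
        by (intro product_span.intros)
      show "((\<lambda>x. (deriv ^^ i) f x * (deriv ^^ j) g x) has_real_derivative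
          (deriv ^^ Suc i) f x * (deriv ^^ j) g x + (deriv ^^ i) f x * (deriv ^^ Suc j) g x) (at x)" for x
        using DERIV_mult[OF smooth_fun_DERIV[OF f, of i x] smooth_fun_DERIV[OF g, of j x]] by (simp add: mult.commute)
    qed
  next
    case (add p q)
    then obtain p' q' where "p' \<in> product_span f g" "q' \<in> product_span f g"
      "\<forall>x. (p has_real_derivative p' x) (at x)" "\<forall>x. (q has_real_derivative q' x) (at x)" by blast
    thus ?case by (intro bexI[of _ "\<lambda>x. p' x + q' x"]) (auto intro: DERIV_add product_span.add)
  qed
  show ?thesis
  proof (rule smooth_fun_coinduct)
    show "(\<lambda>x. f x * g x) \<in> product_span f g" using product_span.prod[of 0 f 0 g] by simp
    fix p assume p: "p \<in> product_span f g"
    from D[OF p] obtain p' where p': "p' \<in> product_span f g" "\<forall>x. (p has_real_derivative p' x) (at x)" by blast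
    hence "deriv p = p'" by (auto intro: DERIV_imp_deriv)
    thus "deriv p \<in> product_span f g" using p' by simp
    show "p differentiable (at x)" for x
      using p'(2) by (auto simp: real_differentiable_def)
  qed
qed

lemma smooth_fun_affine:
  assumes f: "smooth_fun f"
  shows "smooth_fun (\<lambda>x. f (c * x + d))"
proof -
  have D: "((\<lambda>x. k * (deriv ^^ i) f (c * x + d)) has_real_derivative (k * c) * (deriv ^^ Suc i) f (c * x + d)) (at x)" for k i x
    by (rule derivative_eq_intros DERIV_chain2[OF smooth_fun_DERIV[OF f]] | simp)+
  show ?thesis
  proof (rule smooth_fun_coinduct)
    let ?A = "{\<lambda>x. k * (deriv ^^ i) f (c * x + d) | k i. True}"
    show "(\<lambda>x. f (c * x + d)) \<in> ?A" by (rule CollectI, rule exI[of _ 1], rule exI[of _ 0]) simp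
    fix g assume "g \<in> ?A"
    then obtain k i where g: "g = (\<lambda>x. k * (deriv ^^ i) f (c * x + d))" by blast
    have "deriv g = (\<lambda>x. (k * c) * (deriv ^^ Suc i) f (c * x + d))"
      unfolding g by (intro ext DERIV_imp_deriv D)
    thus "deriv g \<in> ?A" by blast
    show "g differentiable (at x)" for x
      unfolding g using D by (auto simp: real_differentiable_def)
  qed
qed

text \<open>For p = 1 this is the classical flat function exp (-1/x), extended by 0. The polynomial
  in 1/x is carried along so that the family is closed under differentiation.\<close>

definition flat_exp :: "real poly \<Rightarrow> real \<Rightarrow> real" where
  "flat_exp p x = (if x > 0 then poly p (1 / x) * exp (- (1 / x)) else 0)"

lemma flat_exp_tendsto_0: "(flat_exp p \<longlongrightarrow> 0) (at 0)"
proof -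
  have "((\<lambda>z. \<Sum>i\<le>degree p. coeff p i * (z ^ i / exp z)) \<longlongrightarrow> (\<Sum>i\<le>degree p. coeff p i * 0)) at_top"
    by (intro tendsto_intros tendsto_power_div_exp_0)
  hence "((\<lambda>z. poly p z * exp (- z)) \<longlongrightarrow> 0) at_top"
    by (simp add: poly_altdef sum_distrib_right exp_minus divide_inverse mult.assoc)
  from filterlim_compose[OF this filterlim_inverse_at_top_right]
  have R: "((\<lambda>x. poly p (inverse x) * exp (- inverse x)) \<longlongrightarrow> 0) (at_right 0)" .
  have "(flat_exp p \<longlongrightarrow> 0) (at_right 0)"
    by (rule Lim_transform_eventually[OF R])
       (use eventually_at_right_less[of 0] in eventually_elim, simp add: flat_exp_def divide_inverse)
  moreover have "(flat_exp p \<longlongrightarrow> 0) (at_left 0)"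
  proof (rule Lim_transform_eventually[OF tendsto_const])
    show "\<forall>\<^sub>F x in at_left 0. 0 = flat_exp p x"
      by (auto simp: eventually_at_filter flat_exp_def)
  qed
  ultimately show ?thesis by (simp add: filterlim_split_at)
qed

text \<open>With z = 1/x one has dz/dx = - z^2, so p(z) * exp (-z) has derivative z^2 * (p - p')(z)
  * exp (-z). At 0 the difference quotient is the member with polynomial z * p, which tends to
  0.\<close>

lemma flat_exp_DERIV:
  "(flat_exp p has_real_derivative flat_exp ([:0, 0, 1:] * (p - pderiv p)) x) (at x)"
proof -
  consider "x > 0" | "x < 0" | "x = 0" by linarith
  thus ?thesis
  proof cases
    case 1
    have "((\<lambda>x. poly p (1 / x) * exp (- (1 / x))) has_real_derivative flat_exp ([:0, 0, 1:] * (p - pderiv p)) x) (at x)"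
      using 1 by (auto intro!: derivative_eq_intros DERIV_chain2[OF poly_DERIV] simp: flat_exp_def field_simps power2_eq_square)
    moreover have "\<forall>\<^sub>F y in nhds x. flat_exp p y = poly p (1 / y) * exp (- (1 / y))"
      using eventually_nhds_in_open[of "{0<..}" x] 1 by (auto simp: flat_exp_def elim!: eventually_mono)
    ultimately show ?thesis by (subst DERIV_cong_ev[OF refl _ refl])
  next
    case 2
    have "((\<lambda>x. 0) has_real_derivative flat_exp ([:0, 0, 1:] * (p - pderiv p)) x) (at x)"
      using 2 by (simp add: flat_exp_def)
    moreover have "\<forall>\<^sub>F y in nhds x. flat_exp p y = 0"
      using eventually_nhds_in_open[of "{..<0}" x] 2 by (auto simp: flat_exp_def elim!: eventually_mono)
    ultimately show ?thesis by (subst DERIV_cong_ev[OF refl _ refl])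
  next
    case 3
    have "flat_exp p y / y = flat_exp ([:0, 1:] * p) y" for y
      by (simp add: flat_exp_def)
    hence "((\<lambda>y. (flat_exp p y - flat_exp p 0) / (y - 0)) \<longlongrightarrow> 0) (at 0)"
    proof -
      have "flat_exp p 0 = 0" by (simp add: flat_exp_def)
      thus ?thesis
        using flat_exp_tendsto_0[of "[:0, 1:] * p"] \<open>\<And>y. flat_exp p y / y = _\<close> by (simp only: diff_zero)
    qed
    thus ?thesis using 3
      by (simp add: has_field_derivative_iff flat_exp_def)
  qed
qed

lemma smooth_fun_flat_exp: "smooth_fun (flat_exp p)"
proof (rule smooth_fun_coinduct)
  show "flat_exp p \<in> range flat_exp" by simp
  fix g assume "g \<in> range flat_exp"
  then obtain q where g: "g = flat_exp q" by blast
  have "deriv g = flat_exp ([:0, 0, 1:] * (q - pderiv q))"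
    unfolding g by (intro ext DERIV_imp_deriv flat_exp_DERIV)
  thus "deriv g \<in> range flat_exp" by blast
  show "g differentiable (at x)" for x
    unfolding g using flat_exp_DERIV by (auto simp: real_differentiable_def)
qed

text \<open>The first factor vanishes for x \<le> -1, the second for x \<ge> 1. The arguments are
  spelled out as c * x + d so that \<open>smooth_fun_affine\<close> matches.\<close>

definition bump :: "real \<Rightarrow> real" where
  "bump x = flat_exp 1 (1 * x + 1) * flat_exp 1 ((-1) * x + 1)"

lemma bump_smooth: "smooth_fun bump"
  unfolding bump_def [abs_def] by (intro smooth_fun_mult smooth_fun_affine smooth_fun_flat_exp)

lemma bump_nonneg: "bump x \<ge> 0"
  by (simp add: bump_def flat_exp_def)

lemma bump_pos: "\<bar>x\<bar> < 1 \<Longrightarrow> bump x > 0"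
  by (simp add: bump_def flat_exp_def abs_less_iff)

lemma bump_eq_0: "\<bar>x\<bar> \<ge> 1 \<Longrightarrow> bump x = 0"
  by (cases "x \<ge> 0") (auto simp: bump_def flat_exp_def)

section \<open>Closure of test functions under differentiation, and rescaled bumps\<close>

lemma test_function_iff: "test_function \<phi> \<longleftrightarrow> smooth_fun \<phi> \<and> (\<exists>R. \<forall>x. \<bar>x\<bar> > R \<longrightarrow> \<phi> x = 0)"
  by (simp add: test_function_def smooth_fun_def)

lemma deriv_zero_outside:
  fixes \<phi> :: "real \<Rightarrow> real"
  assumes "\<And>x. \<bar>x\<bar> > R \<Longrightarrow> \<phi> x = 0" "\<bar>x\<bar> > R"
  shows "(\<phi> has_real_derivative 0) (at x)"
proof -
  have "open {x::real. \<bar>x\<bar> > R}" by (intro open_Collect_less continuous_intros)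
  from eventually_nhds_in_open[OF this, of x]
  have "\<forall>\<^sub>F y in nhds x. \<phi> y = 0" using assms by (auto elim!: eventually_mono)
  thus ?thesis by (subst DERIV_cong_ev[OF refl _ refl]) auto
qed

lemma test_function_deriv:
  assumes "test_function \<phi>"
  shows "test_function (deriv \<phi>)"
proof -
  from assms obtain R where s: "smooth_fun \<phi>" and R: "\<And>x. \<bar>x\<bar> > R \<Longrightarrow> \<phi> x = 0"
    by (auto simp: test_function_iff)
  have "deriv \<phi> x = 0" if "\<bar>x\<bar> > R" for x
    by (rule DERIV_imp_deriv[OF deriv_zero_outside[of R, OF R that]])
  moreover have "smooth_fun (deriv \<phi>)"
    using s by (rule smooth_fun_deriv)
  ultimately show ?thesis by (auto simp: test_function_iff)
qed

lemma test_function_DERIV: "test_function \<phi> \<Longrightarrow> (\<phi> has_real_derivative deriv \<phi> x) (at x)"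
  using smooth_fun_DERIV[of \<phi> 0 x] by (simp add: test_function_iff)

lemma test_function_continuous: "test_function \<phi> \<Longrightarrow> continuous_on A \<phi>"
  using test_function_DERIV DERIV_continuous_on by (metis DERIV_subset subset_UNIV)

lemma test_function_bump:
  assumes "\<epsilon> > 0"
  shows "test_function (\<lambda>y. bump ((y - z) / \<epsilon>))"
proof -
  have "smooth_fun (\<lambda>y. bump ((1 / \<epsilon>) * y + (- z / \<epsilon>)))"
    by (rule smooth_fun_affine[OF bump_smooth])
  moreover have "(\<lambda>y. bump ((1 / \<epsilon>) * y + (- z / \<epsilon>))) = (\<lambda>y. bump ((y - z) / \<epsilon>))"
    by (auto simp: diff_divide_distrib)
  moreover have "bump ((y - z) / \<epsilon>) = 0" if "\<bar>y\<bar> > \<bar>z\<bar> + \<epsilon>" for y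
    using that assms by (intro bump_eq_0) (auto simp: le_divide_eq)
  ultimately show ?thesis by (auto simp: test_function_iff)
qed

lemma bump_DERIV: "(bump has_real_derivative deriv bump x) (at x)"
  using smooth_fun_DERIV[OF bump_smooth, of 0 x] by simp

lemma deriv_bump_eq_0: "\<bar>x\<bar> > 1 \<Longrightarrow> deriv bump x = 0"
  by (intro DERIV_imp_deriv deriv_zero_outside[of 1]) (auto intro: bump_eq_0)

lemma bump_continuous: "continuous_on A bump" "continuous_on A (deriv bump)"
proof -
  have "((deriv bump) has_real_derivative deriv (deriv bump) x) (at x)" for x
    using smooth_fun_DERIV[OF bump_smooth, of 1 x] by simp
  thus "continuous_on A bump" "continuous_on A (deriv bump)"
    using bump_DERIV by (metis DERIV_continuous_on DERIV_subset subset_UNIV)+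
qed

section \<open>Characteristics\<close>

lemma compact_support_integrable:
  fixes F :: "real \<Rightarrow> real"
  assumes "continuous_on {a..b} F" "\<And>x. x \<notin> {a..b} \<Longrightarrow> F x = 0"
  shows "integrable lborel F"
proof -
  have "integrable lborel (\<lambda>x. indicator {a..b} x *\<^sub>R F x)"
    by (rule borel_integrable_compact[OF compact_Icc assms(1)])
  also have "(\<lambda>x. indicator {a..b} x *\<^sub>R F x) = F"
  proof
    show "indicator {a..b} x *\<^sub>R F x = F x" for x
      by (cases "x \<in> {a..b}") (use assms(2)[of x] in auto)
  qed
  finally show ?thesis .
qed

lemma abs_integral_le_integral:
  fixes F :: "real \<Rightarrow> real"
  assumes F: "integrable lborel F" and G: "integrable lborel G" and "\<And>x. \<bar>F x\<bar> \<le> G x"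
  shows "\<bar>LINT x|lborel. F x\<bar> \<le> (LINT x|lborel. G x)"
proof -
  have "\<bar>LINT x|lborel. F x\<bar> \<le> (LINT x|lborel. \<bar>F x\<bar>)"
    using integral_norm_bound[of lborel F] by simp
  also have "\<dots> \<le> (LINT x|lborel. G x)"
    using assms by (intro integral_mono) auto
  finally show ?thesis .
qed

text \<open>Serves as integration by parts throughout: F is taken to be the product in question, and
  the boundary terms vanish.\<close>

lemma compact_support_integral_deriv:
  fixes F F' :: "real \<Rightarrow> real"
  assumes "\<And>x. (F has_real_derivative F' x) (at x)" "continuous_on UNIV F'"
    "\<And>x. \<bar>x\<bar> > R \<Longrightarrow> F x = 0"
  shows "(LINT x|lborel. F' x) = 0"
proof -
  define S where "S = \<bar>R\<bar> + 1"
  have S: "S > 0" "S > R" by (auto simp: S_def)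
  have out: "F' x = 0" if "x \<notin> {-S..S}" for x
  proof -
    have "\<bar>x\<bar> > R" using that S by auto
    from DERIV_unique[OF assms(1) deriv_zero_outside[of R F x, OF assms(3) this]] show ?thesis .
  qed
  have "(LINT x|lborel. F' x) = (LINT x|lborel. F' x * indicator {-S..S} x)"
    using out by (intro Bochner_Integration.integral_cong) (auto simp: indicator_def)
  also have "\<dots> = F S - F (- S)"
    using assms(1,2) S by (intro integral_FTC_Icc_real) (auto simp: continuous_on_eq_continuous_at)
  also have "\<dots> = 0" using assms(3) S by simp
  finally show ?thesis .
qed

text \<open>Picard's fixed point argument on the whole interval at once: the Lipschitz bound is
  global in x and T * L \<le> 1/4 makes the integral map a contraction. The value is prescribed at
  an arbitrary time t, because characteristics are followed back from a given point.\<close>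

lemma ode_terminal_value_exists:
  fixes a :: "real \<Rightarrow> real \<Rightarrow> real"
  assumes T: "0 \<le> T" and t: "t \<in> {0..T}"
    and cont: "continuous_on ({0..T} \<times> UNIV) (\<lambda>(t, x). a t x)"
    and lip: "\<And>t x y. t \<in> {0..T} \<Longrightarrow> \<bar>a t x - a t y\<bar> \<le> L * \<bar>x - y\<bar>"
    and L: "0 \<le> L" "T * L \<le> 1 / 4"
  obtains \<eta> where "\<eta> t = y" "\<And>\<tau>. \<tau> \<in> {0..T} \<Longrightarrow> (\<eta> has_real_derivative a \<tau> (\<eta> \<tau>)) (at \<tau> within {0..T})"
proof -
  define I where "I (\<eta> :: real \<Rightarrow>\<^sub>C real) r = integral {0..r} (\<lambda>\<sigma>. a \<sigma> (\<eta> \<sigma>))" for \<eta> r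
  have ac: "continuous_on {0..T} (\<lambda>\<sigma>. a \<sigma> (apply_bcontfun \<eta> \<sigma>))" for \<eta>
  proof -
    have "continuous_on {0..T} (\<lambda>\<sigma>. (\<lambda>(t, x). a t x) (\<sigma>, apply_bcontfun \<eta> \<sigma>))"
      by (rule continuous_on_compose2[OF cont]) (auto intro!: continuous_intros)
    thus ?thesis by simp
  qed
  have ai: "(\<lambda>\<sigma>. a \<sigma> (apply_bcontfun \<eta> \<sigma>)) integrable_on {0..r}" if "r \<in> {0..T}" for \<eta> r
    using that by (intro integrable_continuous_interval continuous_on_subset[OF ac]) auto
  have ID: "((I \<eta>) has_real_derivative a r (\<eta> r)) (at r within {0..T})" if "r \<in> {0..T}" for \<eta> r
    unfolding I_def by (rule integral_has_real_derivative[OF ac that])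
  hence Ic: "continuous_on {0..T} (I \<eta>)" for \<eta>
    by (rule DERIV_continuous_on)
  have Il: "\<bar>I \<eta> r - I \<zeta> r\<bar> \<le> dist \<eta> \<zeta> / 4" if r: "r \<in> {0..T}" for \<eta> \<zeta> r
  proof -
    have "norm (integral {0..r} (\<lambda>\<sigma>. a \<sigma> (\<eta> \<sigma>) - a \<sigma> (\<zeta> \<sigma>))) \<le> integral {0..r} (\<lambda>\<sigma>. L * dist \<eta> \<zeta>)"
    proof (rule integral_norm_bound_integral)
      show "(\<lambda>\<sigma>. a \<sigma> (\<eta> \<sigma>) - a \<sigma> (\<zeta> \<sigma>)) integrable_on {0..r}"
        using ai[OF r] by (intro integrable_diff) auto
      show "(\<lambda>\<sigma>. L * dist \<eta> \<zeta>) integrable_on {0..r}" by (rule integrable_const_ivl)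
      fix \<sigma> assume "\<sigma> \<in> {0..r}"
      hence "\<sigma> \<in> {0..T}" using r by auto
      hence "norm (a \<sigma> (\<eta> \<sigma>) - a \<sigma> (\<zeta> \<sigma>)) \<le> L * \<bar>\<eta> \<sigma> - \<zeta> \<sigma>\<bar>" using lip by simp
      also have "\<dots> \<le> L * dist \<eta> \<zeta>"
        using dist_bounded[of \<eta> \<sigma> \<zeta>] L by (intro mult_left_mono) (auto simp: dist_real_def)
      finally show "norm (a \<sigma> (\<eta> \<sigma>) - a \<sigma> (\<zeta> \<sigma>)) \<le> L * dist \<eta> \<zeta>" .
    qed
    also have "integral {0..r} (\<lambda>\<sigma>. L * dist \<eta> \<zeta>) = r * L * dist \<eta> \<zeta>"
      using r by simp
    also have "\<dots> \<le> 1/4 * dist \<eta> \<zeta>"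
    proof (rule mult_right_mono)
      have "r * L \<le> T * L" using r L by (intro mult_right_mono) auto
      thus "r * L \<le> 1/4" using L by linarith
    qed simp
    finally show ?thesis
      unfolding I_def using ai[OF r] by (simp add: integral_diff)
  qed
  \<comment> \<open>Subtracting \<open>I \<eta> t\<close> moves the base point of the integral from
    0 to t. The clamp extends the image curve constantly beyond [0, T], so that it is a bounded
    continuous function on all reals, an element of the complete space
    \<open>bcontfun\<close>.\<close>
  have "\<exists>P. \<forall>x. apply_bcontfun P x = y - I \<eta> t + I \<eta> (clamp 0 T x)" for \<eta>
  proof -
    have "continuous_on (cbox 0 T) (\<lambda>x. y - I \<eta> t + I \<eta> x)"
      using Ic by (auto intro!: continuous_intros simp: box_real)
    from continuous_on_cbox_bcontfunE[OF this] show ?thesis by metis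
  qed
  then obtain P where P: "\<And>\<eta> x. apply_bcontfun (P \<eta>) x = y - I \<eta> t + I \<eta> (clamp 0 T x)" by metis
  have clamp: "clamp 0 T x \<in> {0..T}" for x :: real
    using clamp_in_interval[of 0 T x] T by (simp add: box_real)
  have "\<exists>!\<eta>. P \<eta> = \<eta>"
  proof (rule banach_fix_type)
    \<comment> \<open>Two integrals enter, one up to t and one up to the clamped argument; each
      contributes 1/4.\<close>
    show "\<forall>\<eta> \<zeta>. dist (P \<eta>) (P \<zeta>) \<le> 1/2 * dist \<eta> \<zeta>"
    proof (intro allI dist_bound)
      fix \<eta> \<zeta> x
      show "dist (apply_bcontfun (P \<eta>) x) (apply_bcontfun (P \<zeta>) x) \<le> 1 / 2 * dist \<eta> \<zeta>"
        using Il[OF t, of \<eta> \<zeta>] Il[OF clamp[of x], of \<eta> \<zeta>] unfolding P dist_real_def by linarith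
    qed
  qed auto
  then obtain \<eta> where \<eta>: "P \<eta> = \<eta>" by blast
  have eq: "\<eta> x = y - I \<eta> t + I \<eta> x" if "x \<in> {0..T}" for x
    using P[of \<eta> x] that unfolding \<eta> by (simp add: clamp_cancel_cbox box_real)
  show ?thesis
  proof (rule that[of "apply_bcontfun \<eta>"])
    show "\<eta> t = y" using eq[OF t] by simp
    fix \<tau> assume \<tau>: "\<tau> \<in> {0..T}"
    have "((\<lambda>x. y - I \<eta> t + I \<eta> x) has_real_derivative 0 + a \<tau> (\<eta> \<tau>)) (at \<tau> within {0..T})"
      by (intro DERIV_add DERIV_const ID \<tau>)
    thus "(apply_bcontfun \<eta> has_real_derivative a \<tau> (\<eta> \<tau>)) (at \<tau> within {0..T})"
      unfolding add_0 by (rule has_field_derivative_transform_within[where d=1]) (use \<tau> eq in auto)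
  qed
qed

section \<open>Weak transport equations\<close>

text \<open>The weak form of f_t + a f_x = g. The term a f_x paired with \<phi> becomes the negative
  of the integral of f * (a \<phi>)_x, so only the velocity and the test function are
  differentiated.\<close>

definition weak_transport ::
  "real \<Rightarrow> (real \<Rightarrow> real \<Rightarrow> real) \<Rightarrow> (real \<Rightarrow> real \<Rightarrow> real) \<Rightarrow> (real \<Rightarrow> real \<Rightarrow> real) \<Rightarrow> bool" where
  "weak_transport T a f g \<longleftrightarrow> (\<forall>\<phi> t. test_function \<phi> \<longrightarrow> t \<in> {0..T} \<longrightarrow>
     ((\<lambda>\<tau>. LINT x|lborel. f \<tau> x * \<phi> x) has_real_derivative
        (LINT x|lborel. f t x * deriv (\<lambda>y. a t y * \<phi> y) x + g t x * \<phi> x)) (at t within {0..T}))"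

lemma continuous_on_slice:
  assumes "continuous_on (A \<times> UNIV) (\<lambda>(t, x). f t x)" "t \<in> A"
  shows "continuous_on S (f t)"
proof -
  have "continuous_on S (\<lambda>x. (\<lambda>(t, x). f t x) (t, x))"
    by (rule continuous_on_compose2[OF assms(1)]) (use assms(2) in \<open>auto intro!: continuous_intros\<close>)
  thus ?thesis by simp
qed

text \<open>The curve over [0, T] and its unit neighbourhood lie in a compact strip, where h is
  uniformly continuous; hence one radius works for all times.\<close>

lemma uniform_near_curve:
  fixes h :: "real \<Rightarrow> real \<Rightarrow> real"
  assumes h: "continuous_on ({0..T} \<times> UNIV) (\<lambda>(t, x). h t x)"
    and \<eta>: "continuous_on {0..T} \<eta>" and \<delta>: "\<delta> > 0"
  obtains e where "e > 0" "\<And>t y. t \<in> {0..T} \<Longrightarrow> \<bar>y - \<eta> t\<bar> \<le> e \<Longrightarrow> \<bar>h t y - h t (\<eta> t)\<bar> \<le> \<delta>"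
proof -
  have "bounded (\<eta> ` {0..T})"
    by (intro compact_imp_bounded compact_continuous_image \<eta> compact_Icc)
  then obtain R where R: "\<And>t. t \<in> {0..T} \<Longrightarrow> \<bar>\<eta> t\<bar> \<le> R"
    unfolding bounded_iff real_norm_def by blast
  have "compact ({0..T} \<times> {-(R+1)..R+1})" by (intro compact_Times compact_Icc)
  moreover have "continuous_on ({0..T} \<times> {-(R+1)..R+1}) (\<lambda>(t, x). h t x)"
    by (rule continuous_on_subset[OF h]) auto
  ultimately have "uniformly_continuous_on ({0..T} \<times> {-(R+1)..R+1}) (\<lambda>(t, x). h t x)"
    by (intro compact_uniformly_continuous)
  from uniformly_continuous_onE[OF this \<delta>] obtain d where d: "d > 0"
    "\<And>p q. p \<in> {0..T} \<times> {-(R+1)..R+1} \<Longrightarrow> q \<in> {0..T} \<times> {-(R+1)..R+1} \<Longrightarrow> dist q p < d \<Longrightarrow>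
       dist ((\<lambda>(t, x). h t x) q) ((\<lambda>(t, x). h t x) p) < \<delta>" by metis
  show ?thesis
  proof (rule that[of "min (d/2) 1"])
    fix t y assume t: "t \<in> {0..T}" and y: "\<bar>y - \<eta> t\<bar> \<le> min (d/2) 1"
    have "\<bar>y\<bar> \<le> R + 1" using R[OF t] y by linarith
    hence "(t, y) \<in> {0..T} \<times> {-(R+1)..R+1}" "(t, \<eta> t) \<in> {0..T} \<times> {-(R+1)..R+1}"
      using t R[OF t] by auto
    moreover have "dist (t, y) (t, \<eta> t) < d" using y d(1) by (simp add: dist_Pair_Pair dist_real_def)
    ultimately show "\<bar>h t y - h t (\<eta> t)\<bar> \<le> \<delta>"
      using d(2)[of "(t, \<eta> t)" "(t, y)"] by (simp add: dist_real_def)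
  qed (use d in auto)
qed

text \<open>The weak equation speaks of a fixed test function, but here the bump is centred at
  \<open>\<eta> \<tau>\<close>. With time and centre as independent variables, the time derivative
  of the average is the weak equation and the centre derivative falls on the smooth bump; the chain
  rule along (\<tau>, \<eta> \<tau>) joins them.\<close>

lemma moving_mollifier_derivative:
  fixes f a g :: "real \<Rightarrow> real \<Rightarrow> real" and \<eta> :: "real \<Rightarrow> real"
  assumes wt: "weak_transport T a f g"
    and f: "continuous_on ({0..T} \<times> UNIV) (\<lambda>(t, x). f t x)"
    and \<eta>: "\<And>\<tau>. \<tau> \<in> {0..T} \<Longrightarrow> (\<eta> has_real_derivative a \<tau> (\<eta> \<tau>)) (at \<tau> within {0..T})"
    and \<epsilon>: "0 < \<epsilon>" "\<epsilon> \<le> 1" and t: "t \<in> {0..T}"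
  defines "\<phi> \<equiv> \<lambda>z y. bump ((y - z) / \<epsilon>)"
  shows "((\<lambda>\<tau>. LINT y|lborel. f \<tau> y * \<phi> (\<eta> \<tau>) y) has_real_derivative
     (LINT y|lborel. f t y * deriv (\<lambda>y. a t y * \<phi> (\<eta> t) y) y + g t y * \<phi> (\<eta> t) y)
     - a t (\<eta> t) * (LINT y|lborel. f t y * deriv (\<phi> (\<eta> t)) y)) (at t within {0..T})"
proof -
  have \<phi>t: "test_function (\<phi> z)" for z unfolding \<phi>_def by (rule test_function_bump[OF \<epsilon>(1)])
  have dz: "((\<lambda>z. \<phi> z y) has_real_derivative - deriv bump ((y - z) / \<epsilon>) / \<epsilon>) (at z within A)" for z y A
  proof -
    have "((\<lambda>z. (y - z) / \<epsilon>) has_real_derivative (- 1) / \<epsilon>) (at z)"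
      using \<epsilon>(1) by (auto intro!: derivative_eq_intros)
    from DERIV_chain2[OF bump_DERIV this] show ?thesis
      unfolding \<phi>_def by (auto intro: has_field_derivative_at_within)
  qed
  have dy: "deriv (\<phi> z) y = deriv bump ((y - z) / \<epsilon>) / \<epsilon>" for z y
  proof -
    have "((\<lambda>y. (y - z) / \<epsilon>) has_real_derivative 1 / \<epsilon>) (at y)"
      using \<epsilon>(1) by (auto intro!: derivative_eq_intros)
    from DERIV_chain2[OF bump_DERIV this] show ?thesis
      unfolding \<phi>_def by (auto intro: DERIV_imp_deriv)
  qed
  have fs: "continuous_on S (f \<tau>)" if "\<tau> \<in> {0..T}" for \<tau> S by (rule continuous_on_slice[OF f that])
  have \<eta>c: "continuous_on {0..T} \<eta>" using \<eta> by (rule DERIV_continuous_on)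
  have "bounded (\<eta> ` {0..T})"
    by (intro compact_imp_bounded compact_continuous_image \<eta>c compact_Icc)
  then obtain R where R: "\<And>\<tau>. \<tau> \<in> {0..T} \<Longrightarrow> \<bar>\<eta> \<tau>\<bar> \<le> R"
    unfolding bounded_iff real_norm_def by blast
  \<comment> \<open>\<open>Y\<close> contains the whole curve. As \<epsilon> \<le> 1, every bump
    centred in \<open>Y\<close> is supported in [-c, c], so all integrals run over one compact
    interval.\<close>
  define Y where "Y = {-R..R}"
  define c where "c = R + 1"
  have outb: "\<phi> z y = 0" "deriv (\<phi> z) y = 0" if "z \<in> Y" "y \<notin> {-c..c}" for z y
  proof -
    have 1: "\<bar>(y' - z) / \<epsilon>\<bar> \<ge> 1" if "\<bar>y'\<bar> > c" for y'
    proof -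
      have "\<bar>y' - z\<bar> \<ge> 1" using \<open>z \<in> Y\<close> that by (auto simp: Y_def c_def abs_le_iff)
      thus ?thesis using \<epsilon> by (simp add: le_divide_eq)
    qed
    have y: "\<bar>y\<bar> > c" using that(2) by auto
    show "\<phi> z y = 0" using 1[OF y] by (simp add: \<phi>_def bump_eq_0)
    show "deriv (\<phi> z) y = 0"
      by (rule DERIV_imp_deriv, rule deriv_zero_outside[of c, OF _ y]) (use 1 in \<open>auto simp: \<phi>_def bump_eq_0\<close>)
  qed
  \<comment> \<open>Passes to the gauge integral over a compact interval, for which the Leibniz rule
    and continuity in a parameter are available.\<close>
  have LI: "(LINT y|lborel. F y) = integral {-c..c} F" if "continuous_on {-c..c} F" "\<And>y. y \<notin> {-c..c} \<Longrightarrow> F y = 0" for F :: "real \<Rightarrow> real"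
  proof -
    have "(F has_integral (LINT y|lborel. F y)) UNIV"
      by (intro has_integral_integral_lborel compact_support_integrable[of "-c" c] that)
    moreover have "(F has_integral integral {-c..c} F) UNIV"
      by (rule has_integral_on_superset[OF integrable_integral])
         (use that in \<open>auto intro: integrable_continuous_interval\<close>)
    ultimately show ?thesis by (rule has_integral_unique)
  qed
  define P where "P \<tau> z = (LINT y|lborel. f \<tau> y * \<phi> z y)" for \<tau> z
  define Pz where "Pz \<tau> z = integral {-c..c} (\<lambda>y. f \<tau> y * (- deriv bump ((y - z) / \<epsilon>) / \<epsilon>))" for \<tau> z
  have P_eq: "P \<tau> z = integral {-c..c} (\<lambda>y. f \<tau> y * \<phi> z y)" if "\<tau> \<in> {0..T}" "z \<in> Y" for \<tau> z
    unfolding P_def using outb(1)[OF that(2)]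
    by (intro LI continuous_on_mult fs that test_function_continuous \<phi>t) simp
  have PzD: "((\<lambda>z. P \<tau> z) has_real_derivative Pz \<tau> z) (at z within Y)" if \<tau>: "\<tau> \<in> {0..T}" and z: "z \<in> Y" for \<tau> z
  proof -
    have "((\<lambda>z. integral (cbox (-c) c) (\<lambda>y. f \<tau> y * \<phi> z y)) has_real_derivative
       integral (cbox (-c) c) (\<lambda>y. f \<tau> y * (- deriv bump ((y - z) / \<epsilon>) / \<epsilon>))) (at z within Y)"
    proof (rule leibniz_rule_field_derivative[where fx = "\<lambda>z y. f \<tau> y * (- deriv bump ((y - z) / \<epsilon>) / \<epsilon>)"])
      show "((\<lambda>z. f \<tau> y * \<phi> z y) has_real_derivative f \<tau> y * (- deriv bump ((y - z) / \<epsilon>) / \<epsilon>)) (at z within Y)" for z y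
        by (rule DERIV_cmult[OF dz])
      show "(\<lambda>y. f \<tau> y * \<phi> z y) integrable_on cbox (-c) c" for z
        by (intro integrable_continuous continuous_on_mult fs \<tau> test_function_continuous \<phi>t)
      have "continuous_on (Y \<times> cbox (-c) c) (\<lambda>p. f \<tau> (snd p))"
        by (rule continuous_on_compose2[OF fs[OF \<tau>, of UNIV]]) (auto intro!: continuous_intros)
      moreover have "continuous_on (Y \<times> cbox (-c) c) (\<lambda>p. deriv bump ((snd p - fst p) / \<epsilon>))"
        by (rule continuous_on_compose2[OF bump_continuous(2)[of UNIV]]) (use \<epsilon>(1) in \<open>auto intro!: continuous_intros\<close>)
      ultimately show "continuous_on (Y \<times> cbox (-c) c) (\<lambda>(z, y). f \<tau> y * (- deriv bump ((y - z) / \<epsilon>) / \<epsilon>))"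
        using \<epsilon>(1) by (auto simp: case_prod_beta intro!: continuous_intros)
    qed (use z in \<open>auto simp: Y_def\<close>)
    hence "((\<lambda>z. integral {-c..c} (\<lambda>y. f \<tau> y * \<phi> z y)) has_real_derivative Pz \<tau> z) (at z within Y)"
      by (simp add: Pz_def)
    thus ?thesis
      by (rule has_field_derivative_transform_within[where d=1]) (use P_eq \<tau> z in auto)
  qed
  have Pzc: "continuous_on ({0..T} \<times> Y) (\<lambda>(\<tau>, z). Pz \<tau> z)"
  proof -
    have "continuous_on (({0..T} \<times> Y) \<times> cbox (-c) c) (\<lambda>q. f (fst (fst q)) (snd q))"
    proof -
      have "continuous_on (({0..T} \<times> Y) \<times> cbox (-c) c) (\<lambda>q. (\<lambda>(t, x). f t x) (fst (fst q), snd q))"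
        by (rule continuous_on_compose2[OF f]) (auto intro!: continuous_intros)
      thus ?thesis by simp
    qed
    moreover have "continuous_on (({0..T} \<times> Y) \<times> cbox (-c) c) (\<lambda>q. deriv bump ((snd q - snd (fst q)) / \<epsilon>))"
      by (rule continuous_on_compose2[OF bump_continuous(2)[of UNIV]]) (use \<epsilon>(1) in \<open>auto intro!: continuous_intros\<close>)
    ultimately have "continuous_on (({0..T} \<times> Y) \<times> cbox (-c) c) (\<lambda>(p, y). f (fst p) y * (- deriv bump ((y - snd p) / \<epsilon>) / \<epsilon>))"
      using \<epsilon>(1) by (auto simp: case_prod_beta intro!: continuous_intros)
    from integral_continuous_on_param[OF this]
    show ?thesis by (simp add: Pz_def case_prod_beta)
  qed
  have zY: "\<eta> \<tau> \<in> Y" if "\<tau> \<in> {0..T}" for \<tau>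
    using R[OF that] by (simp add: Y_def abs_le_iff)
  note zt = zY[OF t]
  define W where "W = (LINT y|lborel. f t y * deriv (\<lambda>y. a t y * \<phi> (\<eta> t) y) y + g t y * \<phi> (\<eta> t) y)"
  \<comment> \<open>Joint differentiability follows from an asymmetric criterion: the time
    derivative is supplied at the single point (t, \<eta> t), while the centre derivative is
    continuous in both variables.\<close>
  have "((\<lambda>(\<tau>, z). P \<tau> z) has_derivative (\<lambda>(dt, dz). W * dt + blinfun_apply (blinfun_mult_right (Pz t (\<eta> t))) dz)) (at (t, \<eta> t) within {0..T} \<times> Y)"
  proof (rule has_derivative_partialsI[where fy = "\<lambda>\<tau> z. blinfun_mult_right (Pz \<tau> z)"])
    show "((\<lambda>\<tau>. P \<tau> (\<eta> t)) has_derivative (*) W) (at t within {0..T})"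
      using wt \<phi>t t unfolding weak_transport_def P_def W_def has_field_derivative_def by blast
    show "((\<lambda>z. P \<tau> z) has_derivative blinfun_apply (blinfun_mult_right (Pz \<tau> z))) (at z within Y)" if "\<tau> \<in> {0..T}" "z \<in> Y" for \<tau> z
      using PzD[OF that] by (simp add: has_field_derivative_eq_has_derivative_blinfun)
    have "continuous_on ({0..T} \<times> Y) (\<lambda>(\<tau>, z). blinfun_mult_right (Pz \<tau> z))"
      using Pzc by (auto simp: case_prod_beta intro!: continuous_intros bounded_linear.continuous_on[OF bounded_linear_blinfun_mult_right])
    thus "continuous (at (t, \<eta> t) within {0..T} \<times> Y) (\<lambda>(\<tau>, z). blinfun_mult_right (Pz \<tau> z))"
      using t zt by (auto simp: continuous_on_eq_continuous_within)
  qed (use zt in \<open>auto simp: Y_def\<close>)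
  hence D2: "((\<lambda>(\<tau>, z). P \<tau> z) has_derivative (\<lambda>(dt, dz). W * dt + Pz t (\<eta> t) * dz)) (at (t, \<eta> t) within {0..T} \<times> Y)"
    by simp
  have D1: "((\<lambda>\<tau>. (\<tau>, \<eta> \<tau>)) has_derivative (\<lambda>h. (h, a t (\<eta> t) * h))) (at t within {0..T})"
    using \<eta>[OF t] by (auto intro!: has_derivative_Pair simp: has_field_derivative_def)
  have "((\<lambda>\<tau>. (\<lambda>(\<tau>, z). P \<tau> z) (\<tau>, \<eta> \<tau>)) has_derivative (\<lambda>h. (\<lambda>(dt, dz). W * dt + Pz t (\<eta> t) * dz) (h, a t (\<eta> t) * h))) (at t within {0..T})"
    by (rule has_derivative_in_compose[OF D1 has_derivative_subset[OF D2]])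
       (use zY in auto)
  moreover have "Pz t (\<eta> t) = - (LINT y|lborel. f t y * deriv (\<phi> (\<eta> t)) y)"
  proof -
    have "(LINT y|lborel. f t y * deriv (\<phi> (\<eta> t)) y) = integral {-c..c} (\<lambda>y. f t y * deriv (\<phi> (\<eta> t)) y)"
      using outb(2)[OF zt]
      by (intro LI continuous_on_mult fs t test_function_continuous test_function_deriv \<phi>t) simp
    also have "\<dots> = - Pz t (\<eta> t)"
      unfolding Pz_def dy by (simp flip: integral_neg)
    finally show ?thesis by simp
  qed
  hence "(\<lambda>h. (\<lambda>(dt, dz). W * dt + Pz t (\<eta> t) * dz) (h, a t (\<eta> t) * h))
      = (*) (W - a t (\<eta> t) * (LINT y|lborel. f t y * deriv (\<phi> (\<eta> t)) y))"
    by (simp add: fun_eq_iff algebra_simps)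
  ultimately have "((\<lambda>\<tau>. (\<lambda>(\<tau>, z). P \<tau> z) (\<tau>, \<eta> \<tau>)) has_derivative
      (*) (W - a t (\<eta> t) * (LINT y|lborel. f t y * deriv (\<phi> (\<eta> t)) y))) (at t within {0..T})"
    by simp
  thus ?thesis by (simp add: has_field_derivative_def P_def W_def)
qed

section \<open>Size and mass of the bump function\<close>

lemma bump_bounded: obtains B where "B \<ge> 0" "\<And>x. bump x \<le> B" "\<And>x. \<bar>deriv bump x\<bar> \<le> B"
proof -
  have "bounded (bump ` {-1..1})" "bounded (deriv bump ` {-1..1})"
    by (intro compact_imp_bounded compact_continuous_image bump_continuous compact_Icc)+
  then obtain B1 B2 where B: "\<forall>x\<in>{-1..1}. \<bar>bump x\<bar> \<le> B1" "\<forall>x\<in>{-1..1}. \<bar>deriv bump x\<bar> \<le> B2"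
    unfolding bounded_iff real_norm_def by blast
  show ?thesis
  proof (rule that[of "max 0 (max B1 B2)"])
    show "bump x \<le> max 0 (max B1 B2)" for x
    proof (cases "\<bar>x\<bar> \<le> 1")
      case True
      hence "x \<in> {-1..1}" by auto
      hence "\<bar>bump x\<bar> \<le> B1" using B(1) by blast
      thus ?thesis by linarith
    qed (simp add: bump_eq_0)
    show "\<bar>deriv bump x\<bar> \<le> max 0 (max B1 B2)" for x
    proof (cases "\<bar>x\<bar> \<le> 1")
      case True
      hence "x \<in> {-1..1}" by auto
      hence "\<bar>deriv bump x\<bar> \<le> B2" using B(2) by blast
      thus ?thesis by linarith
    qed (simp add: deriv_bump_eq_0)
  qed simp
qed

lemma bump_integrable: "integrable lborel bump"
  by (rule compact_support_integrable[of "-1" 1]) (auto intro: bump_continuous bump_eq_0)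

lemma bump_integral_pos: "(LINT x|lborel. bump x) > 0"
proof -
  have "(LINT x|lborel. bump x) \<noteq> 0"
  proof
    assume "(LINT x|lborel. bump x) = 0"
    hence "AE x in lborel. bump x = 0"
      using integral_nonneg_eq_0_iff_AE[OF bump_integrable] bump_nonneg by simp
    hence "AE x::real in lborel. x \<notin> {-1<..<1}"
    proof eventually_elim
      case (elim x)
      show ?case
      proof
        assume "x \<in> {-1<..<1}"
        hence "\<bar>x\<bar> < 1" by (simp add: abs_less_iff)
        from bump_pos[OF this] elim show False by simp
      qed
    qed
    hence "emeasure lborel {-1<..<(1::real)} = 0"
      by (subst AE_iff_measurable[symmetric, of "{-1<..<1::real}" lborel "\<lambda>x. x \<notin> {-1<..<1}"]) auto
    thus False by simp
  qed
  moreover have "(LINT x|lborel. bump x) \<ge> 0" by (simp add: bump_nonneg)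
  ultimately show ?thesis by linarith
qed

lemma bump_rescaled_integral:
  assumes "\<epsilon> > 0"
  shows "(LINT y|lborel. bump ((y - z) / \<epsilon>)) = \<epsilon> * (LINT y|lborel. bump y)"
proof -
  have "(LINT y|lborel. bump y) = \<bar>1 / \<epsilon>\<bar> *\<^sub>R (LINT y|lborel. bump (- z / \<epsilon> + (1 / \<epsilon>) * y))"
    using assms by (intro lborel_integral_real_affine) auto
  also have "(\<lambda>y. bump (- z / \<epsilon> + (1 / \<epsilon>) * y)) = (\<lambda>y. bump ((y - z) / \<epsilon>))"
    by (simp add: diff_divide_distrib)
  finally show ?thesis using assms by simp
qed

lemma real_le_add_small_mult:
  fixes x y C :: real
  assumes "\<And>\<delta>. \<delta> > 0 \<Longrightarrow> x \<le> y + \<delta> * C" "C > 0"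
  shows "x \<le> y"
proof (rule field_le_epsilon)
  fix e :: real assume "e > 0"
  thus "x \<le> y + e" using assms(1)[of "e / C"] assms(2) by simp
qed

text \<open>Mollifying with a bump that moves along the curve leaves only the commutator with the
  transport term; as \<open>f\<close> is merely continuous, the bump derivative is paired with \<open>f y - f z\<close>,
  which is possible because the commutator kernel is itself a derivative and integrates to zero.\<close>

lemma weak_transport_along_characteristic:
  fixes f a a' g :: "real \<Rightarrow> real \<Rightarrow> real" and \<eta> :: "real \<Rightarrow> real"
  assumes wt: "weak_transport T a f g"
    and f: "continuous_on ({0..T} \<times> UNIV) (\<lambda>(t, x). f t x)"
    and g: "continuous_on ({0..T} \<times> UNIV) (\<lambda>(t, x). g t x)"
    and a': "\<And>t x. t \<in> {0..T} \<Longrightarrow> (a t has_real_derivative a' t x) (at x)"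
    and a'c: "\<And>t. t \<in> {0..T} \<Longrightarrow> continuous_on UNIV (a' t)"
    and L: "\<And>t x. t \<in> {0..T} \<Longrightarrow> \<bar>a' t x\<bar> \<le> L"
    and \<eta>: "\<And>\<tau>. \<tau> \<in> {0..T} \<Longrightarrow> (\<eta> has_real_derivative a \<tau> (\<eta> \<tau>)) (at \<tau> within {0..T})"
    and t: "t \<in> {0..T}"
    and k: "\<And>\<tau>. \<tau> \<in> {0..t} \<Longrightarrow> \<bar>g \<tau> (\<eta> \<tau>)\<bar> \<le> k"
  shows "\<bar>f t (\<eta> t) - f 0 (\<eta> 0)\<bar> \<le> t * k"
proof -
  define I where "I = (LINT x|lborel. bump x)"
  have I: "I > 0" unfolding I_def by (rule bump_integral_pos)
  obtain B where B: "B \<ge> 0" "\<And>x. bump x \<le> B" "\<And>x. \<bar>deriv bump x\<bar> \<le> B" using bump_bounded by blast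
  have t0: "0 \<in> {0..T}" "0 \<le> t" using t by auto
  have L0: "L \<ge> 0" using L[OF t0(1), of 0] by linarith
  have k0: "k \<ge> 0" using k[of 0] t0 by force
  have \<eta>c: "continuous_on {0..T} \<eta>" using \<eta> by (rule DERIV_continuous_on)
  have lip: "\<bar>a \<tau> y - a \<tau> z\<bar> \<le> L * \<bar>y - z\<bar>" if "\<tau> \<in> {0..T}" for \<tau> y z
    using field_differentiable_bound[of UNIV "a \<tau>" "a' \<tau>" L y z] a'[OF that] L[OF that] by simp
  show ?thesis
  proof (rule real_le_add_small_mult)
    \<comment> \<open>The coefficient of \<delta> collects the errors: 2 for averaging at the two
      end times, t for the oscillation of g, and the last term for the commutator, relative to the
      mass of the bump.\<close>
    show "2 + t + t * (4 * L * B / I) > 0" using t0 L0 B I by (auto intro!: add_pos_nonneg)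
    fix \<delta> :: real assume \<delta>: "\<delta> > 0"
    obtain e1 where e1: "e1 > 0" "\<And>t y. t \<in> {0..T} \<Longrightarrow> \<bar>y - \<eta> t\<bar> \<le> e1 \<Longrightarrow> \<bar>f t y - f t (\<eta> t)\<bar> \<le> \<delta>"
      using uniform_near_curve[OF f \<eta>c \<delta>] by blast
    obtain e2 where e2: "e2 > 0" "\<And>t y. t \<in> {0..T} \<Longrightarrow> \<bar>y - \<eta> t\<bar> \<le> e2 \<Longrightarrow> \<bar>g t y - g t (\<eta> t)\<bar> \<le> \<delta>"
      using uniform_near_curve[OF g \<eta>c \<delta>] by blast
    define \<epsilon> where "\<epsilon> = min 1 (min e1 e2)"
    have \<epsilon>: "0 < \<epsilon>" "\<epsilon> \<le> 1" "\<epsilon> \<le> e1" "\<epsilon> \<le> e2" using e1 e2 by (auto simp: \<epsilon>_def)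
    define \<phi> where "\<phi> = (\<lambda>z y. bump ((y - z) / \<epsilon>))"
    define \<phi>' where "\<phi>' = (\<lambda>z y. deriv bump ((y - z) / \<epsilon>) / \<epsilon>)"
    have \<phi>D: "(\<phi> z has_real_derivative \<phi>' z y) (at y)" for z y
    proof -
      have "((\<lambda>y. (y - z) / \<epsilon>) has_real_derivative 1 / \<epsilon>) (at y)"
        using \<epsilon>(1) by (auto intro!: derivative_eq_intros)
      from DERIV_chain2[OF bump_DERIV this] show ?thesis
        unfolding \<phi>_def \<phi>'_def by simp
    qed
    have \<phi>c: "continuous_on A (\<phi> z)" for A z
      unfolding \<phi>_def by (rule continuous_on_compose2[OF bump_continuous(1)[of UNIV]]) (use \<epsilon>(1) in \<open>auto intro!: continuous_intros\<close>)
    have \<phi>'c: "continuous_on A (\<phi>' z)" for A z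
    proof -
      have "continuous_on A (\<lambda>y. deriv bump ((y - z) / \<epsilon>))"
        by (rule continuous_on_compose2[OF bump_continuous(2)[of UNIV]]) (use \<epsilon>(1) in \<open>auto intro!: continuous_intros\<close>)
      thus ?thesis unfolding \<phi>'_def using \<epsilon>(1) by (auto intro!: continuous_intros)
    qed
    have out: "\<phi> z y = 0" "\<phi>' z y = 0" if "\<bar>y - z\<bar> > \<epsilon>" for z y
    proof -
      have "\<bar>(y - z) / \<epsilon>\<bar> > 1" using that \<epsilon>(1) by (simp add: less_divide_eq)
      thus "\<phi> z y = 0" "\<phi>' z y = 0" by (auto simp: \<phi>_def \<phi>'_def bump_eq_0 deriv_bump_eq_0)
    qed
    have \<phi>0: "\<phi> z y \<ge> 0" "\<phi> z y \<le> B" for z y using bump_nonneg B by (auto simp: \<phi>_def)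
    have \<phi>'B: "\<bar>\<phi>' z y\<bar> \<le> B / \<epsilon>" for z y using B(3) \<epsilon>(1) by (auto simp: \<phi>'_def intro: divide_right_mono)
    have int: "integrable lborel F" if "continuous_on UNIV F" "\<And>y. \<bar>y - z\<bar> > \<epsilon> \<Longrightarrow> F y = 0" for F :: "real \<Rightarrow> real" and z
    proof (rule compact_support_integrable[of "z - \<epsilon>" "z + \<epsilon>"])
      show "continuous_on {z - \<epsilon>..z + \<epsilon>} F" using that(1) by (rule continuous_on_subset) simp
      show "F y = 0" if "y \<notin> {z - \<epsilon>..z + \<epsilon>}" for y using that \<open>\<And>y. \<bar>y - z\<bar> > \<epsilon> \<Longrightarrow> F y = 0\<close>[of y] by auto
    qed
    have \<phi>i: "integrable lborel (\<phi> z)" for z by (rule int[of _ z]) (use \<phi>c out in auto)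
    have \<phi>I: "(LINT y|lborel. \<phi> z y) = \<epsilon> * I" for z
      unfolding \<phi>_def I_def by (rule bump_rescaled_integral[OF \<epsilon>(1)])
    define \<Phi> where "\<Phi> \<tau> = (LINT y|lborel. f \<tau> y * \<phi> (\<eta> \<tau>) y)" for \<tau>
    define V where "V \<tau> = (LINT y|lborel. f \<tau> y * deriv (\<lambda>y. a \<tau> y * \<phi> (\<eta> \<tau>) y) y + g \<tau> y * \<phi> (\<eta> \<tau>) y)
     - a \<tau> (\<eta> \<tau>) * (LINT y|lborel. f \<tau> y * deriv (\<phi> (\<eta> \<tau>)) y)" for \<tau>
    have \<Phi>D: "(\<Phi> has_real_derivative V \<tau>) (at \<tau> within {0..T})" if "\<tau> \<in> {0..T}" for \<tau>
      using moving_mollifier_derivative[OF wt f \<eta> \<epsilon>(1,2) that] unfolding \<Phi>_def [abs_def] V_def \<phi>_def .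
    have Vb: "\<bar>V \<tau>\<bar> \<le> \<epsilon> * (\<delta> * (4 * L * B) + (k + \<delta>) * I)" if \<tau>: "\<tau> \<in> {0..t}" for \<tau>
    proof -
      have \<tau>T: "\<tau> \<in> {0..T}" using \<tau> t by auto
      define z where "z = \<eta> \<tau>"
      note ctn = continuous_on_slice[OF f \<tau>T, of UNIV] continuous_on_slice[OF g \<tau>T, of UNIV] a'c[OF \<tau>T]
        \<phi>c[of UNIV z] \<phi>'c[of UNIV z]
      have ac: "continuous_on UNIV (a \<tau>)" using a'[OF \<tau>T] by (metis DERIV_continuous_on DERIV_subset subset_UNIV)
      \<comment> \<open>The motion of the centre subtracts the velocity at z, so only the difference
        \<open>a \<tau> y - a \<tau> z\<close> acts on the bump. \<open>D\<close> is the derivative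
        of this difference times the bump.\<close>
      define D where "D y = a' \<tau> y * \<phi> z y + (a \<tau> y - a \<tau> z) * \<phi>' z y" for y
      have Dc: "continuous_on UNIV D" unfolding D_def by (intro continuous_intros ctn ac)
      have Dout: "D y = 0" if "\<bar>y - z\<bar> > \<epsilon>" for y using out[OF that] by (simp add: D_def)
      have Di: "(LINT y|lborel. D y) = 0"
      proof (rule compact_support_integral_deriv[OF _ Dc])
        show "((\<lambda>y. (a \<tau> y - a \<tau> z) * \<phi> z y) has_real_derivative D y) (at y)" for y
          unfolding D_def using a'[OF \<tau>T, of y] \<phi>D[of z y]
          by (auto intro!: derivative_eq_intros)
        show "(a \<tau> x - a \<tau> z) * \<phi> z x = 0" if "\<bar>x\<bar> > \<bar>z\<bar> + \<epsilon>" for x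
          using out(1)[of x z] that by simp
      qed
      have der1: "deriv (\<lambda>y. a \<tau> y * \<phi> z y) y = a' \<tau> y * \<phi> z y + a \<tau> y * \<phi>' z y" for y
        by (rule DERIV_imp_deriv) (use a'[OF \<tau>T, of y] \<phi>D[of z y] in \<open>auto intro!: derivative_eq_intros\<close>)
      have der2: "deriv (\<phi> z) y = \<phi>' z y" for y by (rule DERIV_imp_deriv[OF \<phi>D])
      have i1: "integrable lborel (\<lambda>y. f \<tau> y * (a' \<tau> y * \<phi> z y + a \<tau> y * \<phi>' z y) + g \<tau> y * \<phi> z y)"
        by (rule int[of _ z]) (auto intro!: continuous_intros ctn ac simp: out)
      have i2: "integrable lborel (\<lambda>y. f \<tau> y * \<phi>' z y)"
        by (rule int[of _ z]) (auto intro!: continuous_intros ctn ac simp: out)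
      have i3: "integrable lborel D"
        by (rule int[of _ z]) (auto intro!: Dc Dout)
      have "V \<tau> = (LINT y|lborel. f \<tau> y * (a' \<tau> y * \<phi> z y + a \<tau> y * \<phi>' z y) + g \<tau> y * \<phi> z y)
          - a \<tau> z * (LINT y|lborel. f \<tau> y * \<phi>' z y) - f \<tau> z * (LINT y|lborel. D y)"
        unfolding Di by (simp add: V_def z_def [symmetric] der1 der2)
      also have "\<dots> = (LINT y|lborel. f \<tau> y * (a' \<tau> y * \<phi> z y + a \<tau> y * \<phi>' z y) + g \<tau> y * \<phi> z y
          - a \<tau> z * (f \<tau> y * \<phi>' z y) - f \<tau> z * D y)"
        using i1 i2 i3 by simp
      also have "\<dots> = (LINT y|lborel. (f \<tau> y - f \<tau> z) * D y + g \<tau> y * \<phi> z y)"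
        by (intro Bochner_Integration.integral_cong refl) (simp add: D_def algebra_simps)
      finally have V: "V \<tau> = (LINT y|lborel. (f \<tau> y - f \<tau> z) * D y + g \<tau> y * \<phi> z y)" .
      define G where "G y = \<delta> * (2 * L * B) * indicator {z - \<epsilon>..z + \<epsilon>} y + (k + \<delta>) * \<phi> z y" for y
      have ind: "integrable lborel (indicator {z - \<epsilon>..z + \<epsilon>} :: real \<Rightarrow> real)"
        by (rule integrable_real_indicator) (auto simp: emeasure_lborel_Icc_eq)
      have "\<bar>V \<tau>\<bar> \<le> (LINT y|lborel. G y)"
        unfolding V
      proof (rule abs_integral_le_integral)
        show "integrable lborel (\<lambda>y. (f \<tau> y - f \<tau> z) * D y + g \<tau> y * \<phi> z y)"
          by (rule int[of _ z]) (auto intro!: continuous_intros ctn ac Dc simp: out Dout)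
        show "integrable lborel G" unfolding G_def using ind \<phi>i[of z] by simp
        fix y
        show "\<bar>(f \<tau> y - f \<tau> z) * D y + g \<tau> y * \<phi> z y\<bar> \<le> G y"
        proof (cases "\<bar>y - z\<bar> \<le> \<epsilon>")
          case False
          hence "D y = 0" "\<phi> z y = 0" using Dout out by auto
          thus ?thesis using False by (auto simp: G_def indicator_def)
        next
          case True
          have "\<bar>D y\<bar> \<le> \<bar>a' \<tau> y\<bar> * \<bar>\<phi> z y\<bar> + \<bar>a \<tau> y - a \<tau> z\<bar> * \<bar>\<phi>' z y\<bar>"
            unfolding D_def by (metis abs_mult abs_triangle_ineq)
          \<comment> \<open>The decisive cancellation: within distance \<epsilon> of the centre the
            velocity varies by at most L * \<epsilon>, which compensates the factor 1 / \<epsilon>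
            in the derivative of the bump. The bound is thus independent of \<epsilon>.\<close>
          also have "\<dots> \<le> L * B + (L * \<epsilon>) * (B / \<epsilon>)"
          proof (intro add_mono mult_mono)
            show "\<bar>a \<tau> y - a \<tau> z\<bar> \<le> L * \<epsilon>"
              using lip[OF \<tau>T, of y z] mult_left_mono[OF True L0] by linarith
          qed (use L[OF \<tau>T] \<phi>0[of z y] \<phi>'B L0 \<epsilon>(1) in auto)
          also have "\<dots> = 2 * L * B" using \<epsilon>(1) by simp
          finally have Db: "\<bar>D y\<bar> \<le> 2 * L * B" .
          have fb: "\<bar>f \<tau> y - f \<tau> z\<bar> \<le> \<delta>" using e1(2)[OF \<tau>T] True \<epsilon> by (simp add: z_def)
          have "\<bar>g \<tau> y - g \<tau> z\<bar> \<le> \<delta>" using e2(2)[OF \<tau>T] True \<epsilon> by (simp add: z_def)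
          moreover have "\<bar>g \<tau> z\<bar> \<le> k" using k[OF \<tau>] by (simp add: z_def)
          ultimately have gb: "\<bar>g \<tau> y\<bar> \<le> k + \<delta>" by linarith
          have "\<bar>(f \<tau> y - f \<tau> z) * D y + g \<tau> y * \<phi> z y\<bar> \<le> \<bar>f \<tau> y - f \<tau> z\<bar> * \<bar>D y\<bar> + \<bar>g \<tau> y\<bar> * \<bar>\<phi> z y\<bar>"
            by (metis abs_mult abs_triangle_ineq)
          also have "\<dots> \<le> \<delta> * (2 * L * B) + (k + \<delta>) * \<phi> z y"
            using fb Db gb \<phi>0[of z y] \<delta> by (intro add_mono mult_mono) auto
          also have "\<dots> = G y" using True by (auto simp: G_def indicator_def)
          finally show ?thesis .
        qed
      qed
      also have "\<dots> = \<delta> * (2 * L * B) * (2 * \<epsilon>) + (k + \<delta>) * (\<epsilon> * I)"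
        unfolding G_def using ind \<phi>i[of z] \<phi>I[of z] \<epsilon>(1) by simp
      also have "\<dots> = \<epsilon> * (\<delta> * (4 * L * B) + (k + \<delta>) * I)" by (simp add: algebra_simps)
      finally show ?thesis .
    qed
    have \<Phi>b: "\<bar>\<Phi> \<tau> - f \<tau> (\<eta> \<tau>) * (\<epsilon> * I)\<bar> \<le> \<delta> * (\<epsilon> * I)" if \<tau>: "\<tau> \<in> {0..T}" for \<tau>
    proof -
      define z where "z = \<eta> \<tau>"
      have i: "integrable lborel (\<lambda>y. f \<tau> y * \<phi> z y)"
        by (rule int[of _ z]) (auto intro!: continuous_intros continuous_on_slice[OF f \<tau>] \<phi>c simp: out)
      have "\<Phi> \<tau> - f \<tau> z * (\<epsilon> * I) = (LINT y|lborel. f \<tau> y * \<phi> z y - f \<tau> z * \<phi> z y)"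
        using i \<phi>i[of z] by (simp add: \<Phi>_def z_def [symmetric] \<phi>I)
      also have "\<bar>\<dots>\<bar> \<le> (LINT y|lborel. \<delta> * \<phi> z y)"
      proof (rule abs_integral_le_integral)
        show "integrable lborel (\<lambda>y. f \<tau> y * \<phi> z y - f \<tau> z * \<phi> z y)" "integrable lborel (\<lambda>y. \<delta> * \<phi> z y)"
          using i \<phi>i[of z] by auto
        fix y
        show "\<bar>f \<tau> y * \<phi> z y - f \<tau> z * \<phi> z y\<bar> \<le> \<delta> * \<phi> z y"
        proof (cases "\<bar>y - z\<bar> \<le> \<epsilon>")
          case True
          hence "\<bar>f \<tau> y - f \<tau> z\<bar> \<le> \<delta>" using e1(2)[OF \<tau>] \<epsilon> by (simp add: z_def)
          hence "\<bar>f \<tau> y - f \<tau> z\<bar> * \<phi> z y \<le> \<delta> * \<phi> z y" using \<phi>0 by (intro mult_right_mono)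
          thus ?thesis using \<phi>0[of z y] by (simp add: abs_mult flip: left_diff_distrib)
        qed (use out in auto)
      qed
      also have "\<dots> = \<delta> * (\<epsilon> * I)" by (simp add: \<phi>I)
      finally show ?thesis by (simp add: z_def)
    qed
    \<comment> \<open>Every term carries a factor \<epsilon>, the width of the bump. Dividing by its
      mass \<epsilon> * I removes \<epsilon> altogether and leaves an error proportional to
      \<delta>.\<close>
    have "\<bar>\<Phi> t - \<Phi> 0\<bar> \<le> \<epsilon> * (\<delta> * (4 * L * B) + (k + \<delta>) * I) * \<bar>t - 0\<bar>"
    proof -
      have "norm (\<Phi> t - \<Phi> 0) \<le> \<epsilon> * (\<delta> * (4 * L * B) + (k + \<delta>) * I) * norm (t - 0)"
      proof (rule field_differentiable_bound[of "{0..t}"])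
        show "(\<Phi> has_real_derivative V \<tau>) (at \<tau> within {0..t})" if "\<tau> \<in> {0..t}" for \<tau>
          by (rule DERIV_subset[OF \<Phi>D]) (use that t in auto)
      qed (use Vb t0 in auto)
      thus ?thesis by simp
    qed
    moreover have "\<bar>\<Phi> t - f t (\<eta> t) * (\<epsilon> * I)\<bar> \<le> \<delta> * (\<epsilon> * I)" "\<bar>\<Phi> 0 - f 0 (\<eta> 0) * (\<epsilon> * I)\<bar> \<le> \<delta> * (\<epsilon> * I)"
      using \<Phi>b t t0 by auto
    ultimately have "\<bar>f t (\<eta> t) * (\<epsilon> * I) - f 0 (\<eta> 0) * (\<epsilon> * I)\<bar> \<le> 2 * (\<delta> * (\<epsilon> * I)) + \<epsilon> * (\<delta> * (4 * L * B) + (k + \<delta>) * I) * t"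
      using t0 by (simp add: abs_if split: if_splits)
    also have "\<dots> = (t * k + \<delta> * (2 + t + t * (4 * L * B / I))) * (\<epsilon> * I)"
      using I by (simp add: field_simps)
    also have "\<bar>f t (\<eta> t) * (\<epsilon> * I) - f 0 (\<eta> 0) * (\<epsilon> * I)\<bar> = \<bar>f t (\<eta> t) - f 0 (\<eta> 0)\<bar> * (\<epsilon> * I)"
      using \<epsilon>(1) I by (simp add: abs_mult flip: left_diff_distrib)
    finally show "\<bar>f t (\<eta> t) - f 0 (\<eta> 0)\<bar> \<le> t * k + \<delta> * (2 + t + t * (4 * L * B / I))"
      using \<epsilon>(1) I by (subst (asm) mult_le_cancel_right_pos) auto
  qed
qed

section \<open>Solutions as classical functions\<close>

text \<open>Applied to increments in time, the embedding shows that all derivatives up to order k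
  converge uniformly in x as \<tau> tends to t. Together with continuity in x this gives joint
  continuity, and near time 0 the derivatives stay within 1 of their initial values.\<close>

lemma sobolev_curve_classical:
  assumes s: "s > real k + 1 / 2" and f: "sobolev_curve s T f" and T: "0 < T"
  obtains \<delta> B where "\<delta> > 0" "B \<ge> 0"
    "\<And>j. j \<le> k \<Longrightarrow> continuous_on (time_interval T \<times> UNIV) (\<lambda>(t, x). (deriv ^^ j) (f t) x)"
    "\<And>j t x. j \<le> k \<Longrightarrow> t \<in> time_interval T \<Longrightarrow> t \<le> \<delta> \<Longrightarrow> \<bar>(deriv ^^ j) (f t) x\<bar> \<le> B"
    "\<And>j t x. j < k \<Longrightarrow> t \<in> time_interval T \<Longrightarrow> ((deriv ^^ j) (f t) has_real_derivative (deriv ^^ Suc j) (f t) x) (at x)"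
proof -
  obtain c where c1: "\<And>f j. f \<in> sobolev_cont s \<Longrightarrow> j \<le> k \<Longrightarrow> continuous_on UNIV ((deriv ^^ j) f)"
    and c2: "\<And>f j x. f \<in> sobolev_cont s \<Longrightarrow> j \<le> k \<Longrightarrow> \<bar>(deriv ^^ j) f x\<bar> \<le> c * sobolev_norm s f"
    and c3: "\<And>f j x. f \<in> sobolev_cont s \<Longrightarrow> j < k \<Longrightarrow> ((deriv ^^ j) f has_real_derivative (deriv ^^ Suc j) f x) (at x)"
    using sobolev_embedding[OF s] by blast
  let ?A = "time_interval T"
  have fs: "f t \<in> sobolev_cont s" if "t \<in> ?A" for t
    using f that by (simp add: sobolev_curve_def)
  have diff: "(deriv ^^ j) (\<lambda>x. f \<tau> x - f t x) = (\<lambda>x. (deriv ^^ j) (f \<tau>) x - (deriv ^^ j) (f t) x)"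
    if "\<tau> \<in> ?A" "t \<in> ?A" "j \<le> k" for \<tau> t j
    using that(3)
  proof (induction j)
    case (Suc j)
    hence "(deriv ^^ Suc j) (\<lambda>x. f \<tau> x - f t x) = deriv (\<lambda>x. (deriv ^^ j) (f \<tau>) x - (deriv ^^ j) (f t) x)" by simp
    also have "\<dots> = (\<lambda>x. (deriv ^^ Suc j) (f \<tau>) x - (deriv ^^ Suc j) (f t) x)"
      using Suc.prems by (intro ext DERIV_imp_deriv DERIV_diff c3 fs that) auto
    finally show ?case .
  qed simp
  have unif: "\<exists>d>0. \<forall>\<tau>\<in>?A. \<bar>\<tau> - t\<bar> < d \<longrightarrow> (\<forall>j\<le>k. \<forall>y. \<bar>(deriv ^^ j) (f \<tau>) y - (deriv ^^ j) (f t) y\<bar> \<le> e)"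
    if t: "t \<in> ?A" and e: "e > 0" for t e
  proof -
    have "((\<lambda>\<tau>. c * sobolev_norm s (\<lambda>x. f \<tau> x - f t x)) \<longlongrightarrow> c * 0) (at t within ?A)"
      using f t unfolding sobolev_curve_def by (intro tendsto_mult tendsto_const) auto
    hence "\<forall>\<^sub>F \<tau> in at t within ?A. c * sobolev_norm s (\<lambda>x. f \<tau> x - f t x) < e"
      using e by (auto dest: order_tendstoD(2))
    then obtain d where d: "d > 0" "\<And>\<tau>. \<tau> \<in> ?A \<Longrightarrow> \<tau> \<noteq> t \<Longrightarrow> dist \<tau> t < d \<Longrightarrow> c * sobolev_norm s (\<lambda>x. f \<tau> x - f t x) < e"
      unfolding eventually_at by blast
    show ?thesis
    proof (intro exI[of _ d] conjI ballI impI allI d(1))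
      fix \<tau> j y assume \<tau>: "\<tau> \<in> ?A" "\<bar>\<tau> - t\<bar> < d" and j: "j \<le> k"
      show "\<bar>(deriv ^^ j) (f \<tau>) y - (deriv ^^ j) (f t) y\<bar> \<le> e"
      proof (cases "\<tau> = t")
        case False
        have "\<bar>(deriv ^^ j) (f \<tau>) y - (deriv ^^ j) (f t) y\<bar> = \<bar>(deriv ^^ j) (\<lambda>x. f \<tau> x - f t x) y\<bar>"
          by (simp add: diff[OF \<tau>(1) t j])
        also have "\<dots> \<le> c * sobolev_norm s (\<lambda>x. f \<tau> x - f t x)"
          by (intro c2 sobolev_cont_diff fs \<tau> t j)
        also have "\<dots> \<le> e" using d(2)[OF \<tau>(1) False] \<tau>(2) by (simp add: dist_real_def)
        finally show ?thesis .
      qed (use e in simp)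
    qed
  qed
  have cont: "continuous_on (?A \<times> UNIV) (\<lambda>(t, x). (deriv ^^ j) (f t) x)" if j: "j \<le> k" for j
    unfolding continuous_on_iff
  proof (intro ballI allI impI)
    fix p :: "real \<times> real" and e :: real assume p: "p \<in> ?A \<times> UNIV" and e: "e > 0"
    obtain t x where [simp]: "p = (t, x)" by (cases p)
    have t: "t \<in> ?A" using p by simp
    obtain d where d: "d > 0" "\<forall>\<tau>\<in>?A. \<bar>\<tau> - t\<bar> < d \<longrightarrow> (\<forall>j\<le>k. \<forall>y. \<bar>(deriv ^^ j) (f \<tau>) y - (deriv ^^ j) (f t) y\<bar> \<le> e / 3)"
      using unif[OF t, of "e / 3"] e by auto
    have "isCont ((deriv ^^ j) (f t)) x" using c1[OF fs[OF t] j] by (simp add: continuous_on_eq_continuous_at)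
    then obtain d' where d': "d' > 0" "\<And>y. dist y x < d' \<Longrightarrow> dist ((deriv ^^ j) (f t) y) ((deriv ^^ j) (f t) x) < e / 3"
      unfolding continuous_at_eps_delta by (metis e divide_pos_pos zero_less_numeral)
    show "\<exists>d>0. \<forall>q\<in>?A \<times> UNIV. dist q p < d \<longrightarrow> dist (case q of (t, x) \<Rightarrow> (deriv ^^ j) (f t) x) (case p of (t, x) \<Rightarrow> (deriv ^^ j) (f t) x) < e"
    proof (intro exI[of _ "min d d'"] conjI ballI impI)
      fix q :: "real \<times> real" assume q: "q \<in> ?A \<times> UNIV" and dq: "dist q p < min d d'"
      obtain \<tau> y where [simp]: "q = (\<tau>, y)" by (cases q)
      have "dist \<tau> t < d" "dist y x < d'"
        using dist_fst_le[of q p] dist_snd_le[of q p] dq by auto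
      hence "\<bar>(deriv ^^ j) (f \<tau>) y - (deriv ^^ j) (f t) y\<bar> \<le> e / 3" "\<bar>(deriv ^^ j) (f t) y - (deriv ^^ j) (f t) x\<bar> < e / 3"
        using d(2) d'(2)[of y] q j by (auto simp: dist_real_def)
      hence "\<bar>(deriv ^^ j) (f \<tau>) y - (deriv ^^ j) (f t) x\<bar> < e"
        using e by linarith
      thus "dist (case q of (t, x) \<Rightarrow> (deriv ^^ j) (f t) x) (case p of (t, x) \<Rightarrow> (deriv ^^ j) (f t) x) < e"
        by (simp add: dist_real_def)
    qed (use d d' in auto)
  qed
  have 0: "0 \<in> ?A" using T by (simp add: time_interval_def zero_ereal_def)
  obtain d where d: "d > 0" "\<forall>\<tau>\<in>?A. \<bar>\<tau> - 0\<bar> < d \<longrightarrow> (\<forall>j\<le>k. \<forall>y. \<bar>(deriv ^^ j) (f \<tau>) y - (deriv ^^ j) (f 0) y\<bar> \<le> 1)"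
    using unif[OF 0, of 1] by auto
  \<comment> \<open>The embedding bounds the derivatives at time 0, and the added 1 is their allowed
    variation up to time d / 2.\<close>
  define B where "B = \<bar>c * sobolev_norm s (f 0)\<bar> + 1"
  have bound: "\<bar>(deriv ^^ j) (f t) x\<bar> \<le> B" if j: "j \<le> k" and t: "t \<in> ?A" "t \<le> d / 2" for j t x
  proof -
    have "\<bar>t - 0\<bar> < d" using t d(1) by (simp add: time_interval_def)
    hence "\<bar>(deriv ^^ j) (f t) x - (deriv ^^ j) (f 0) x\<bar> \<le> 1" using d(2) t j by blast
    moreover have "\<bar>(deriv ^^ j) (f 0) x\<bar> \<le> c * sobolev_norm s (f 0)" by (rule c2[OF fs[OF 0] j])
    ultimately show ?thesis unfolding B_def by linarith
  qed
  show ?thesis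
    by (rule that[of "d / 2" B]) (use d(1) cont bound c3 fs in \<open>auto simp: B_def\<close>)
qed

section \<open>The logarithmic weight and the elliptic operator\<close>

lemma log_weight_base:
  assumes "\<beta> > (0::real)"
  shows "ln (exp 1 + \<beta> + \<bar>x\<bar>) \<ge> 1"
  using assms exp_gt_zero[of "1::real"] by (subst ln_ge_iff) linarith+

lemma log_weight_pos: "\<beta> > 0 \<Longrightarrow> log_weight \<beta> x > 0"
  using log_weight_base[of \<beta> x] by (simp add: log_weight_def)

lemma log_weight_continuous:
  assumes "\<beta> > 0"
  shows "continuous_on UNIV (log_weight \<beta>)"
proof -
  have "exp 1 + \<beta> + \<bar>x\<bar> \<noteq> 0" for x :: real
    using assms by (metis abs_ge_zero add_pos_nonneg add_pos_pos exp_gt_zero less_irrefl)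
  moreover have "ln (exp 1 + \<beta> + \<bar>x\<bar>) \<noteq> 0" for x using log_weight_base[OF assms, of x] by auto
  ultimately show ?thesis
    unfolding log_weight_def by (intro continuous_intros) auto
qed

text \<open>The logarithmic derivative of the weight is at most \<open>\<beta> / ((e + \<beta>) ln (e + \<beta>)) \<le> 1/2\<close>, uniformly
  in \<open>\<beta>\<close>, because \<open>ln z \<ge> 2 - e / z\<close>.\<close>

lemma log_weight_ratio:
  assumes \<beta>: "\<beta> > 0"
  shows "log_weight \<beta> x \<le> exp (\<bar>x - y\<bar> / 2) * log_weight \<beta> y"
proof -
  define z where "z = exp 1 + \<beta>"
  have z: "z > 0" "z > \<beta>" using \<beta> by (auto simp: z_def intro: add_pos_pos)
  define X where "X = ln (z + \<bar>x\<bar>)"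
  define Y where "Y = ln (z + \<bar>y\<bar>)"
  have XY: "X \<ge> 1" "Y \<ge> 1" using log_weight_base[OF \<beta>] by (auto simp: X_def Y_def z_def)
  have "\<beta> * (ln X - ln Y) \<le> \<bar>x - y\<bar> / 2"
  proof (cases "\<bar>x\<bar> \<le> \<bar>y\<bar>")
    case True
    hence "X \<le> Y" unfolding X_def Y_def using z by (subst ln_le_cancel_iff) auto
    hence "ln X \<le> ln Y" using XY by (subst ln_le_cancel_iff) auto
    hence "\<beta> * (ln X - ln Y) \<le> 0" using \<beta> by (simp add: mult_nonneg_nonpos)
    thus ?thesis by (rule order_trans) simp
  next
    case False
    define d where "d = \<bar>x\<bar> - \<bar>y\<bar>"
    have d: "d > 0" "d \<le> \<bar>x - y\<bar>" using False by (auto simp: d_def)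
    have "X - Y = ln ((z + \<bar>x\<bar>) / (z + \<bar>y\<bar>))"
      unfolding X_def Y_def using z by (subst ln_divide_pos) auto
    also have "\<dots> \<le> (z + \<bar>x\<bar>) / (z + \<bar>y\<bar>) - 1" using z by (intro ln_le_minus_one divide_pos_pos) auto
    also have "\<dots> = d / (z + \<bar>y\<bar>)" using z by (simp add: d_def field_simps)
    also have "\<dots> \<le> d / z" using z d by (intro divide_left_mono) auto
    finally have 1: "X - Y \<le> d / z" .
    have "ln z \<le> Y" unfolding Y_def using z by (subst ln_le_cancel_iff) auto
    moreover have zl: "2 - exp 1 / z \<le> ln z"
    proof -
      have "ln (exp 1 / z) \<le> exp 1 / z - 1" using z by (intro ln_le_minus_one) auto
      thus ?thesis using z by (simp add: ln_divide_pos)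
    qed
    moreover have "2 * \<beta> / z = 2 - 2 * exp 1 / z" using z by (simp add: z_def field_simps)
    moreover have "exp 1 / z > 0" using z by simp
    ultimately have 2: "2 * \<beta> / z \<le> Y" by simp
    have "ln X - ln Y = ln (X / Y)" using XY by (subst ln_divide_pos) auto
    also have "\<dots> \<le> X / Y - 1" using XY by (intro ln_le_minus_one divide_pos_pos) auto
    also have "\<dots> = (X - Y) / Y" using XY by (simp add: field_simps)
    also have "\<dots> \<le> (d / z) / Y" using 1 XY by (intro divide_right_mono) auto
    finally have "\<beta> * (ln X - ln Y) \<le> \<beta> * ((d / z) / Y)" using \<beta> by (intro mult_left_mono) auto
    also have "\<dots> = (2 * \<beta> / z) / Y * (d / 2)" by simp
    also have "\<dots> \<le> 1 * (d / 2)"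
    proof (rule mult_right_mono)
      have "(2 * \<beta> / z) / Y \<le> Y / Y" by (rule divide_right_mono[OF 2]) (use XY in simp)
      also have "Y / Y = 1" using XY by simp
      finally show "(2 * \<beta> / z) / Y \<le> 1" .
    qed (use d in simp)
    also have "\<dots> \<le> \<bar>x - y\<bar> / 2" using d by simp
    finally show ?thesis .
  qed
  hence "exp (\<beta> * ln X) \<le> exp (\<bar>x - y\<bar> / 2 + \<beta> * ln Y)" by (simp add: algebra_simps)
  moreover have "log_weight \<beta> x = exp (\<beta> * ln X)" "log_weight \<beta> y = exp (\<beta> * ln Y)"
    using XY by (auto simp: log_weight_def X_def Y_def z_def powr_def)
  ultimately show ?thesis by (simp add: exp_add)
qed

section \<open>Essential suprema of continuous functions\<close>

lemma linf_norm_le: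
  assumes "continuous_on UNIV f" "\<And>x. \<bar>f x\<bar> \<le> C"
  shows "linf_norm f \<le> ennreal C"
proof -
  have [measurable]: "f \<in> borel_measurable borel" by (rule borel_measurable_continuous_onI[OF assms(1)])
  show ?thesis
    unfolding linf_norm_def by (rule esssup_I) (use assms(2) in \<open>auto intro: ennreal_leI\<close>)
qed

text \<open>Continuity upgrades an almost everywhere bound to every point: a violation at x would
  persist on an open interval, which has positive measure.\<close>

lemma le_linf_norm:
  fixes x :: real
  assumes "linf_norm f \<le> ennreal C" "C \<ge> 0" "continuous_on UNIV f"
  shows "\<bar>f x\<bar> \<le> C"
proof (rule ccontr)
  assume "\<not> \<bar>f x\<bar> \<le> C"
  hence x: "x \<in> {y. C < \<bar>f y\<bar>}" by simp
  have "open {y. C < \<bar>f y\<bar>}" using assms(3) by (intro open_Collect_less continuous_intros) auto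
  then obtain e where e: "e > 0" "ball x e \<subseteq> {y. C < \<bar>f y\<bar>}" using x by (auto simp: open_contains_ball)
  have "AE y in lborel. ennreal \<bar>f y\<bar> \<le> linf_norm f" unfolding linf_norm_def by (rule esssup_AE)
  hence "AE y in lborel. y \<notin> {x - e<..<x + e}"
  proof eventually_elim
    case (elim y)
    hence "ennreal \<bar>f y\<bar> \<le> ennreal C" using assms(1) by (rule order_trans)
    hence le: "\<bar>f y\<bar> \<le> C" using assms(2) by simp
    show ?case
    proof
      assume "y \<in> {x - e<..<x + e}"
      hence "y \<in> ball x e" by (auto simp: dist_real_def)
      with e(2) le show False by auto
    qed
  qed
  hence "emeasure lborel {x - e<..<x + e} = 0"
    by (subst AE_iff_measurable[symmetric, of "{x - e<..<x + e}" lborel "\<lambda>y. y \<notin> {x - e<..<x + e}"]) auto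
  thus False using e by simp
qed

text \<open>The function exp (-y) * (u + u') has derivative - exp (-y) * (u - u'') and tends to 0 at
  infinity because u and u' are bounded, so it is recovered by integrating from x to infinity.
  Moving the weight from x to y costs exp ((y - x) / 2), half of the decay; the integral of the
  remaining exp (- (y - x) / 2) is the factor 2.\<close>

lemma elliptic_weighted_bound_aux:
  fixes u u' u'' w :: "real \<Rightarrow> real"
  assumes u: "\<And>x. (u has_real_derivative u' x) (at x)" "\<And>x. (u' has_real_derivative u'' x) (at x)"
    and B: "\<And>x. \<bar>u x\<bar> \<le> B" "\<And>x. \<bar>u' x\<bar> \<le> B"
    and w: "\<And>x. w x > 0" "\<And>x y. w x \<le> exp (\<bar>x - y\<bar> / 2) * w y"
    and K: "\<And>x. \<bar>u x - u'' x\<bar> * w x \<le> K"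
  shows "\<bar>u x + u' x\<bar> * w x \<le> 2 * K"
proof -
  define k where "k = K / w x"
  define h where "h y = exp (- y) * (u y + u' y)" for y
  \<comment> \<open>An antiderivative of the bound \<open>k * exp (- x / 2) * exp (- y / 2)\<close>
    for |h'|, negative when k > 0 and vanishing at infinity.\<close>
  define G where "G y = - 2 * k * exp (- x / 2) * exp (- y / 2)" for y
  have K0: "K \<ge> 0" using K[of x] w(1)[of x] by (auto intro: order_trans[rotated])
  have k0: "k \<ge> 0" using K0 w(1)[of x] by (simp add: k_def)
  have hD: "(h has_real_derivative - exp (- y) * (u y - u'' y)) (at y)" for y
    unfolding h_def using u(1)[of y] u(2)[of y]
    by (auto intro!: derivative_eq_intros simp: algebra_simps)
  have GD: "(G has_real_derivative k * exp (- x / 2) * exp (- y / 2)) (at y)" for y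
    unfolding G_def by (auto intro!: derivative_eq_intros)
  have bd: "\<bar>exp (- y) * (u y - u'' y)\<bar> \<le> k * exp (- x / 2) * exp (- y / 2)" if "y \<ge> x" for y
  proof -
    have "\<bar>u y - u'' y\<bar> * w x \<le> \<bar>u y - u'' y\<bar> * (exp (\<bar>x - y\<bar> / 2) * w y)"
      by (intro mult_left_mono w) auto
    also have "\<dots> = exp ((y - x) / 2) * (\<bar>u y - u'' y\<bar> * w y)" using that by simp
    also have "\<dots> \<le> exp ((y - x) / 2) * K" by (intro mult_left_mono K) auto
    finally have "\<bar>u y - u'' y\<bar> \<le> k * exp ((y - x) / 2)"
      using w(1)[of x] by (simp add: k_def field_simps)
    hence "exp (- y) * \<bar>u y - u'' y\<bar> \<le> exp (- y) * (k * exp ((y - x) / 2))" by (intro mult_left_mono) auto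
    also have "\<dots> = k * (exp (- y) * exp ((y - x) / 2))" by simp
    also have "exp (- y) * exp ((y - x) / 2) = exp (- x / 2) * exp (- y / 2)"
      by (simp add: exp_add[symmetric] field_simps)
    finally show ?thesis by (simp add: abs_mult)
  qed
  \<comment> \<open>Since |h'| \<le> G', both G - h and G + h are nondecreasing on [x, R]. This
    replaces an improper integral; the term at R disappears in the limit.\<close>
  have "\<bar>h x\<bar> \<le> 2 * k * exp (- x) + 2 * B * exp (- R)" if R: "R \<ge> x" for R
  proof -
    have "G x - h x \<le> G R - h R"
    proof (rule DERIV_nonneg_imp_nondecreasing[OF R])
      fix y assume "x \<le> y"
      have "0 \<le> k * exp (- x / 2) * exp (- y / 2) - - exp (- y) * (u y - u'' y)"
        using bd[OF \<open>x \<le> y\<close>] by (simp add: abs_le_iff)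
      thus "\<exists>d. ((\<lambda>y. G y - h y) has_real_derivative d) (at y) \<and> 0 \<le> d"
        using DERIV_diff[OF GD hD] by blast
    qed
    moreover have "G x + h x \<le> G R + h R"
    proof (rule DERIV_nonneg_imp_nondecreasing[OF R])
      fix y assume "x \<le> y"
      have "0 \<le> k * exp (- x / 2) * exp (- y / 2) + - exp (- y) * (u y - u'' y)"
        using bd[OF \<open>x \<le> y\<close>] by (simp add: abs_le_iff)
      thus "\<exists>d. ((\<lambda>y. G y + h y) has_real_derivative d) (at y) \<and> 0 \<le> d"
        using DERIV_add[OF GD hD] by blast
    qed
    moreover have "G R \<le> 0" using k0 by (simp add: G_def)
    moreover have "G x = - (2 * k * exp (- x))"
      by (simp add: G_def exp_add[symmetric])
    moreover have "\<bar>h R\<bar> \<le> 2 * B * exp (- R)"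
    proof -
      have "\<bar>u R + u' R\<bar> \<le> 2 * B" using B[of R] by linarith
      thus ?thesis by (simp add: h_def abs_mult mult.commute)
    qed
    ultimately show ?thesis by linarith
  qed
  from eventually_mono[OF eventually_ge_at_top this]
  have "\<forall>\<^sub>F R in at_top. \<bar>h x\<bar> \<le> 2 * k * exp (- x) + 2 * B * exp (- R)" .
  moreover have "((\<lambda>R. 2 * k * exp (- x) + 2 * B * exp (- R)) \<longlongrightarrow> 2 * k * exp (- x) + 2 * B * 0) at_top"
    by (intro tendsto_intros filterlim_compose[OF exp_at_bot filterlim_uminus_at_bot_at_top])
  ultimately have "\<bar>h x\<bar> \<le> 2 * k * exp (- x)"
    using tendsto_lowerbound[of _ "2 * k * exp (- x) + 2 * B * 0" at_top] by fastforce
  hence "exp (- x) * \<bar>u x + u' x\<bar> \<le> exp (- x) * (2 * k)" by (simp add: h_def abs_mult mult_ac)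
  hence "\<bar>u x + u' x\<bar> \<le> 2 * k" by simp
  thus ?thesis using w(1)[of x] by (simp add: k_def field_simps)
qed

text \<open>Since \<open>(1 - \<partial>\<^sub>x\<^sup>2) = (1 - \<partial>\<^sub>x)(1 + \<partial>\<^sub>x)\<close>, the combinations \<open>u + u'\<close> and \<open>u - u'\<close> solve first-order
  equations that are integrated from \<open>+\<infinity>\<close> and \<open>-\<infinity>\<close>.\<close>

lemma elliptic_weighted_bound:
  fixes u u' u'' w :: "real \<Rightarrow> real"
  assumes u: "\<And>x. (u has_real_derivative u' x) (at x)" "\<And>x. (u' has_real_derivative u'' x) (at x)"
    and B: "\<And>x. \<bar>u x\<bar> \<le> B" "\<And>x. \<bar>u' x\<bar> \<le> B"
    and w: "\<And>x. w x > 0" "\<And>x y. w x \<le> exp (\<bar>x - y\<bar> / 2) * w y"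
    and K: "\<And>x. \<bar>u x - u'' x\<bar> * w x \<le> K"
  shows "\<bar>u x\<bar> * w x \<le> 2 * K" "\<bar>u' x\<bar> * w x \<le> 2 * K" "\<bar>u'' x\<bar> * w x \<le> 3 * K"
proof -
  have p: "\<bar>u x + u' x\<bar> * w x \<le> 2 * K"
    by (rule elliptic_weighted_bound_aux[OF u B w K])
  have m: "(uminus has_real_derivative - 1) (at x)" for x :: real
    by (auto intro!: derivative_eq_intros)
  \<comment> \<open>Reflection x -> -x turns u - u' into the sum treated before and preserves the
    condition on the weight, which depends on |x - y| only.\<close>
  have "\<bar>u (- (- x)) + - u' (- (- x))\<bar> * w (- (- x)) \<le> 2 * K"
  proof (rule elliptic_weighted_bound_aux[where u = "\<lambda>x. u (- x)" and u' = "\<lambda>x. - u' (- x)" and u'' = "\<lambda>x. u'' (- x)" and w = "\<lambda>x. w (- x)" and B = B])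
    show "((\<lambda>x. u (- x)) has_real_derivative - u' (- x)) (at x)" for x
      using DERIV_chain2[where f = u and g = uminus, OF u(1)[of "- x"] m[of x]] by simp
    show "((\<lambda>x. - u' (- x)) has_real_derivative u'' (- x)) (at x)" for x
      using DERIV_minus[OF DERIV_chain2[where f = u' and g = uminus, OF u(2)[of "- x"] m[of x]]] by simp
    show "w (- x) \<le> exp (\<bar>x - y\<bar> / 2) * w (- y)" for x y
      using w(2)[of "-x" "-y"] by (simp add: abs_minus_commute)
  qed (use B w K in auto)
  hence q: "\<bar>u x - u' x\<bar> * w x \<le> 2 * K" by simp
  have "\<bar>u x\<bar> \<le> (\<bar>u x + u' x\<bar> + \<bar>u x - u' x\<bar>) / 2"
    using abs_triangle_ineq[of "u x + u' x" "u x - u' x"] by simp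
  moreover have "\<bar>u' x\<bar> \<le> (\<bar>u x + u' x\<bar> + \<bar>u x - u' x\<bar>) / 2"
    using abs_triangle_ineq4[of "u x + u' x" "u x - u' x"] by simp
  ultimately have "\<bar>u x\<bar> * w x \<le> (\<bar>u x + u' x\<bar> + \<bar>u x - u' x\<bar>) / 2 * w x" "\<bar>u' x\<bar> * w x \<le> (\<bar>u x + u' x\<bar> + \<bar>u x - u' x\<bar>) / 2 * w x"
    using w(1)[of x] by (auto intro: mult_right_mono)
  with p q show 1: "\<bar>u x\<bar> * w x \<le> 2 * K" "\<bar>u' x\<bar> * w x \<le> 2 * K" by (auto simp: algebra_simps)
  have "\<bar>u'' x\<bar> \<le> \<bar>u x\<bar> + \<bar>u x - u'' x\<bar>" by linarith
  hence "\<bar>u'' x\<bar> * w x \<le> (\<bar>u x\<bar> + \<bar>u x - u'' x\<bar>) * w x" using w(1)[of x] by (auto intro: mult_right_mono)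
  with 1 K[of x] show "\<bar>u'' x\<bar> * w x \<le> 3 * K" by (simp add: algebra_simps)
qed

section \<open>Weighted bounds for small times\<close>

text \<open>Takes the place of Gronwall's inequality: at a time \<sigma> where |f| is maximal along
  the characteristic, with maximum S, one gets S \<le> |f 0 (\<eta> 0)| + T * (A * S + C). As T * A
  \<le> 1/2, half of S is absorbed on the left, which explains the factors 2.\<close>

lemma weak_transport_growth:
  fixes f a a' g :: "real \<Rightarrow> real \<Rightarrow> real" and \<eta> :: "real \<Rightarrow> real"
  assumes wt: "weak_transport T a f g"
    and f: "continuous_on ({0..T} \<times> UNIV) (\<lambda>(t, x). f t x)"
    and g: "continuous_on ({0..T} \<times> UNIV) (\<lambda>(t, x). g t x)"
    and a': "\<And>t x. t \<in> {0..T} \<Longrightarrow> (a t has_real_derivative a' t x) (at x)"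
    and a'c: "\<And>t. t \<in> {0..T} \<Longrightarrow> continuous_on UNIV (a' t)"
    and L: "\<And>t x. t \<in> {0..T} \<Longrightarrow> \<bar>a' t x\<bar> \<le> L"
    and \<eta>: "\<And>\<tau>. \<tau> \<in> {0..T} \<Longrightarrow> (\<eta> has_real_derivative a \<tau> (\<eta> \<tau>)) (at \<tau> within {0..T})"
    and gb: "\<And>\<tau>. \<tau> \<in> {0..T} \<Longrightarrow> \<bar>g \<tau> (\<eta> \<tau>)\<bar> \<le> A * \<bar>f \<tau> (\<eta> \<tau>)\<bar> + C"
    and A: "0 \<le> A" "T * A \<le> 1 / 2" and C: "0 \<le> C" and t: "t \<in> {0..T}"
  shows "\<bar>f t (\<eta> t)\<bar> \<le> 2 * \<bar>f 0 (\<eta> 0)\<bar> + 2 * (T * C)"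
proof -
  have \<eta>c: "continuous_on {0..T} \<eta>" using \<eta> by (rule DERIV_continuous_on)
  have "continuous_on {0..T} (\<lambda>\<tau>. (\<lambda>(t, x). f t x) (\<tau>, \<eta> \<tau>))"
    by (rule continuous_on_compose2[OF f]) (auto intro!: continuous_intros \<eta>c)
  hence "continuous_on {0..T} (\<lambda>\<tau>. \<bar>f \<tau> (\<eta> \<tau>)\<bar>)" by (auto intro!: continuous_intros)
  from continuous_attains_sup[OF compact_Icc _ this] t
  obtain \<sigma> where \<sigma>: "\<sigma> \<in> {0..T}" "\<And>\<tau>. \<tau> \<in> {0..T} \<Longrightarrow> \<bar>f \<tau> (\<eta> \<tau>)\<bar> \<le> \<bar>f \<sigma> (\<eta> \<sigma>)\<bar>" by auto
  define S where "S = \<bar>f \<sigma> (\<eta> \<sigma>)\<bar>"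
  have "\<bar>f \<sigma> (\<eta> \<sigma>) - f 0 (\<eta> 0)\<bar> \<le> \<sigma> * (A * S + C)"
  proof (rule weak_transport_along_characteristic[OF wt f g a' a'c L \<eta> \<sigma>(1)])
    fix \<tau> assume "\<tau> \<in> {0..\<sigma>}"
    hence \<tau>: "\<tau> \<in> {0..T}" using \<sigma>(1) by auto
    have "A * \<bar>f \<tau> (\<eta> \<tau>)\<bar> \<le> A * S" unfolding S_def by (intro mult_left_mono \<sigma>(2)[OF \<tau>] A)
    with gb[OF \<tau>] show "\<bar>g \<tau> (\<eta> \<tau>)\<bar> \<le> A * S + C" by linarith
  qed
  also have "\<dots> \<le> T * (A * S + C)"
    using \<sigma>(1) A C by (intro mult_right_mono) (auto simp: S_def)
  also have "\<dots> = (T * A) * S + T * C" by (simp add: algebra_simps)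
  also have "\<dots> \<le> 1 / 2 * S + T * C" using A by (intro add_right_mono mult_right_mono) (auto simp: S_def)
  finally have "S \<le> 2 * \<bar>f 0 (\<eta> 0)\<bar> + 2 * (T * C)" unfolding S_def by linarith
  with \<sigma>(2)[OF t] show ?thesis unfolding S_def by linarith
qed

text \<open>The solution on a short interval as functions with named derivatives. The single
  smallness condition T * 8 * B^2 \<le> 1 covers all uses: Lipschitz constant 2 * B^2 of the
  velocity times T at most 1/4, growth rates up to 4 * B^2 times T at most 1/2, displacement at most
  1, and source terms at most the initial size of \<rho>.\<close>

locale classical_solution =
  fixes T B :: real and \<rho> \<rho>x u ux uxx v vx vxx :: "real \<Rightarrow> real \<Rightarrow> real"
  assumes T: "0 \<le> T" "T * (8 * B\<^sup>2) \<le> 1"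
    and cont: "continuous_on ({0..T} \<times> UNIV) (\<lambda>(t, x). \<rho> t x)" "continuous_on ({0..T} \<times> UNIV) (\<lambda>(t, x). \<rho>x t x)"
      "continuous_on ({0..T} \<times> UNIV) (\<lambda>(t, x). u t x)" "continuous_on ({0..T} \<times> UNIV) (\<lambda>(t, x). ux t x)"
      "continuous_on ({0..T} \<times> UNIV) (\<lambda>(t, x). uxx t x)" "continuous_on ({0..T} \<times> UNIV) (\<lambda>(t, x). v t x)"
      "continuous_on ({0..T} \<times> UNIV) (\<lambda>(t, x). vx t x)" "continuous_on ({0..T} \<times> UNIV) (\<lambda>(t, x). vxx t x)"
    and bound: "\<And>t x. t \<in> {0..T} \<Longrightarrow> \<bar>\<rho> t x\<bar> \<le> B" "\<And>t x. t \<in> {0..T} \<Longrightarrow> \<bar>u t x\<bar> \<le> B"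
      "\<And>t x. t \<in> {0..T} \<Longrightarrow> \<bar>ux t x\<bar> \<le> B" "\<And>t x. t \<in> {0..T} \<Longrightarrow> \<bar>uxx t x\<bar> \<le> B"
      "\<And>t x. t \<in> {0..T} \<Longrightarrow> \<bar>v t x\<bar> \<le> B" "\<And>t x. t \<in> {0..T} \<Longrightarrow> \<bar>vx t x\<bar> \<le> B"
      "\<And>t x. t \<in> {0..T} \<Longrightarrow> \<bar>vxx t x\<bar> \<le> B"
    and der: "\<And>t x. t \<in> {0..T} \<Longrightarrow> (\<rho> t has_real_derivative \<rho>x t x) (at x)"
      "\<And>t x. t \<in> {0..T} \<Longrightarrow> (u t has_real_derivative ux t x) (at x)"
      "\<And>t x. t \<in> {0..T} \<Longrightarrow> (ux t has_real_derivative uxx t x) (at x)"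
      "\<And>t x. t \<in> {0..T} \<Longrightarrow> (v t has_real_derivative vx t x) (at x)"
      "\<And>t x. t \<in> {0..T} \<Longrightarrow> (vx t has_real_derivative vxx t x) (at x)"
    and weak_\<rho>: "\<And>\<phi> t. test_function \<phi> \<Longrightarrow> t \<in> {0..T} \<Longrightarrow>
      ((\<lambda>\<tau>. LINT x|lborel. \<rho> \<tau> x * \<phi> x) has_real_derivative
        (LINT x|lborel. \<rho> t x * u t x * v t x * deriv \<phi> x)) (at t within {0..T})"
    and weak_u: "\<And>\<phi> t. test_function \<phi> \<Longrightarrow> t \<in> {0..T} \<Longrightarrow>
      ((\<lambda>\<tau>. LINT x|lborel. (u \<tau> x - uxx \<tau> x) * \<phi> x) has_real_derivative
        (LINT x|lborel. (u t x - uxx t x) * deriv (\<lambda>y. u t y * v t y * \<phi> y) x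
          - 3 * v t x * ux t x * (u t x - uxx t x) * \<phi> x - (\<rho> t x)\<^sup>2 * u t x * \<phi> x)) (at t within {0..T})"
    and weak_v: "\<And>\<phi> t. test_function \<phi> \<Longrightarrow> t \<in> {0..T} \<Longrightarrow>
      ((\<lambda>\<tau>. LINT x|lborel. (v \<tau> x - vxx \<tau> x) * \<phi> x) has_real_derivative
        (LINT x|lborel. (v t x - vxx t x) * deriv (\<lambda>y. u t y * v t y * \<phi> y) x
          - 3 * vx t x * u t x * (v t x - vxx t x) * \<phi> x + (\<rho> t x)\<^sup>2 * v t x * \<phi> x)) (at t within {0..T})"
begin

section \<open>The velocity uv and the transport equations\<close>

definition a :: "real \<Rightarrow> real \<Rightarrow> real" where "a t x = u t x * v t x"
definition ax :: "real \<Rightarrow> real \<Rightarrow> real" where "ax t x = ux t x * v t x + u t x * vx t x"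
definition axx :: "real \<Rightarrow> real \<Rightarrow> real" where "axx t x = uxx t x * v t x + 2 * ux t x * vx t x + u t x * vxx t x"

lemmas cont' = cont[unfolded case_prod_beta]

lemma cont_a: "continuous_on ({0..T} \<times> UNIV) (\<lambda>(t, x). a t x)"
  "continuous_on ({0..T} \<times> UNIV) (\<lambda>(t, x). ax t x)" "continuous_on ({0..T} \<times> UNIV) (\<lambda>(t, x). axx t x)"
  unfolding a_def ax_def axx_def case_prod_beta by (intro continuous_intros cont')+

lemma der_a:
  assumes "t \<in> {0..T}"
  shows "(a t has_real_derivative ax t x) (at x)" "(ax t has_real_derivative axx t x) (at x)"
proof -
  show "(a t has_real_derivative ax t x) (at x)"
    unfolding a_def [abs_def] ax_def using der[OF assms, of x] by (auto intro!: derivative_eq_intros)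
  show "(ax t has_real_derivative axx t x) (at x)"
    unfolding ax_def [abs_def] axx_def using der[OF assms, of x] by (auto intro!: derivative_eq_intros)
qed

lemma mult_bound:
  assumes "\<bar>p\<bar> \<le> B" "\<bar>q\<bar> \<le> B"
  shows "\<bar>p * q\<bar> \<le> B\<^sup>2"
proof -
  have "\<bar>p\<bar> * \<bar>q\<bar> \<le> B * B" using assms by (intro mult_mono) auto
  thus ?thesis by (simp add: abs_mult power2_eq_square)
qed

lemma bound_a:
  assumes "t \<in> {0..T}"
  shows "\<bar>a t x\<bar> \<le> B\<^sup>2" "\<bar>ax t x\<bar> \<le> 2 * B\<^sup>2" "\<bar>axx t x\<bar> \<le> 4 * B\<^sup>2"
proof -
  note b = bound[OF assms, of x]
  show "\<bar>a t x\<bar> \<le> B\<^sup>2" unfolding a_def by (rule mult_bound[OF b(2) b(5)])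
  show "\<bar>ax t x\<bar> \<le> 2 * B\<^sup>2"
    unfolding ax_def using mult_bound[OF b(3) b(5)] mult_bound[OF b(2) b(6)] by linarith
  show "\<bar>axx t x\<bar> \<le> 4 * B\<^sup>2"
    unfolding axx_def mult.assoc
    using mult_bound[OF b(4) b(5)] mult_bound[OF b(3) b(6)] mult_bound[OF b(2) b(7)] by linarith
qed

lemma deriv_a_test:
  assumes "t \<in> {0..T}" "test_function \<phi>"
  shows "deriv (\<lambda>y. a t y * \<phi> y) x = ax t x * \<phi> x + a t x * deriv \<phi> x"
  using der_a(1)[OF assms(1), of x] test_function_DERIV[OF assms(2), of x]
  by (intro DERIV_imp_deriv) (auto intro!: derivative_eq_intros)

text \<open>The conservation law (\<rho> a)_x is expanded as a \<rho>_x + a_x \<rho>; its second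
  part becomes the source.\<close>

lemma transport_\<rho>: "weak_transport T a \<rho> (\<lambda>t x. - ax t x * \<rho> t x)"
  unfolding weak_transport_def
proof (intro allI impI)
  fix \<phi> t assume \<phi>: "test_function \<phi>" and t: "t \<in> {0..T}"
  have "(\<lambda>x. \<rho> t x * deriv (\<lambda>y. a t y * \<phi> y) x + - ax t x * \<rho> t x * \<phi> x) = (\<lambda>x. \<rho> t x * u t x * v t x * deriv \<phi> x)"
    unfolding deriv_a_test[OF t \<phi>] by (simp add: algebra_simps a_def)
  with weak_\<rho>[OF \<phi> t]
  show "((\<lambda>\<tau>. LINT x|lborel. \<rho> \<tau> x * \<phi> x) has_real_derivative
      (LINT x|lborel. \<rho> t x * deriv (\<lambda>y. a t y * \<phi> y) x + - ax t x * \<rho> t x * \<phi> x)) (at t within {0..T})"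
    by simp
qed

lemma transport_u:
  "weak_transport T a (\<lambda>t x. u t x - uxx t x) (\<lambda>t x. - 3 * v t x * ux t x * (u t x - uxx t x) - (\<rho> t x)\<^sup>2 * u t x)"
  unfolding weak_transport_def a_def using weak_u by (auto simp: algebra_simps)

lemma transport_v:
  "weak_transport T a (\<lambda>t x. v t x - vxx t x) (\<lambda>t x. - 3 * vx t x * u t x * (v t x - vxx t x) + (\<rho> t x)\<^sup>2 * v t x)"
  unfolding weak_transport_def a_def using weak_v by (auto simp: algebra_simps)

text \<open>Testing the first equation with \<open>\<phi>'\<close> gives the equation of \<open>\<rho>\<^sub>x\<close>; no second derivative of \<open>\<rho>\<close> occurs.\<close>

lemma transport_\<rho>x: "weak_transport T a \<rho>x (\<lambda>t x. - 2 * ax t x * \<rho>x t x - axx t x * \<rho> t x)"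
  unfolding weak_transport_def
proof (intro allI impI)
  fix \<phi> t assume \<phi>: "test_function \<phi>" and t: "t \<in> {0..T}"
  note \<phi>' = test_function_deriv[OF \<phi>] and \<phi>'' = test_function_deriv[OF test_function_deriv[OF \<phi>]]
  note tc = test_function_continuous[OF \<phi>] test_function_continuous[OF \<phi>'] test_function_continuous[OF \<phi>'']
  obtain R where R: "\<And>x. \<bar>x\<bar> > R \<Longrightarrow> \<phi> x = 0" using \<phi> by (auto simp: test_function_def)
  obtain R' where R': "\<And>x. \<bar>x\<bar> > R' \<Longrightarrow> deriv \<phi> x = 0" using \<phi>' by (auto simp: test_function_def)
  obtain R'' where R'': "\<And>x. \<bar>x\<bar> > R'' \<Longrightarrow> deriv (deriv \<phi>) x = 0" using \<phi>'' by (auto simp: test_function_def)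
  define M where "M = max R (max R' R'')"
  have M: "\<phi> x = 0" "deriv \<phi> x = 0" "deriv (deriv \<phi>) x = 0" if "\<bar>x\<bar> > M" for x
    using R R' R'' that by (auto simp: M_def)
  have int: "integrable lborel F" if "continuous_on UNIV F" "\<And>x. \<bar>x\<bar> > M \<Longrightarrow> F x = 0" for F :: "real \<Rightarrow> real"
  proof (rule compact_support_integrable[of "- M" M])
    show "continuous_on {- M..M} F" using that(1) by (rule continuous_on_subset) simp
    show "F x = 0" if "x \<notin> {- M..M}" for x using that \<open>\<And>x. \<bar>x\<bar> > M \<Longrightarrow> F x = 0\<close>[of x] by auto
  qed
  have slice: "continuous_on UNIV (\<rho> \<tau>)" "continuous_on UNIV (\<rho>x \<tau>)" "continuous_on UNIV (a \<tau>)"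
    "continuous_on UNIV (ax \<tau>)" "continuous_on UNIV (axx \<tau>)" if "\<tau> \<in> {0..T}" for \<tau>
    by (rule continuous_on_slice[OF cont(1) that] continuous_on_slice[OF cont(2) that] continuous_on_slice[OF cont_a(1) that]
      continuous_on_slice[OF cont_a(2) that] continuous_on_slice[OF cont_a(3) that])+
  have eq1: "- (LINT x|lborel. \<rho> \<tau> x * deriv \<phi> x) = (LINT x|lborel. \<rho>x \<tau> x * \<phi> x)" if \<tau>: "\<tau> \<in> {0..T}" for \<tau>
  proof -
    note s = slice[OF \<tau>]
    have i: "integrable lborel (\<lambda>x. \<rho> \<tau> x * deriv \<phi> x)" "integrable lborel (\<lambda>x. \<rho>x \<tau> x * \<phi> x)"
      by (intro int continuous_intros s tc; simp add: M)+
    have "(LINT x|lborel. \<rho>x \<tau> x * \<phi> x + \<rho> \<tau> x * deriv \<phi> x) = 0"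
    proof (rule compact_support_integral_deriv[of "\<lambda>x. \<rho> \<tau> x * \<phi> x"])
      show "((\<lambda>x. \<rho> \<tau> x * \<phi> x) has_real_derivative \<rho>x \<tau> x * \<phi> x + \<rho> \<tau> x * deriv \<phi> x) (at x)" for x
        using der(1)[OF \<tau>, of x] test_function_DERIV[OF \<phi>, of x] by (auto intro!: derivative_eq_intros)
      show "continuous_on UNIV (\<lambda>x. \<rho>x \<tau> x * \<phi> x + \<rho> \<tau> x * deriv \<phi> x)" by (intro continuous_intros s tc)
      show "\<rho> \<tau> x * \<phi> x = 0" if "\<bar>x\<bar> > M" for x using M that by simp
    qed
    thus ?thesis using i by simp
  qed
  have eq2: "(LINT x|lborel. \<rho>x t x * deriv (\<lambda>y. a t y * \<phi> y) x + (- 2 * ax t x * \<rho>x t x - axx t x * \<rho> t x) * \<phi> x)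
     = - (LINT x|lborel. \<rho> t x * u t x * v t x * deriv (deriv \<phi>) x)"
  proof -
    note s = slice[OF t]
    let ?G = "\<lambda>x. \<rho>x t x * (ax t x * \<phi> x + a t x * deriv \<phi> x) + (- 2 * ax t x * \<rho>x t x - axx t x * \<rho> t x) * \<phi> x"
    have i: "integrable lborel (\<lambda>x. \<rho> t x * a t x * deriv (deriv \<phi>) x)" "integrable lborel ?G"
      by (intro int continuous_intros s tc; simp add: M)+
    have "(LINT x|lborel. ?G x + \<rho> t x * a t x * deriv (deriv \<phi>) x) = 0"
    \<comment> \<open>Found by integrating by parts on paper: in the derivative of this function the
      two terms \<rho> a_x \<phi>' cancel and the rest is the integrand. The coefficient -2 in front
      of a_x \<rho>_x comes from differentiating the product (\<rho> a)_x.\<close>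
    proof (rule compact_support_integral_deriv[of "\<lambda>x. \<rho> t x * a t x * deriv \<phi> x - \<rho> t x * ax t x * \<phi> x"])
      show "((\<lambda>x. \<rho> t x * a t x * deriv \<phi> x - \<rho> t x * ax t x * \<phi> x) has_real_derivative
          ?G x + \<rho> t x * a t x * deriv (deriv \<phi>) x) (at x)" for x
        using der(1)[OF t, of x] der_a[OF t, of x] test_function_DERIV[OF \<phi>, of x] test_function_DERIV[OF \<phi>', of x]
        by (auto intro!: derivative_eq_intros simp: algebra_simps)
      show "continuous_on UNIV (\<lambda>x. ?G x + \<rho> t x * a t x * deriv (deriv \<phi>) x)" by (intro continuous_intros s tc)
      show "\<rho> t x * a t x * deriv \<phi> x - \<rho> t x * ax t x * \<phi> x = 0" if "\<bar>x\<bar> > M" for x using M that by simp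
    qed
    hence "(LINT x|lborel. ?G x) = - (LINT x|lborel. \<rho> t x * a t x * deriv (deriv \<phi>) x)"
      using i by simp
    thus ?thesis unfolding deriv_a_test[OF t \<phi>] by (simp add: a_def mult.assoc)
  qed
  have "((\<lambda>\<tau>. - (LINT x|lborel. \<rho> \<tau> x * deriv \<phi> x)) has_real_derivative
      - (LINT x|lborel. \<rho> t x * u t x * v t x * deriv (deriv \<phi>) x)) (at t within {0..T})"
    by (intro DERIV_minus weak_\<rho> \<phi>' t)
  hence "((\<lambda>\<tau>. LINT x|lborel. \<rho>x \<tau> x * \<phi> x) has_real_derivative
      - (LINT x|lborel. \<rho> t x * u t x * v t x * deriv (deriv \<phi>) x)) (at t within {0..T})"
    by (rule has_field_derivative_transform_within[where d = 1]) (use t eq1 in auto)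
  thus "((\<lambda>\<tau>. LINT x|lborel. \<rho>x \<tau> x * \<phi> x) has_real_derivative
      (LINT x|lborel. \<rho>x t x * deriv (\<lambda>y. a t y * \<phi> y) x + (- 2 * ax t x * \<rho>x t x - axx t x * \<rho> t x) * \<phi> x)) (at t within {0..T})"
    unfolding eq2 .
qed

text \<open>All four quantities share the velocity uv, so one characteristic through (t, y), with
  foot x = \<eta> 0, serves them all. The bound for \<rho> is established first, along the entire
  curve, since \<rho> enters the sources of the other three.\<close>

lemma pointwise_bounds:
  assumes t: "t \<in> {0..T}"
  obtains x where "\<bar>x - y\<bar> \<le> 1" "\<bar>\<rho> t y\<bar> \<le> 2 * \<bar>\<rho> 0 x\<bar>" "\<bar>\<rho>x t y\<bar> \<le> 2 * \<bar>\<rho>x 0 x\<bar> + 2 * \<bar>\<rho> 0 x\<bar>"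
    "\<bar>u t y - uxx t y\<bar> \<le> 2 * \<bar>u 0 x - uxx 0 x\<bar> + 2 * \<bar>\<rho> 0 x\<bar>"
    "\<bar>v t y - vxx t y\<bar> \<le> 2 * \<bar>v 0 x - vxx 0 x\<bar> + 2 * \<bar>\<rho> 0 x\<bar>"
proof -
  have axc: "continuous_on UNIV (ax t)" if "t \<in> {0..T}" for t
    by (rule continuous_on_slice[OF cont_a(2) that])
  have lip: "\<bar>a t x - a t z\<bar> \<le> 2 * B\<^sup>2 * \<bar>x - z\<bar>" if "t \<in> {0..T}" for t x z
    using field_differentiable_bound[of UNIV "a t" "ax t" "2 * B\<^sup>2" x z] der_a(1)[OF that] bound_a(2)[OF that] by simp
  have "T * (2 * B\<^sup>2) \<le> 1 / 4" using T by simp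
  from ode_terminal_value_exists[OF T(1) t cont_a(1) lip _ this]
  obtain \<eta> where \<eta>y: "\<eta> t = y" and \<eta>: "\<And>\<tau>. \<tau> \<in> {0..T} \<Longrightarrow> (\<eta> has_real_derivative a \<tau> (\<eta> \<tau>)) (at \<tau> within {0..T})"
    by auto
  have t0: "0 \<in> {0..T}" using T by simp
  define r where "r = \<bar>\<rho> 0 (\<eta> 0)\<bar>"
  have r0: "r \<ge> 0" by (simp add: r_def)
  have TB: "T * B\<^sup>2 \<le> 1 / 8" using T by simp
  \<comment> \<open>The speed |uv| is at most B^2, so the foot lies within T * B^2 of y; distance 1
    is all that is kept of this.\<close>
  have "norm (\<eta> 0 - \<eta> t) \<le> B\<^sup>2 * norm (0 - t)"
    by (rule field_differentiable_bound[of "{0..T}", OF _ \<eta>]) (use bound_a(1) t t0 in auto)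
  also have "\<dots> \<le> T * B\<^sup>2" using t by (simp add: mult.commute mult_right_mono)
  also have "\<dots> \<le> 1" using TB by simp
  finally have dist: "\<bar>\<eta> 0 - y\<bar> \<le> 1" by (simp add: \<eta>y)
  note grow = weak_transport_growth[OF _ _ _ der_a(1) axc bound_a(2) \<eta>]
  have \<rho>b: "\<bar>\<rho> \<tau> (\<eta> \<tau>)\<bar> \<le> 2 * r" if \<tau>: "\<tau> \<in> {0..T}" for \<tau>
  proof -
    have "\<bar>\<rho> \<tau> (\<eta> \<tau>)\<bar> \<le> 2 * \<bar>\<rho> 0 (\<eta> 0)\<bar> + 2 * (T * 0)"
    proof (rule grow[OF transport_\<rho> cont(1), where A = "2 * B\<^sup>2"])
      show "continuous_on ({0..T} \<times> UNIV) (\<lambda>(t, x). - ax t x * \<rho> t x)"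
        using cont_a(2) cont(1) unfolding case_prod_beta by (intro continuous_intros)
      show "\<bar>- ax t (\<eta> t) * \<rho> t (\<eta> t)\<bar> \<le> 2 * B\<^sup>2 * \<bar>\<rho> t (\<eta> t)\<bar> + 0" if "t \<in> {0..T}" for t
        using bound_a(2)[OF that, of "\<eta> t"] by (simp add: abs_mult mult_right_mono)
    qed (use TB \<tau> in auto)
    thus ?thesis by (simp add: r_def)
  qed
  have \<rho>xb: "\<bar>\<rho>x t (\<eta> t)\<bar> \<le> 2 * \<bar>\<rho>x 0 (\<eta> 0)\<bar> + 2 * (T * (8 * B\<^sup>2 * r))"
  proof (rule grow[OF transport_\<rho>x cont(2), where A = "4 * B\<^sup>2"])
    show "continuous_on ({0..T} \<times> UNIV) (\<lambda>(t, x). - 2 * ax t x * \<rho>x t x - axx t x * \<rho> t x)"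
      using cont_a(2,3) cont(1,2) unfolding case_prod_beta by (intro continuous_intros)
    fix \<tau> assume \<tau>: "\<tau> \<in> {0..T}"
    have "\<bar>ax \<tau> (\<eta> \<tau>)\<bar> * \<bar>\<rho>x \<tau> (\<eta> \<tau>)\<bar> \<le> 2 * B\<^sup>2 * \<bar>\<rho>x \<tau> (\<eta> \<tau>)\<bar>"
      by (intro mult_right_mono bound_a \<tau>) simp
    moreover have "\<bar>axx \<tau> (\<eta> \<tau>)\<bar> * \<bar>\<rho> \<tau> (\<eta> \<tau>)\<bar> \<le> 4 * B\<^sup>2 * (2 * r)"
      by (intro mult_mono bound_a \<rho>b \<tau>) auto
    moreover have "\<bar>- 2 * ax \<tau> (\<eta> \<tau>) * \<rho>x \<tau> (\<eta> \<tau>) - axx \<tau> (\<eta> \<tau>) * \<rho> \<tau> (\<eta> \<tau>)\<bar>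
        \<le> 2 * (\<bar>ax \<tau> (\<eta> \<tau>)\<bar> * \<bar>\<rho>x \<tau> (\<eta> \<tau>)\<bar>) + \<bar>axx \<tau> (\<eta> \<tau>)\<bar> * \<bar>\<rho> \<tau> (\<eta> \<tau>)\<bar>"
      unfolding abs_mult[symmetric] by linarith
    ultimately show "\<bar>- 2 * ax \<tau> (\<eta> \<tau>) * \<rho>x \<tau> (\<eta> \<tau>) - axx \<tau> (\<eta> \<tau>) * \<rho> \<tau> (\<eta> \<tau>)\<bar> \<le> 4 * B\<^sup>2 * \<bar>\<rho>x \<tau> (\<eta> \<tau>)\<bar> + 8 * B\<^sup>2 * r"
      by linarith
  qed (use TB t r0 in auto)
  \<comment> \<open>The quadratic term is kept linear in the initial data: one factor \<rho> is
    bounded by B together with p, and only the other by 2 * r.\<close>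
  have src: "\<bar>(\<rho> \<tau> (\<eta> \<tau>))\<^sup>2 * p\<bar> \<le> 2 * B\<^sup>2 * r" if \<tau>: "\<tau> \<in> {0..T}" and p: "\<bar>p\<bar> \<le> B" for \<tau> p
  proof -
    have "\<bar>(\<rho> \<tau> (\<eta> \<tau>))\<^sup>2 * p\<bar> = \<bar>\<rho> \<tau> (\<eta> \<tau>) * p\<bar> * \<bar>\<rho> \<tau> (\<eta> \<tau>)\<bar>" by (simp add: power2_eq_square abs_mult)
    also have "\<dots> \<le> B\<^sup>2 * (2 * r)" by (intro mult_mono mult_bound bound \<tau> p \<rho>b) auto
    finally show ?thesis by simp
  qed
  have lin: "\<bar>3 * p * q * m\<bar> \<le> 3 * B\<^sup>2 * \<bar>m\<bar>" if "\<bar>p\<bar> \<le> B" "\<bar>q\<bar> \<le> B" for p q m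
  proof -
    have "\<bar>p * q\<bar> * \<bar>m\<bar> \<le> B\<^sup>2 * \<bar>m\<bar>" by (intro mult_right_mono mult_bound that) simp
    thus ?thesis by (simp add: abs_mult)
  qed
  have ub: "\<bar>u t (\<eta> t) - uxx t (\<eta> t)\<bar> \<le> 2 * \<bar>u 0 (\<eta> 0) - uxx 0 (\<eta> 0)\<bar> + 2 * (T * (2 * B\<^sup>2 * r))"
  proof (rule grow[OF transport_u, where A = "3 * B\<^sup>2"])
    show "continuous_on ({0..T} \<times> UNIV) (\<lambda>(t, x). - 3 * v t x * ux t x * (u t x - uxx t x) - (\<rho> t x)\<^sup>2 * u t x)"
      "continuous_on ({0..T} \<times> UNIV) (\<lambda>(t, x). u t x - uxx t x)"
      unfolding case_prod_beta by (intro continuous_intros cont')+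
    fix \<tau> assume \<tau>: "\<tau> \<in> {0..T}"
    show "\<bar>- 3 * v \<tau> (\<eta> \<tau>) * ux \<tau> (\<eta> \<tau>) * (u \<tau> (\<eta> \<tau>) - uxx \<tau> (\<eta> \<tau>)) - (\<rho> \<tau> (\<eta> \<tau>))\<^sup>2 * u \<tau> (\<eta> \<tau>)\<bar>
      \<le> 3 * B\<^sup>2 * \<bar>u \<tau> (\<eta> \<tau>) - uxx \<tau> (\<eta> \<tau>)\<bar> + 2 * B\<^sup>2 * r"
      using src[OF \<tau> bound(2)[OF \<tau>], of "\<eta> \<tau>"]
        lin[OF bound(5)[OF \<tau>, of "\<eta> \<tau>"] bound(3)[OF \<tau>, of "\<eta> \<tau>"], of "u \<tau> (\<eta> \<tau>) - uxx \<tau> (\<eta> \<tau>)"]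
      by (simp only: mult_minus_left)
  qed (use TB t r0 in auto)
  have vb: "\<bar>v t (\<eta> t) - vxx t (\<eta> t)\<bar> \<le> 2 * \<bar>v 0 (\<eta> 0) - vxx 0 (\<eta> 0)\<bar> + 2 * (T * (2 * B\<^sup>2 * r))"
  proof (rule grow[OF transport_v, where A = "3 * B\<^sup>2"])
    show "continuous_on ({0..T} \<times> UNIV) (\<lambda>(t, x). - 3 * vx t x * u t x * (v t x - vxx t x) + (\<rho> t x)\<^sup>2 * v t x)"
      "continuous_on ({0..T} \<times> UNIV) (\<lambda>(t, x). v t x - vxx t x)"
      unfolding case_prod_beta by (intro continuous_intros cont')+
    fix \<tau> assume \<tau>: "\<tau> \<in> {0..T}"
    show "\<bar>- 3 * vx \<tau> (\<eta> \<tau>) * u \<tau> (\<eta> \<tau>) * (v \<tau> (\<eta> \<tau>) - vxx \<tau> (\<eta> \<tau>)) + (\<rho> \<tau> (\<eta> \<tau>))\<^sup>2 * v \<tau> (\<eta> \<tau>)\<bar>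
      \<le> 3 * B\<^sup>2 * \<bar>v \<tau> (\<eta> \<tau>) - vxx \<tau> (\<eta> \<tau>)\<bar> + 2 * B\<^sup>2 * r"
      using src[OF \<tau> bound(5)[OF \<tau>], of "\<eta> \<tau>"]
        lin[OF bound(6)[OF \<tau>, of "\<eta> \<tau>"] bound(2)[OF \<tau>, of "\<eta> \<tau>"], of "v \<tau> (\<eta> \<tau>) - vxx \<tau> (\<eta> \<tau>)"]
      by (simp only: mult_minus_left)
  qed (use TB t r0 in auto)
  \<comment> \<open>Short time makes the accumulated sources at most r, so that they appear in the
    result simply as 2 * |\<rho> 0 x|.\<close>
  have "(T * B\<^sup>2) * r \<le> 1 / 8 * r" by (rule mult_right_mono[OF TB r0])
  hence Tr: "T * (8 * B\<^sup>2 * r) \<le> r" "T * (2 * B\<^sup>2 * r) \<le> r" using r0 by (simp_all add: mult_ac)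
  show ?thesis
    by (rule that[of "\<eta> 0"]) (use dist \<rho>b[OF t] \<rho>xb ub vb Tr in \<open>simp_all add: \<eta>y r_def [symmetric]\<close>)
qed

text \<open>Carrying the weight over distance at most 1 costs exp (1/2) \<le> 2. This gives 2 * 2 C
  = 4 C for \<rho> and 2 * (2 C + 2 C) = 8 C for \<open>\<rho>x\<close>. Initially |m| and |n| have
  weighted bound 2 C, hence 2 * (4 C + 2 C) = 12 C later, and the elliptic factors 2 and 3 turn this
  into 24 C and 36 C.\<close>

lemma weighted_bounds:
  fixes w :: "real \<Rightarrow> real"
  assumes w: "\<And>x. w x > 0" "\<And>x y. w x \<le> exp (\<bar>x - y\<bar> / 2) * w y"
    and init: "\<And>x. \<bar>\<rho> 0 x\<bar> * w x \<le> C" "\<And>x. \<bar>\<rho>x 0 x\<bar> * w x \<le> C" "\<And>x. \<bar>u 0 x\<bar> * w x \<le> C" "\<And>x. \<bar>uxx 0 x\<bar> * w x \<le> C"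
      "\<And>x. \<bar>v 0 x\<bar> * w x \<le> C" "\<And>x. \<bar>vxx 0 x\<bar> * w x \<le> C"
    and t: "t \<in> {0..T}"
  shows "\<bar>\<rho> t y\<bar> * w y \<le> 4 * C" "\<bar>\<rho>x t y\<bar> * w y \<le> 8 * C" "\<bar>u t y\<bar> * w y \<le> 24 * C" "\<bar>ux t y\<bar> * w y \<le> 24 * C"
    "\<bar>uxx t y\<bar> * w y \<le> 36 * C" "\<bar>v t y\<bar> * w y \<le> 24 * C" "\<bar>vx t y\<bar> * w y \<le> 24 * C" "\<bar>vxx t y\<bar> * w y \<le> 36 * C"
proof -
  have wt: "w y \<le> 2 * w x" if "\<bar>x - y\<bar> \<le> 1" for x y
  proof -
    have "exp (\<bar>y - x\<bar> / 2) \<le> exp (1 / 2)" using that by (simp add: abs_minus_commute)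
    also have "exp (1 / 2 :: real) \<le> 2" using exp_bound_half[of "1 / 2 :: real"] by simp
    finally have "exp (\<bar>y - x\<bar> / 2) * w x \<le> 2 * w x" using w(1)[of x] by (intro mult_right_mono) auto
    with w(2)[of y x] show ?thesis by linarith
  qed
  have tr: "\<bar>p\<bar> * w y \<le> 2 * c" if "\<bar>p\<bar> \<le> q" "q * w x \<le> c" "\<bar>x - y\<bar> \<le> 1" for p q c x y
  proof -
    have "\<bar>p\<bar> * w y \<le> q * (2 * w x)" using that(1) wt[OF that(3)] w(1)[of y] by (intro mult_mono) auto
    with that(2) show ?thesis by simp
  qed
  have m0: "\<bar>u 0 x - uxx 0 x\<bar> * w x \<le> 2 * C" "\<bar>v 0 x - vxx 0 x\<bar> * w x \<le> 2 * C" for x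
  proof -
    have "\<bar>u 0 x - uxx 0 x\<bar> * w x \<le> (\<bar>u 0 x\<bar> + \<bar>uxx 0 x\<bar>) * w x" "\<bar>v 0 x - vxx 0 x\<bar> * w x \<le> (\<bar>v 0 x\<bar> + \<bar>vxx 0 x\<bar>) * w x"
      using w(1)[of x] by (intro mult_right_mono; simp)+
    thus "\<bar>u 0 x - uxx 0 x\<bar> * w x \<le> 2 * C" "\<bar>v 0 x - vxx 0 x\<bar> * w x \<le> 2 * C"
      using init[of x] by (simp_all add: distrib_right)
  qed
  have main: "\<bar>\<rho> t y\<bar> * w y \<le> 2 * (2 * C)" "\<bar>\<rho>x t y\<bar> * w y \<le> 2 * (4 * C)"
    "\<bar>u t y - uxx t y\<bar> * w y \<le> 2 * (6 * C)" "\<bar>v t y - vxx t y\<bar> * w y \<le> 2 * (6 * C)" for y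
  proof -
    obtain x where x: "\<bar>x - y\<bar> \<le> 1" "\<bar>\<rho> t y\<bar> \<le> 2 * \<bar>\<rho> 0 x\<bar>" "\<bar>\<rho>x t y\<bar> \<le> 2 * \<bar>\<rho>x 0 x\<bar> + 2 * \<bar>\<rho> 0 x\<bar>"
      "\<bar>u t y - uxx t y\<bar> \<le> 2 * \<bar>u 0 x - uxx 0 x\<bar> + 2 * \<bar>\<rho> 0 x\<bar>"
      "\<bar>v t y - vxx t y\<bar> \<le> 2 * \<bar>v 0 x - vxx 0 x\<bar> + 2 * \<bar>\<rho> 0 x\<bar>"
      using pointwise_bounds[OF t] by blast
    show "\<bar>\<rho> t y\<bar> * w y \<le> 2 * (2 * C)"
      by (rule tr[OF x(2) _ x(1)]) (use init(1)[of x] in simp)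
    show "\<bar>\<rho>x t y\<bar> * w y \<le> 2 * (4 * C)"
      by (rule tr[OF x(3) _ x(1)]) (use init(1,2)[of x] in \<open>simp add: distrib_right\<close>)
    show "\<bar>u t y - uxx t y\<bar> * w y \<le> 2 * (6 * C)"
      by (rule tr[OF x(4) _ x(1)]) (use init(1)[of x] m0(1)[of x] in \<open>simp add: distrib_right\<close>)
    show "\<bar>v t y - vxx t y\<bar> * w y \<le> 2 * (6 * C)"
      by (rule tr[OF x(5) _ x(1)]) (use init(1)[of x] m0(2)[of x] in \<open>simp add: distrib_right\<close>)
  qed
  show "\<bar>\<rho> t y\<bar> * w y \<le> 4 * C" "\<bar>\<rho>x t y\<bar> * w y \<le> 8 * C" using main by simp_all
  note eu = elliptic_weighted_bound[OF der(2)[OF t] der(3)[OF t] bound(2)[OF t] bound(3)[OF t] w main(3), of y]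
  note ev = elliptic_weighted_bound[OF der(4)[OF t] der(5)[OF t] bound(5)[OF t] bound(6)[OF t] w main(4), of y]
  show "\<bar>u t y\<bar> * w y \<le> 24 * C" "\<bar>ux t y\<bar> * w y \<le> 24 * C" "\<bar>uxx t y\<bar> * w y \<le> 36 * C"
    "\<bar>v t y\<bar> * w y \<le> 24 * C" "\<bar>vx t y\<bar> * w y \<le> 24 * C" "\<bar>vxx t y\<bar> * w y \<le> 36 * C"
    using eu ev by simp_all
qed

end

section \<open>From pointwise weighted bounds to the norms\<close>

lemma weighted_linf_norm_le:
  assumes "\<And>f. f \<in> {\<rho>, deriv \<rho>, u, deriv u, deriv (deriv u), v, deriv v, deriv (deriv v)} \<Longrightarrow> continuous_on UNIV f"
    and "\<beta> > 0" and "0 \<le> C"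
    and "\<And>x. \<bar>\<rho> x\<bar> * log_weight \<beta> x \<le> 4 * C" "\<And>x. \<bar>deriv \<rho> x\<bar> * log_weight \<beta> x \<le> 8 * C"
    "\<And>x. \<bar>u x\<bar> * log_weight \<beta> x \<le> 24 * C" "\<And>x. \<bar>deriv u x\<bar> * log_weight \<beta> x \<le> 24 * C" "\<And>x. \<bar>deriv (deriv u) x\<bar> * log_weight \<beta> x \<le> 36 * C"
    "\<And>x. \<bar>v x\<bar> * log_weight \<beta> x \<le> 24 * C" "\<And>x. \<bar>deriv v x\<bar> * log_weight \<beta> x \<le> 24 * C" "\<And>x. \<bar>deriv (deriv v) x\<bar> * log_weight \<beta> x \<le> 36 * C"
  shows "weighted_linf_norm \<beta> \<rho> u v \<le> ennreal (180 * C)"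
proof -
  have le: "linf_norm (\<lambda>x. f x * log_weight \<beta> x) \<le> ennreal K"
    if "f \<in> {\<rho>, deriv \<rho>, u, deriv u, deriv (deriv u), v, deriv v, deriv (deriv v)}" "\<And>x. \<bar>f x\<bar> * log_weight \<beta> x \<le> K" for f K
    using that(2) log_weight_pos[OF assms(2)]
    by (intro linf_norm_le continuous_on_mult assms(1)[OF that(1)] log_weight_continuous assms(2)) (simp add: abs_mult less_imp_le)
  have "weighted_linf_norm \<beta> \<rho> u v \<le> ennreal (4 * C) + (ennreal (8 * C) + (ennreal (24 * C) + (ennreal (24 * C) + (ennreal (36 * C)
      + (ennreal (24 * C) + (ennreal (24 * C) + ennreal (36 * C)))))))"
    unfolding weighted_linf_norm_def list.map sum_list.Cons sum_list.Nil add_0_right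
    by (intro add_mono le assms) simp_all
  \<comment> \<open>Here 180 = 4 + 8 + 2 * (24 + 24 + 36).\<close>
  also have "\<dots> = ennreal (180 * C)" using assms(3) by (simp flip: ennreal_plus)
  finally show ?thesis .
qed

text \<open>A single summand is below the sum of norms in \<open>ennreal\<close>, and continuity
  turns its essential bound into one at every point.\<close>

lemma weighted_linf_norm_pointwise:
  assumes "weighted_linf_norm \<beta> \<rho> u v \<le> ennreal C" "0 \<le> C" "\<beta> > 0"
    and f: "f \<in> {\<rho>, deriv \<rho>, u, deriv u, deriv (deriv u), v, deriv v, deriv (deriv v)}" "continuous_on UNIV f"
  shows "\<bar>f x\<bar> * log_weight \<beta> x \<le> C"
proof -
  have "linf_norm (\<lambda>x. f x * log_weight \<beta> x) \<le> weighted_linf_norm \<beta> \<rho> u v"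
    unfolding weighted_linf_norm_def using f(1) by (intro member_le_sum_list) auto
  also note assms(1)
  finally have "\<bar>f x * log_weight \<beta> x\<bar> \<le> C"
    by (rule le_linf_norm) (intro assms(2) continuous_on_mult f(2) log_weight_continuous assms(3))+
  thus ?thesis using log_weight_pos[OF assms(3), of x] by (simp add: abs_mult)
qed

theorem theorem1p6:
  fixes s :: real
  assumes "s > 5 / 2"
  shows "\<exists>C\<^sub>1 :: real \<Rightarrow> real \<Rightarrow> real \<Rightarrow> real.
    \<forall>(\<rho>\<^sub>0 :: real \<Rightarrow> real) (u\<^sub>0 :: real \<Rightarrow> real) (v\<^sub>0 :: real \<Rightarrow> real) (T :: ereal)
     (\<rho> :: real \<Rightarrow> real \<Rightarrow> real) (u :: real \<Rightarrow> real \<Rightarrow> real) (v :: real \<Rightarrow> real \<Rightarrow> real)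
     (\<beta> :: real) (C\<^sub>\<beta> :: real) (C\<^sub>0 :: real).
      \<rho>\<^sub>0 \<in> sobolev_cont (s - 1) \<and> u\<^sub>0 \<in> sobolev_cont s \<and> v\<^sub>0 \<in> sobolev_cont s \<and>
      T = lifespan s \<rho>\<^sub>0 u\<^sub>0 v\<^sub>0 \<and> 0 < T \<and>
      solution s T \<rho> u v \<and> \<rho> 0 = \<rho>\<^sub>0 \<and> u 0 = u\<^sub>0 \<and> v 0 = v\<^sub>0 \<and>
      0 < \<beta> \<and> is_C\<^sub>\<beta> \<beta> C\<^sub>\<beta> \<and> 0 \<le> C\<^sub>0 \<and>
      weighted_linf_norm \<beta> \<rho>\<^sub>0 u\<^sub>0 v\<^sub>0 \<le> ennreal C\<^sub>0
      \<longrightarrow> (\<exists>T\<^sub>0. 0 < T\<^sub>0 \<and> ereal T\<^sub>0 < T \<and>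
            (\<forall>t\<in>{0..T\<^sub>0}. weighted_linf_norm \<beta> (\<rho> t) (u t) (v t)
                \<le> ennreal (C\<^sub>1 (sup_sobolev_norm s T\<^sub>0 \<rho> u v) C\<^sub>\<beta> C\<^sub>0)))"
proof (intro exI[of _ "\<lambda>_ _ C\<^sub>0. 180 * C\<^sub>0"] allI impI; elim conjE)
  fix \<rho>\<^sub>0 u\<^sub>0 v\<^sub>0 :: "real \<Rightarrow> real" and T :: ereal and \<rho> u v :: "real \<Rightarrow> real \<Rightarrow> real" and \<beta> C\<^sub>\<beta> C :: real
  assume T: "0 < T" and sol: "solution s T \<rho> u v" and init: "\<rho> 0 = \<rho>\<^sub>0" "u 0 = u\<^sub>0" "v 0 = v\<^sub>0"
    and \<beta>: "0 < \<beta>" and C: "0 \<le> C" and norm0: "weighted_linf_norm \<beta> \<rho>\<^sub>0 u\<^sub>0 v\<^sub>0 \<le> ennreal C"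
  let ?I = "time_interval T"
  have curves: "sobolev_curve (s - 1) T \<rho>" "sobolev_curve s T u" "sobolev_curve s T v"
    and weak: "\<And>\<phi> t. test_function \<phi> \<Longrightarrow> t \<in> ?I \<Longrightarrow>
        ((\<lambda>\<tau>. LINT x|lborel. \<rho> \<tau> x * \<phi> x) has_real_derivative weak_rhs_\<rho> (\<rho> t) (u t) (v t) \<phi>) (at t within ?I)"
      "\<And>\<phi> t. test_function \<phi> \<Longrightarrow> t \<in> ?I \<Longrightarrow>
        ((\<lambda>\<tau>. LINT x|lborel. momentum (u \<tau>) x * \<phi> x) has_real_derivative weak_rhs_m (\<rho> t) (u t) (v t) \<phi>) (at t within ?I)"
      "\<And>\<phi> t. test_function \<phi> \<Longrightarrow> t \<in> ?I \<Longrightarrow>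
        ((\<lambda>\<tau>. LINT x|lborel. momentum (v \<tau>) x * \<phi> x) has_real_derivative weak_rhs_n (\<rho> t) (u t) (v t) \<phi>) (at t within ?I)"
    using sol by (auto simp: solution_def)
  \<comment> \<open>This is where 5/2 enters: one classical derivative of \<rho> in H^(s-1), two of
    u and v in H^s.\<close>
  have s: "s - 1 > real 1 + 1 / 2" "s > real 2 + 1 / 2" using assms by auto
  obtain d1 B1 where \<rho>: "d1 > 0" "B1 \<ge> 0"
    "\<And>j. j \<le> 1 \<Longrightarrow> continuous_on (?I \<times> UNIV) (\<lambda>(t, x). (deriv ^^ j) (\<rho> t) x)"
    "\<And>j t x. j \<le> 1 \<Longrightarrow> t \<in> ?I \<Longrightarrow> t \<le> d1 \<Longrightarrow> \<bar>(deriv ^^ j) (\<rho> t) x\<bar> \<le> B1"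
    "\<And>j t x. j < 1 \<Longrightarrow> t \<in> ?I \<Longrightarrow> ((deriv ^^ j) (\<rho> t) has_real_derivative (deriv ^^ Suc j) (\<rho> t) x) (at x)"
    using sobolev_curve_classical[OF s(1) curves(1) T] by blast
  obtain d2 B2 where u: "d2 > 0" "B2 \<ge> 0"
    "\<And>j. j \<le> 2 \<Longrightarrow> continuous_on (?I \<times> UNIV) (\<lambda>(t, x). (deriv ^^ j) (u t) x)"
    "\<And>j t x. j \<le> 2 \<Longrightarrow> t \<in> ?I \<Longrightarrow> t \<le> d2 \<Longrightarrow> \<bar>(deriv ^^ j) (u t) x\<bar> \<le> B2"
    "\<And>j t x. j < 2 \<Longrightarrow> t \<in> ?I \<Longrightarrow> ((deriv ^^ j) (u t) has_real_derivative (deriv ^^ Suc j) (u t) x) (at x)"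
    using sobolev_curve_classical[OF s(2) curves(2) T] by blast
  obtain d3 B3 where v: "d3 > 0" "B3 \<ge> 0"
    "\<And>j. j \<le> 2 \<Longrightarrow> continuous_on (?I \<times> UNIV) (\<lambda>(t, x). (deriv ^^ j) (v t) x)"
    "\<And>j t x. j \<le> 2 \<Longrightarrow> t \<in> ?I \<Longrightarrow> t \<le> d3 \<Longrightarrow> \<bar>(deriv ^^ j) (v t) x\<bar> \<le> B3"
    "\<And>j t x. j < 2 \<Longrightarrow> t \<in> ?I \<Longrightarrow> ((deriv ^^ j) (v t) has_real_derivative (deriv ^^ Suc j) (v t) x) (at x)"
    using sobolev_curve_classical[OF s(2) curves(3) T] by blast
  \<comment> \<open>The added 1 keeps \<open>8 * B\<^sup>2\<close> positive, as the choice of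
    \<open>T0\<close> divides by it.\<close>
  define B where "B = 1 + max B1 (max B2 B3)"
  have B: "B1 \<le> B" "B2 \<le> B" "B3 \<le> B" "B \<ge> 1" using \<rho>(2) by (auto simp: B_def)
  \<comment> \<open>The lifespan may be infinite, so a real number strictly below it is picked
    before taking minima.\<close>
  obtain d0 where d0: "0 < d0" "ereal d0 < T"
    using ereal_dense2[OF T] by (auto simp: zero_ereal_def)
  define T0 where "T0 = min d0 (min (min d1 (min d2 d3)) (1 / (8 * B\<^sup>2)))"
  have T0: "0 < T0" "T0 \<le> d0" "T0 \<le> d1" "T0 \<le> d2" "T0 \<le> d3" "T0 \<le> 1 / (8 * B\<^sup>2)"
    using d0 \<rho>(1) u(1) v(1) B by (auto simp: T0_def)
  have T0T: "ereal T0 < T" using T0(2) d0(2) by (metis ereal_less_eq(3) le_less_trans)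
  have sub: "{0..T0} \<subseteq> ?I"
    using T0T by (auto simp: time_interval_def intro: le_less_trans[of "ereal _" "ereal T0"])
  have I: "t \<in> ?I" "t \<le> d1" "t \<le> d2" "t \<le> d3" if "t \<in> {0..T0}" for t
    using that sub T0 by auto
  have sub': "{0..T0} \<times> UNIV \<subseteq> ?I \<times> (UNIV :: real set)" using sub by auto
  interpret classical_solution T0 B \<rho> "\<lambda>t. deriv (\<rho> t)" u "\<lambda>t. deriv (u t)" "\<lambda>t. deriv (deriv (u t))"
    v "\<lambda>t. deriv (v t)" "\<lambda>t. deriv (deriv (v t))"
  proof
    show "0 \<le> T0" using T0 by simp
    show "T0 * (8 * B\<^sup>2) \<le> 1" using T0(6) B by (simp add: field_simps)
    show "continuous_on ({0..T0} \<times> UNIV) (\<lambda>(t, x). \<rho> t x)" "continuous_on ({0..T0} \<times> UNIV) (\<lambda>(t, x). deriv (\<rho> t) x)"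
      using \<rho>(3)[of 0] \<rho>(3)[of 1] by (auto intro: continuous_on_subset[OF _ sub'])
    show "continuous_on ({0..T0} \<times> UNIV) (\<lambda>(t, x). u t x)" "continuous_on ({0..T0} \<times> UNIV) (\<lambda>(t, x). deriv (u t) x)"
      "continuous_on ({0..T0} \<times> UNIV) (\<lambda>(t, x). deriv (deriv (u t)) x)"
      using u(3)[of 0] u(3)[of 1] u(3)[of 2] by (auto simp: numeral_2_eq_2 intro: continuous_on_subset[OF _ sub'])
    show "continuous_on ({0..T0} \<times> UNIV) (\<lambda>(t, x). v t x)" "continuous_on ({0..T0} \<times> UNIV) (\<lambda>(t, x). deriv (v t) x)"
      "continuous_on ({0..T0} \<times> UNIV) (\<lambda>(t, x). deriv (deriv (v t)) x)"
      using v(3)[of 0] v(3)[of 1] v(3)[of 2] by (auto simp: numeral_2_eq_2 intro: continuous_on_subset[OF _ sub'])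
  next
    fix t x assume t: "t \<in> {0..T0}"
    note J = I[OF t]
    show "\<bar>\<rho> t x\<bar> \<le> B" using order_trans[OF \<rho>(4)[OF _ J(1,2), of 0 x] B(1)] by simp
    show "\<bar>u t x\<bar> \<le> B" using order_trans[OF u(4)[OF _ J(1,3), of 0 x] B(2)] by simp
    show "\<bar>deriv (u t) x\<bar> \<le> B" using order_trans[OF u(4)[OF _ J(1,3), of 1 x] B(2)] by simp
    show "\<bar>deriv (deriv (u t)) x\<bar> \<le> B" using order_trans[OF u(4)[OF _ J(1,3), of 2 x] B(2)] by (simp add: numeral_2_eq_2)
    show "\<bar>v t x\<bar> \<le> B" using order_trans[OF v(4)[OF _ J(1,4), of 0 x] B(3)] by simp
    show "\<bar>deriv (v t) x\<bar> \<le> B" using order_trans[OF v(4)[OF _ J(1,4), of 1 x] B(3)] by simp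
    show "\<bar>deriv (deriv (v t)) x\<bar> \<le> B" using order_trans[OF v(4)[OF _ J(1,4), of 2 x] B(3)] by (simp add: numeral_2_eq_2)
    show "(\<rho> t has_real_derivative deriv (\<rho> t) x) (at x)" using \<rho>(5)[of 0 t x] J(1) by simp
    show "(u t has_real_derivative deriv (u t) x) (at x)" using u(5)[of 0 t x] J(1) by simp
    show "(deriv (u t) has_real_derivative deriv (deriv (u t)) x) (at x)" using u(5)[of 1 t x] J(1) by simp
    show "(v t has_real_derivative deriv (v t) x) (at x)" using v(5)[of 0 t x] J(1) by simp
    show "(deriv (v t) has_real_derivative deriv (deriv (v t)) x) (at x)" using v(5)[of 1 t x] J(1) by simp
  next
    fix \<phi> t assume \<phi>: "test_function \<phi>" and t: "t \<in> {0..T0}"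
    show "((\<lambda>\<tau>. LINT x|lborel. \<rho> \<tau> x * \<phi> x) has_real_derivative
        (LINT x|lborel. \<rho> t x * u t x * v t x * deriv \<phi> x)) (at t within {0..T0})"
      using DERIV_subset[OF weak(1)[OF \<phi> I(1)[OF t]] sub] by (simp add: weak_rhs_\<rho>_def)
    show "((\<lambda>\<tau>. LINT x|lborel. (u \<tau> x - deriv (deriv (u \<tau>)) x) * \<phi> x) has_real_derivative
        (LINT x|lborel. (u t x - deriv (deriv (u t)) x) * deriv (\<lambda>y. u t y * v t y * \<phi> y) x
          - 3 * v t x * deriv (u t) x * (u t x - deriv (deriv (u t)) x) * \<phi> x - (\<rho> t x)\<^sup>2 * u t x * \<phi> x)) (at t within {0..T0})"
      using DERIV_subset[OF weak(2)[OF \<phi> I(1)[OF t]] sub] by (simp add: weak_rhs_m_def momentum_def)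
    show "((\<lambda>\<tau>. LINT x|lborel. (v \<tau> x - deriv (deriv (v \<tau>)) x) * \<phi> x) has_real_derivative
        (LINT x|lborel. (v t x - deriv (deriv (v t)) x) * deriv (\<lambda>y. u t y * v t y * \<phi> y) x
          - 3 * deriv (v t) x * u t x * (v t x - deriv (deriv (v t)) x) * \<phi> x + (\<rho> t x)\<^sup>2 * v t x * \<phi> x)) (at t within {0..T0})"
      using DERIV_subset[OF weak(3)[OF \<phi> I(1)[OF t]] sub] by (simp add: weak_rhs_n_def momentum_def)
  qed
  have fc: "continuous_on UNIV f"
    if "t \<in> {0..T0}" "f \<in> {\<rho> t, deriv (\<rho> t), u t, deriv (u t), deriv (deriv (u t)), v t, deriv (v t), deriv (deriv (v t))}" for f t
    using that(2) continuous_on_slice[OF cont(1) that(1)] continuous_on_slice[OF cont(2) that(1)]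
      continuous_on_slice[OF cont(3) that(1)] continuous_on_slice[OF cont(4) that(1)] continuous_on_slice[OF cont(5) that(1)]
      continuous_on_slice[OF cont(6) that(1)] continuous_on_slice[OF cont(7) that(1)] continuous_on_slice[OF cont(8) that(1)]
    by blast
  have "0 \<in> {0..T0}" using T0 by simp
  note fc0 = fc[OF this]
  \<comment> \<open>The norm of the initial data is an essential supremum, while the characteristics
    need its value at each foot point; continuity at time 0 bridges the two.\<close>
  have in0: "\<bar>f x\<bar> * log_weight \<beta> x \<le> C"
    if "f \<in> {\<rho> 0, deriv (\<rho> 0), u 0, deriv (u 0), deriv (deriv (u 0)), v 0, deriv (v 0), deriv (deriv (v 0))}" for f x
    by (rule weighted_linf_norm_pointwise[OF norm0[folded init] C \<beta> that fc0[OF that]])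
  have "weighted_linf_norm \<beta> (\<rho> t) (u t) (v t) \<le> ennreal (180 * C)" if t: "t \<in> {0..T0}" for t
  proof -
    have i: "\<bar>\<rho> 0 x\<bar> * log_weight \<beta> x \<le> C" "\<bar>deriv (\<rho> 0) x\<bar> * log_weight \<beta> x \<le> C"
      "\<bar>u 0 x\<bar> * log_weight \<beta> x \<le> C" "\<bar>deriv (deriv (u 0)) x\<bar> * log_weight \<beta> x \<le> C"
      "\<bar>v 0 x\<bar> * log_weight \<beta> x \<le> C" "\<bar>deriv (deriv (v 0)) x\<bar> * log_weight \<beta> x \<le> C" for x
      by (rule in0; simp)+
    note wb = weighted_bounds[where w = "log_weight \<beta>", OF log_weight_pos[OF \<beta>] log_weight_ratio[OF \<beta>] i t]
    show ?thesis
      by (rule weighted_linf_norm_le[OF fc[OF t] \<beta> C]) (assumption | rule wb)+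
  qed
  with T0(1) T0T
  show "\<exists>T\<^sub>0. 0 < T\<^sub>0 \<and> ereal T\<^sub>0 < T \<and> (\<forall>t\<in>{0..T\<^sub>0}. weighted_linf_norm \<beta> (\<rho> t) (u t) (v t) \<le> ennreal (180 * C))"
    by blast
qed

end
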